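(* Let $\mathcal G=(G_n)_{n\in\mathbb N}$ be an expander sequence and let $q\in(0,1]$. Then, for any choice of the initially informed vertex, with high probability (a) $T_{push}(G_n,q)=c_{push}(q)\log n+o(\log n)$, (b) $T_{pull}(G_n,q)=c_{pull}(q)\log n+o(\log n)$, (c) $T_{pp}(G_n,q)=c_{pp}(q)\log n+o(\log n)$.
   Context: Rumour spreading protocols on a connected graph $G=(V,E)$ with $n$ vertices, one vertex initially informed, proceeding in synchronous rounds; each message transmission succeeds independently with probability $q\in(0,1]$. push: in each round every informed vertex chooses a neighbour independently and uniformly at random and (if the transmission succeeds) informs it. pull: in each round every uninformed vertex chooses a neighbour independently and uniformly at random; if that neighbour is informed and the transmission succeeds, the asking vertex becomes informed. push\&pull (pp): in each round every vertex chooses a neighbour independently and uniformly at random, and if one of the two is informed (and the transmission succeeds) both become informed. $T_{\mathcal P}(G,q)$ is the number of rounds until all vertices are informed by protocol $\mathcal P\in\{push,pull,pp\}$. For $q\in(0,1)$: $c_{push}(q)=\frac{1}{\log(1+q)}+\frac1q$, $c_{pull}(q)=\frac{1}{\log(1+q)}-\frac{1}{\log(1-q)}$, $c_{pp}(q)=\frac{1}{\log(1+2q)}+\frac{1}{q-\log(1-q)}$, and $c_{\mathcal P}(1)=\lim_{q\to1}c_{\mathcal P}(q)$; $\log$ is the natural logarithm. A $(n,\delta,\Delta,\lambda)$-graph is a connected graph on $n$ vertices with minimum degree $\delta$, maximum degree $\Delta$, and $\lambda=\max\{|\mu_2|,|\mu_n|\}$ where $\mu_1\ge\dots\ge\mu_n$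 are the adjacency eigenvalues. A sequence $(G_n)$ with $G_n$ an $(n,\delta_n,\Delta_n,\lambda_n)$-graph is an expander sequence if $\Delta_n/\delta_n=1+o(1)$ and $\lambda_n=o(\Delta_n)$. "With high probability" (whp) means with probability $1-o(1)$ as $n\to\infty$. $a=b+o(f)$ means $a\in[b-g,b+g]$ for some positive $g=o(f)$; $a\le b+o(f)$ means $a\le b+g$ for some positive $g=o(f)$. *)

theory Defs
  imports "HOL-Probability.Probability" "Jordan_Normal_Form.Char_Poly" "HOL-Library.Landau_Symbols"
begin

definition simple_graph_on :: "nat \<Rightarrow> (nat \<Rightarrow> nat \<Rightarrow> bool) \<Rightarrow> bool" where
  "simple_graph_on n E \<longleftrightarrow> (\<forall>u v. E u v \<longrightarrow> u < n \<and> v < n \<and> u \<noteq> v \<and> E v u)"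

definition connected_graph_on :: "nat \<Rightarrow> (nat \<Rightarrow> nat \<Rightarrow> bool) \<Rightarrow> bool" where
  "connected_graph_on n E \<longleftrightarrow> simple_graph_on n E \<and> n \<ge> 1 \<and> (\<forall>u<n. \<forall>v<n. E\<^sup>*\<^sup>* u v)"

definition nbrs :: "(nat \<Rightarrow> nat \<Rightarrow> bool) \<Rightarrow> nat \<Rightarrow> nat set" where
  "nbrs E v = {u. E v u}"

definition degree :: "(nat \<Rightarrow> nat \<Rightarrow> bool) \<Rightarrow> nat \<Rightarrow> nat" where
  "degree E v = card (nbrs E v)"

definition min_degree :: "nat \<Rightarrow> (nat \<Rightarrow> nat \<Rightarrow> bool) \<Rightarrow> nat" where
  "min_degree n E = Min (degree E ` {..<n})"

definition max_degree :: "nat \<Rightarrow> (nat \<Rightarrow> nat \<Rightarrow> bool) \<Rightarrow> nat" where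
  "max_degree n E = Max (degree E ` {..<n})"

definition adj_mat :: "nat \<Rightarrow> (nat \<Rightarrow> nat \<Rightarrow> bool) \<Rightarrow> real Matrix.mat" where
  "adj_mat n E = Matrix.mat n n (\<lambda>(i,j). if E i j then 1 else 0)"

(* eigenvalues mu_1 >= ... >= mu_n, listed in decreasing order (with multiplicity),
   as the real roots of the characteristic polynomial (a real symmetric matrix has
   only real eigenvalues) *)
definition adj_eigenvalues :: "nat \<Rightarrow> (nat \<Rightarrow> nat \<Rightarrow> bool) \<Rightarrow> real list" where
  "adj_eigenvalues n E = rev (sorted_list_of_multiset (proots (char_poly (adj_mat n E))))"

definition spec_lambda :: "nat \<Rightarrow> (nat \<Rightarrow> nat \<Rightarrow> bool) \<Rightarrow> real" where
  "spec_lambda n E = max \<bar>adj_eigenvalues n E ! 1\<bar> \<bar>adj_eigenvalues n E ! (n - 1)\<bar>"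

definition expander_seq :: "(nat \<Rightarrow> nat \<Rightarrow> nat \<Rightarrow> bool) \<Rightarrow> bool" where
  "expander_seq G \<longleftrightarrow> (\<forall>n\<ge>1. connected_graph_on n (G n)) \<and>
     ((\<lambda>n. real (max_degree n (G n)) / real (min_degree n (G n))) \<longlonglongrightarrow> 1) \<and>
     ((\<lambda>n. spec_lambda n (G n) / real (max_degree n (G n))) \<longlonglongrightarrow> 0)"

datatype protocol = Push | Pull | PushPull

(* One synchronous round: each choosing vertex picks a uniform neighbour and
   the transmission succeeds independently with probability q. *)
definition choices :: "(nat \<Rightarrow> nat \<Rightarrow> bool) \<Rightarrow> real \<Rightarrow> nat set \<Rightarrow> (nat \<Rightarrow> nat \<times> bool) pmf" where
  "choices E q A = Pi_pmf A (0, False) (\<lambda>v. pair_pmf (pmf_of_set (nbrs E v)) (bernoulli_pmf q))"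

fun round_step :: "protocol \<Rightarrow> nat \<Rightarrow> (nat \<Rightarrow> nat \<Rightarrow> bool) \<Rightarrow> real \<Rightarrow> nat set \<Rightarrow> nat set pmf" where
  "round_step Push n E q S = map_pmf (\<lambda>f. S \<union> {fst (f v) | v. v \<in> S \<and> snd (f v)}) (choices E q S)"
| "round_step Pull n E q S = map_pmf (\<lambda>f. S \<union> {u. u \<in> {..<n} - S \<and> fst (f u) \<in> S \<and> snd (f u)})
      (choices E q ({..<n} - S))"
| "round_step PushPull n E q S = map_pmf (\<lambda>f. S \<union> {fst (f v) | v. v \<in> S \<and> snd (f v)}
                                      \<union> {v. v < n \<and> fst (f v) \<in> S \<and> snd (f v)})
      (choices E q {..<n})"

primrec informed_after :: "protocol \<Rightarrow> nat \<Rightarrow> (nat \<Rightarrow> nat \<Rightarrow> bool) \<Rightarrow> real \<Rightarrow> nat \<Rightarrow> nat \<Rightarrow> nat set pmf" where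
  "informed_after P n E q v0 0 = return_pmf {v0}"
| "informed_after P n E q v0 (Suc t) = informed_after P n E q v0 t \<bind> round_step P n E q"

definition prob_T_le_nat :: "protocol \<Rightarrow> nat \<Rightarrow> (nat \<Rightarrow> nat \<Rightarrow> bool) \<Rightarrow> real \<Rightarrow> nat \<Rightarrow> nat \<Rightarrow> real" where
  "prob_T_le_nat P n E q v0 t = pmf (informed_after P n E q v0 t) {..<n}"

definition prob_T_le :: "protocol \<Rightarrow> nat \<Rightarrow> (nat \<Rightarrow> nat \<Rightarrow> bool) \<Rightarrow> real \<Rightarrow> nat \<Rightarrow> real \<Rightarrow> real" where
  "prob_T_le P n E q v0 x = (if x < 0 then 0 else prob_T_le_nat P n E q v0 (nat \<lfloor>x\<rfloor>))"

definition prob_T_lt :: "protocol \<Rightarrow> nat \<Rightarrow> (nat \<Rightarrow> nat \<Rightarrow> bool) \<Rightarrow> real \<Rightarrow> nat \<Rightarrow> real \<Rightarrow> real" where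
  "prob_T_lt P n E q v0 x = (if x \<le> 0 then 0 else prob_T_le_nat P n E q v0 (nat (\<lceil>x\<rceil> - 1)))"

definition prob_T_in :: "protocol \<Rightarrow> nat \<Rightarrow> (nat \<Rightarrow> nat \<Rightarrow> bool) \<Rightarrow> real \<Rightarrow> nat \<Rightarrow> real \<Rightarrow> real \<Rightarrow> real" where
  "prob_T_in P n E q v0 a b = prob_T_le P n E q v0 b - prob_T_lt P n E q v0 a"

definition c_push0 :: "real \<Rightarrow> real" where "c_push0 q = 1 / ln (1 + q) + 1 / q"
definition c_pull0 :: "real \<Rightarrow> real" where "c_pull0 q = 1 / ln (1 + q) - 1 / ln (1 - q)"
definition c_pp0 :: "real \<Rightarrow> real" where "c_pp0 q = 1 / ln (1 + 2 * q) + 1 / (q - ln (1 - q))"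

definition c_const :: "protocol \<Rightarrow> real \<Rightarrow> real" where
  "c_const P q = (let f = (case P of Push \<Rightarrow> c_push0 | Pull \<Rightarrow> c_pull0 | PushPull \<Rightarrow> c_pp0)
                  in if q < 1 then f q else Lim (at_left 1) f)"

end

theory Submission
  imports Defs "Jordan_Normal_Form.Schur_Decomposition" "HOL-Real_Asymp.Real_Asymp"
begin

text \<open>The only spectral input is an upper bound for \<open>\<Sum>\<^sub>u d(u, S)\<^sup>2\<close>, the squared norm of the adjacency
  matrix applied to the indicator of a set \<open>S\<close>. Almost regularity and the spectral gap make it
  \<open>\<Delta>\<^sup>2 |S| (|S| / n + o(1))\<close>, so that the neighbourhoods of a small set hardly overlap. Given the
  informed set \<open>S\<close>, the events that different vertices stay uninformed in a round are pairwise
  negatively correlated, hence the number of newly informed (or of remaining uninformed) vertices has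
  variance at most its mean, and the expectation of \<open>1 / (L + X)\<close> is almost \<open>1 / (L + E X)\<close>.

  Every phase of the process is then controlled by a potential whose expectation is multiplied by at most a
  known constant per round, followed by Markov's inequality. For the upper bound these are
  \<open>1 / |S|\<close> while the informed set is small and the number of uninformed vertices afterwards;
  for the lower bound \<open>|S|\<close> during the growth and \<open>1 / (L + |V - S|)\<close> at the end.\<close>

subsection \<open>Spectral gap of the adjacency matrix\<close>

text \<open>Only two stretches of the process cost a constant multiple of log n. Between a large
  constant size and a small share of \<open>n\<close> the informed set grows by a factor close to
  \<open>1 + growth_rate P q\<close>; once few vertices are missing, each of them survives a round
  with probability close to \<open>survival P q 1\<close>. The logarithms of these two numbers give
  the two summands of the constants, and the start and the middle stretch need only \<epsilon> log n
  rounds. The obstacle at the start is that a single informed vertex allows no concentration, so the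
  drift of \<open>1 / |S|\<close> has to be a true contraction already at \<open>|S| = 1\<close>;
  this is why a second-order term is kept there. The factor \<open>exp (- q)\<close> in the push
  constant requires degrees tending to infinity. This is not assumed, but follows from the
  neighbour-count bound applied to one vertex. If every pull succeeds, the limiting survival
  probability is 0 and the last stretch costs o(log n). All limits are first taken for a fixed
  \<epsilon>; a diagonal argument then produces the o(log n) window.\<close>

text \<open>The Hermitian form \<open>s\<close> of the eigenvector equals its own conjugate by
  symmetry, and it is \<open>e\<close> times the positive squared norm \<open>N\<close>.\<close>

lemma symmetric_complex_eigenvalue_real:
  fixes a :: "nat \<Rightarrow> nat \<Rightarrow> real" and z :: "nat \<Rightarrow> complex"
  assumes sym: "\<And>i j. i < n \<Longrightarrow> j < n \<Longrightarrow> a i j = a j i"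
    and eig: "\<And>i. i < n \<Longrightarrow> (\<Sum>j<n. of_real (a i j) * z j) = e * z i"
    and nz: "i0 < n" "z i0 \<noteq> 0"
  shows "Im e = 0"
proof -
  define s where "s = (\<Sum>i<n. cnj (z i) * (\<Sum>j<n. of_real (a i j) * z j))"
  define N where "N = (\<Sum>i<n. (cmod (z i))\<^sup>2)"
  have "s = (\<Sum>i<n. e * of_real ((cmod (z i))\<^sup>2))"
    unfolding s_def by (intro sum.cong refl) (simp add: eig complex_norm_square del: of_real_power)
  then have s1: "s = e * of_real N" by (simp add: N_def sum_distrib_left)
  have "cnj s = (\<Sum>i<n. \<Sum>j<n. z i * (of_real (a i j) * cnj (z j)))"
    by (simp add: s_def sum_distrib_left)
  also have "\<dots> = (\<Sum>j<n. \<Sum>i<n. z i * (of_real (a i j) * cnj (z j)))"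
    by (rule sum.swap)
  also have "\<dots> = s"
    unfolding s_def sum_distrib_left by (intro sum.cong refl) (simp add: sym mult_ac)
  finally have "Im s = 0" by (simp add: complex_eq_iff)
  moreover have "(cmod (z i0))\<^sup>2 \<le> N"
    unfolding N_def by (rule member_le_sum) (use nz in auto)
  then have "N > 0" using nz by (smt (verit) zero_less_norm_iff zero_less_power)
  ultimately show ?thesis by (simp add: s1)
qed

lemma mult_mat_vec_sum:
  assumes "A \<in> carrier_mat n n" "v \<in> carrier_vec n" "i < n"
  shows "vec_index (A *\<^sub>v v) i = (\<Sum>j<n. A $$ (i, j) * vec_index v j)"
  using assms by (auto simp: scalar_prod_def atLeast0LessThan intro!: sum.cong)

lemma mult_mat_sum:
  assumes "A \<in> carrier_mat n n" "B \<in> carrier_mat n n" "i < n" "j < n"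
  shows "(A * B) $$ (i, j) = (\<Sum>k<n. A $$ (i, k) * B $$ (k, j))"
  using assms by (auto simp: scalar_prod_def atLeast0LessThan intro!: sum.cong)

text \<open>Turns a library eigenvector into a function on indices, since the spectral estimates are
  carried out with plain finite sums.\<close>

lemma eigenvalue_sum_form:
  assumes A: "A \<in> carrier_mat n n" and "eigenvalue A e"
  obtains v where "\<And>i. i < n \<Longrightarrow> (\<Sum>j<n. A $$ (i, j) * v j) = e * v i" "\<exists>i<n. v i \<noteq> 0"
proof -
  from assms obtain w where w: "w \<in> carrier_vec n" "w \<noteq> 0\<^sub>v n" "A *\<^sub>v w = e \<cdot>\<^sub>v w"
    unfolding eigenvalue_def eigenvector_def by auto
  show ?thesis
  proof (rule that[of "vec_index w"])
    fix i assume i: "i < n"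
    have "vec_index (A *\<^sub>v w) i = vec_index (e \<cdot>\<^sub>v w) i" using w by simp
    then show "(\<Sum>j<n. A $$ (i, j) * vec_index w j) = e * vec_index w i"
      using mult_mat_vec_sum[OF A w(1) i] i w(1) by simp
  next
    show "\<exists>i<n. vec_index w i \<noteq> 0"
    proof (rule ccontr)
      assume "\<not> ?thesis"
      then have "w = 0\<^sub>v n" using w(1) by (intro eq_vecI) auto
      with w show False by simp
    qed
  qed
qed

text \<open>The characteristic polynomial factors over the complex numbers; its roots are real, so
  the factorisation descends along the injective embedding of the reals.\<close>

lemma symmetric_char_poly_splits:
  fixes A :: "real mat"
  assumes A: "A \<in> carrier_mat n n" and sym: "\<And>i j. i < n \<Longrightarrow> j < n \<Longrightarrow> A $$ (i, j) = A $$ (j, i)"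
  obtains es where "char_poly A = (\<Prod>e\<leftarrow>es. [:- e, 1:])" "length es = n"
proof -
  define C where "C = map_mat complex_of_real A"
  have C: "C \<in> carrier_mat n n" using A by (simp add: C_def)
  obtain as where as: "char_poly C = (\<Prod>a\<leftarrow>as. [:- a, 1:])" "length as = n"
    using char_poly_factorized[OF C] by blast
  have real: "Im a = 0" if "a \<in> set as" for a
  proof -
    have "poly (char_poly C) a = 0"
      using that by (auto simp: as(1) poly_prod_list prod_list_zero_iff o_def)
    then have "eigenvalue C a" using eigenvalue_root_char_poly[OF C] by simp
    then obtain v i0 where v: "\<And>i. i < n \<Longrightarrow> (\<Sum>j<n. C $$ (i, j) * v j) = a * v i"
      "i0 < n" "v i0 \<noteq> 0"
      using eigenvalue_sum_form[OF C] by metis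
    show ?thesis
      by (rule symmetric_complex_eigenvalue_real[of n "\<lambda>i j. A $$ (i, j)" v a i0])
         (use v sym A in \<open>auto simp: C_def\<close>)
  qed
  define es where "es = map Re as"
  have as_es: "as = map complex_of_real es"
    using real by (auto simp: es_def o_def complex_eq_iff intro!: map_idI[symmetric])
  interpret h: map_poly_inj_comm_ring_hom complex_of_real ..
  have "map_poly complex_of_real (char_poly A) = char_poly C"
    unfolding C_def by (rule of_real_hom.char_poly_hom[OF A, symmetric])
  also have "\<dots> = map_poly complex_of_real (\<Prod>e\<leftarrow>es. [:- e, 1:])"
    unfolding as as_es by (simp add: h.hom_prod_list o_def)
  finally have "char_poly A = (\<Prod>e\<leftarrow>es. [:- e, 1:])" by simp
  with as show ?thesis by (intro that[of es]) (auto simp: es_def)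
qed

lemma proots_prod_linear:
  fixes es :: "real list"
  shows "proots (\<Prod>e\<leftarrow>es. [:- e, 1:]) = mset es"
proof (induction es)
  case (Cons e es)
  have "(\<Prod>e\<leftarrow>es. [:- e, 1:]) \<noteq> 0" by (auto simp: prod_list_zero_iff)
  with Cons show ?case by (simp add: proots_mult del: mult_pCons_left)
qed auto

lemma adj_mat_carrier: "adj_mat n E \<in> carrier_mat n n"
  by (simp add: adj_mat_def)

lemma adj_mat_index: "i < n \<Longrightarrow> j < n \<Longrightarrow> adj_mat n E $$ (i, j) = (if E i j then 1 else 0)"
  by (simp add: adj_mat_def)

text \<open>\<open>adj_eigenvalues\<close> is defined through \<open>proots\<close>, which would
  silently omit non-real roots. Splitting over the reals shows that the list is complete, so
  indexing up to \<open>n - 1\<close> is meaningful.\<close>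

lemma adj_eigenvalues_char_poly:
  assumes "simple_graph_on n E"
  shows "char_poly (adj_mat n E) = (\<Prod>e\<leftarrow>adj_eigenvalues n E. [:- e, 1:])"
    and "length (adj_eigenvalues n E) = n"
proof -
  have sym: "adj_mat n E $$ (i, j) = adj_mat n E $$ (j, i)" if "i < n" "j < n" for i j
    using that assms by (auto simp: adj_mat_index simple_graph_on_def)
  obtain es where es: "char_poly (adj_mat n E) = (\<Prod>e\<leftarrow>es. [:- e, 1:])" "length es = n"
    using symmetric_char_poly_splits[OF adj_mat_carrier sym] by blast
  have m: "mset (adj_eigenvalues n E) = mset es"
    by (simp add: adj_eigenvalues_def es proots_prod_linear)
  then show "length (adj_eigenvalues n E) = n" using es(2) mset_eq_length by metis
  have "mset (map (\<lambda>e. [:- e, 1:]) (adj_eigenvalues n E)) = mset (map (\<lambda>e. [:- e, 1:]) es)"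
    by (simp add: m)
  then show "char_poly (adj_mat n E) = (\<Prod>e\<leftarrow>adj_eigenvalues n E. [:- e, 1:])"
    by (metis es(1) prod_mset_prod_list)
qed

text \<open>In the decreasing list every later entry lies between the entries at 1 and
  \<open>n - 1\<close>, the two that define \<open>spec_lambda\<close>.\<close>

lemma adj_eigenvalues_abs_le:
  assumes "simple_graph_on n E" "1 \<le> i" "i < n"
  shows "\<bar>adj_eigenvalues n E ! i\<bar> \<le> spec_lambda n E"
proof -
  let ?l = "adj_eigenvalues n E"
  have len: "length ?l = n" by (rule adj_eigenvalues_char_poly(2)[OF assms(1)])
  have "sorted (rev ?l)" by (simp add: adj_eigenvalues_def)
  then have mono: "?l ! j \<le> ?l ! i" if "i \<le> j" "j < n" for i j
    by (rule sorted_rev_nth_mono) (use that len in auto)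
  have "?l ! i \<le> ?l ! 1" "?l ! (n - 1) \<le> ?l ! i"
    using assms by (auto intro!: mono)
  then show ?thesis by (auto simp: spec_lambda_def)
qed

section \<open>Traces of powers and the gap after the first eigenvalue\<close>

lemma upper_triangular_pow:
  fixes B :: "real mat"
  assumes B: "B \<in> carrier_mat n n" "upper_triangular B"
  shows "upper_triangular (B ^\<^sub>m k) \<and> (\<forall>i<n. (B ^\<^sub>m k) $$ (i, i) = (B $$ (i, i)) ^ k)"
proof (induction k)
  case 0
  then show ?case using B by simp
next
  case (Suc k)
  have Bk: "B ^\<^sub>m k \<in> carrier_mat n n" using B by simp
  have idx: "(B ^\<^sub>m Suc k) $$ (i, j) = (\<Sum>l<n. (B ^\<^sub>m k) $$ (i, l) * B $$ (l, j))" if "i < n" "j < n" for i j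
    using mult_mat_sum[OF Bk B(1) that] by simp
  have z: "(B ^\<^sub>m k) $$ (i, l) * B $$ (l, j) = 0" if "i < n" "j < n" "l < n" "j < i \<or> (j = i \<and> l \<noteq> i)" for i j l
  proof (cases "l < i")
    case True
    then show ?thesis using Suc Bk that upper_triangularD[of "B ^\<^sub>m k" l i] by auto
  next
    case False
    then have "j < l" using that by auto
    then show ?thesis using B that upper_triangularD[of B j l] by auto
  qed
  show ?case
  proof (intro conjI allI impI upper_triangularI)
    fix i j assume "j < i" "i < dim_row (B ^\<^sub>m Suc k)"
    then show "(B ^\<^sub>m Suc k) $$ (i, j) = 0"
      using B by (subst idx) (auto intro!: sum.neutral simp: z)
  next
    fix i assume i: "i < n"
    have "(B ^\<^sub>m Suc k) $$ (i, i) = (\<Sum>l\<in>{i}. (B ^\<^sub>m k) $$ (i, l) * B $$ (l, i))"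
      unfolding idx[OF i i] by (rule sum.mono_neutral_right) (use i z in auto)
    then show "(B ^\<^sub>m Suc k) $$ (i, i) = (B $$ (i, i)) ^ Suc k" using Suc i by simp
  qed
qed

text \<open>A Schur triangularisation has the eigenvalues on its diagonal, and the trace is
  unchanged by cyclic shifts. Such power traces take the place of an orthonormal eigenbasis.\<close>

lemma trace_pow_eigenvalues:
  fixes A :: "real mat"
  assumes A: "A \<in> carrier_mat n n" and es: "char_poly A = (\<Prod>e\<leftarrow>es. [:- e, 1:])"
  shows "(\<Sum>i<n. (A ^\<^sub>m k) $$ (i, i)) = (\<Sum>i<n. (es ! i) ^ k)"
proof -
  obtain B P Q where S: "schur_decomposition A es = (B, P, Q)"
    by (cases "schur_decomposition A es") auto
  from schur_decomposition[OF A es S]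
  have wit: "similar_mat_wit A B P Q" and ut: "upper_triangular B" and dg: "diag_mat B = es" by auto
  note D = similar_mat_witD2[OF A wit]
  have B: "B \<in> carrier_mat n n" and P: "P \<in> carrier_mat n n" and Q: "Q \<in> carrier_mat n n"
    using D by auto
  define M where "M = B ^\<^sub>m k"
  have M: "M \<in> carrier_mat n n" using B by (simp add: M_def)
  have PM: "P * M \<in> carrier_mat n n" using P M by simp
  have Ak: "A ^\<^sub>m k = P * M * Q" unfolding M_def by (rule similar_mat_wit_pow_id[OF wit])
  have QP: "Q * P = 1\<^sub>m n" using D by auto
  have "(\<Sum>i<n. (A ^\<^sub>m k) $$ (i, i)) = (\<Sum>i<n. \<Sum>j<n. (P * M) $$ (i, j) * Q $$ (j, i))"
    unfolding Ak by (intro sum.cong refl) (simp add: mult_mat_sum[OF PM Q] del: index_mult_mat)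
  also have "\<dots> = (\<Sum>j<n. \<Sum>i<n. Q $$ (j, i) * (P * M) $$ (i, j))"
    by (subst sum.swap) (simp add: mult_ac)
  also have "\<dots> = (\<Sum>j<n. (Q * (P * M)) $$ (j, j))"
    by (intro sum.cong refl) (simp add: mult_mat_sum[OF Q PM] del: index_mult_mat)
  also have "Q * (P * M) = M"
    using QP assoc_mult_mat[OF Q P M] M by simp
  also have "(\<Sum>j<n. M $$ (j, j)) = (\<Sum>i<n. (es ! i) ^ k)"
    using upper_triangular_pow[OF B ut, of k] B
    by (auto intro!: sum.cong simp: M_def dg[symmetric] diag_mat_def)
  finally show ?thesis .
qed

text \<open>A constant factor \<open>N\<close> is harmless under growing powers: if
  \<open>b / c > 1\<close>, its powers would exceed \<open>N\<close>. The case \<open>c = 0\<close>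
  is decided by the exponent 1.\<close>

lemma le_if_pow_le:
  fixes b c N :: real
  assumes "0 \<le> b" "0 \<le> c" and le: "\<And>j. b ^ (2 ^ j) \<le> N * c ^ (2 ^ j)"
  shows "b \<le> c"
proof (rule ccontr)
  assume "\<not> b \<le> c"
  then have bc: "c < b" by simp
  show False
  proof (cases "c = 0")
    case True
    then show False using le[of 0] bc by simp
  next
    case False
    then have c: "c > 0" using assms by simp
    then have q: "b / c > 1" using bc by simp
    then obtain j where j: "N < (b / c) ^ j" using real_arch_pow by blast
    also have "(b / c) ^ j \<le> (b / c) ^ (2 ^ j)"
      using q by (intro power_increasing) (auto simp: less_imp_le[OF less_exp])
    also have "\<dots> \<le> N" using le[of j] c by (simp add: power_divide divide_le_eq)
    finally show False by simp
  qed
qed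

text \<open>Bessel's inequality for two orthonormal vectors, by expanding the squared norm of the
  residual.\<close>

lemma bessel_two:
  fixes r v y :: "nat \<Rightarrow> real"
  assumes "(\<Sum>i<n. (v i)\<^sup>2) = 1" "(\<Sum>i<n. (y i)\<^sup>2) = 1" "(\<Sum>i<n. v i * y i) = 0"
  shows "(\<Sum>i<n. r i * v i)\<^sup>2 + (\<Sum>i<n. r i * y i)\<^sup>2 \<le> (\<Sum>i<n. (r i)\<^sup>2)"
proof -
  define \<alpha> where "\<alpha> = (\<Sum>i<n. r i * v i)"
  define \<beta> where "\<beta> = (\<Sum>i<n. r i * y i)"
  have "0 \<le> (\<Sum>i<n. (r i - \<alpha> * v i - \<beta> * y i)\<^sup>2)" by (intro sum_nonneg) simp
  also have "\<dots> = (\<Sum>i<n. (r i)\<^sup>2 + \<alpha>\<^sup>2 * (v i)\<^sup>2 + \<beta>\<^sup>2 * (y i)\<^sup>2 - 2 * \<alpha> * (r i * v i)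
      - 2 * \<beta> * (r i * y i) + 2 * \<alpha> * \<beta> * (v i * y i))"
    by (intro sum.cong refl) (simp add: power2_eq_square algebra_simps)
  also have "\<dots> = (\<Sum>i<n. (r i)\<^sup>2) + \<alpha>\<^sup>2 * (\<Sum>i<n. (v i)\<^sup>2) + \<beta>\<^sup>2 * (\<Sum>i<n. (y i)\<^sup>2)
      - 2 * \<alpha> * \<alpha> - 2 * \<beta> * \<beta> + 2 * \<alpha> * \<beta> * (\<Sum>i<n. v i * y i)"
    by (simp add: sum.distrib sum_subtractf sum_distrib_left \<alpha>_def \<beta>_def)
  finally show ?thesis using assms by (simp add: \<alpha>_def \<beta>_def power2_eq_square)
qed

lemma pow_mat_add:
  fixes A :: "'a :: semiring_1 mat"
  assumes A: "A \<in> carrier_mat n n"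
  shows "A ^\<^sub>m (k + l) = A ^\<^sub>m k * A ^\<^sub>m l"
proof (induction l)
  case (Suc l)
  have "A ^\<^sub>m k \<in> carrier_mat n n" "A ^\<^sub>m l \<in> carrier_mat n n" using A by auto
  with Suc show ?case using assoc_mult_mat[of "A ^\<^sub>m k" n n "A ^\<^sub>m l" n A n] A by simp
qed (use A in simp)

lemma symmetric_pow_mat:
  fixes A :: "real mat"
  assumes A: "A \<in> carrier_mat n n" and sym: "\<And>i j. i < n \<Longrightarrow> j < n \<Longrightarrow> A $$ (i, j) = A $$ (j, i)"
  shows "i < n \<Longrightarrow> j < n \<Longrightarrow> (A ^\<^sub>m k) $$ (i, j) = (A ^\<^sub>m k) $$ (j, i)"
proof -
  have t: "transpose_mat A = A" using A sym by (intro eq_matI) auto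
  have "transpose_mat (A ^\<^sub>m k) = A ^\<^sub>m k"
  proof (induction k)
    case (Suc k)
    have "A ^\<^sub>m k * A = A * A ^\<^sub>m k" using A
      using pow_mat_add[OF A, of k 1] pow_mat_add[OF A, of 1 k] by (simp add: add.commute)
    moreover have "transpose_mat (A ^\<^sub>m k * A) = transpose_mat A * transpose_mat (A ^\<^sub>m k)"
      by (rule transpose_mult[of _ n n _ n]) (use A in auto)
    ultimately show ?case using Suc t by simp
  qed (use A in simp)
  then show "i < n \<Longrightarrow> j < n \<Longrightarrow> (A ^\<^sub>m k) $$ (i, j) = (A ^\<^sub>m k) $$ (j, i)"
    using A by (metis index_transpose_mat(1) pow_carrier_mat carrier_matD)
qed

text \<open>For a unit vector \<open>y\<close> orthogonal to the unit eigenvector of \<open>\<mu>\<close> one has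
  \<open>\<mu>\<^sup>2\<^sup>k + \<parallel>A\<^sup>k y\<parallel>\<^sup>2 \<le> tr A\<^sup>2\<^sup>k\<close>, and \<open>\<parallel>A y\<parallel>\<^sup>2\<^sup>k \<le> \<parallel>A\<^sup>k y\<parallel>\<^sup>2\<close> for powers of two \<open>k\<close>;
  let \<open>k\<close> tend to infinity.\<close>

lemma spectral_gap_unit:
  fixes A :: "real mat" and v y :: "nat \<Rightarrow> real"
  assumes A: "A \<in> carrier_mat n n" and sym: "\<And>i j. i < n \<Longrightarrow> j < n \<Longrightarrow> A $$ (i, j) = A $$ (j, i)"
    and n: "n \<ge> 1"
    and es: "char_poly A = (\<Prod>e\<leftarrow>es. [:- e, 1:])" and lam: "\<And>i. 1 \<le> i \<Longrightarrow> i < n \<Longrightarrow> \<bar>es ! i\<bar> \<le> lam" "0 \<le> lam"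
    and eig: "\<And>i. i < n \<Longrightarrow> (\<Sum>j<n. A $$ (i, j) * v j) = es ! 0 * v i"
    and v: "(\<Sum>i<n. (v i)\<^sup>2) = 1" and y: "(\<Sum>i<n. (y i)\<^sup>2) = 1" and vy: "(\<Sum>i<n. v i * y i) = 0"
  shows "(\<Sum>i<n. (\<Sum>j<n. A $$ (i, j) * y j)\<^sup>2) \<le> lam\<^sup>2"
proof -
  define M where "M = (\<lambda>k i j. (A ^\<^sub>m k) $$ (i, j))"
  define app where "app = (\<lambda>k (z :: nat \<Rightarrow> real) i. \<Sum>j<n. M k i j * z j)"
  have Mc: "A ^\<^sub>m k \<in> carrier_mat n n" for k using A by simp
  have Msym: "M k i j = M k j i" if "i < n" "j < n" for k i j
    unfolding M_def using symmetric_pow_mat[OF A sym] that by blast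
  have Madd: "M (k + l) i j = (\<Sum>m<n. M k i m * M l m j)" if "i < n" "j < n" for k l i j
    unfolding M_def pow_mat_add[OF A] using mult_mat_sum[OF Mc Mc that] .
  have appv: "app k v i = (es ! 0) ^ k * v i" if "i < n" for k i
    using that
  proof (induction k arbitrary: i)
    case 0
    have "app 0 v i = (\<Sum>j<n. if j = i then v j else 0)"
      unfolding app_def M_def using 0 A by (intro sum.cong refl) auto
    then show ?case using 0 by simp
  next
    case (Suc k)
    have "app (Suc k) v i = (\<Sum>j<n. (\<Sum>m<n. M k i m * A $$ (m, j)) * v j)"
      unfolding app_def using Madd[of i _ k 1] Suc A by (intro sum.cong refl) (simp add: M_def)
    also have "\<dots> = (\<Sum>m<n. M k i m * (\<Sum>j<n. A $$ (m, j) * v j))"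
      unfolding sum_distrib_right sum_distrib_left by (subst sum.swap) (simp add: mult_ac)
    also have "\<dots> = (\<Sum>m<n. es ! 0 * (M k i m * v m))"
      using eig by (intro sum.cong refl) simp
    also have "\<dots> = es ! 0 * app k v i" by (simp add: app_def sum_distrib_left)
    finally show ?case using Suc by simp
  qed
  \<comment> \<open>\<open>app k v i\<close> and \<open>app k y i\<close> are the inner products of
    row \<open>i\<close> of the power with two orthonormal vectors, so Bessel applies row by row.
    The squared entries add up to the trace of the doubled power.\<close>
  have tr: "((es ! 0) ^ k)\<^sup>2 + (\<Sum>i<n. (app k y i)\<^sup>2) \<le> (\<Sum>i<n. (es ! i) ^ (2 * k))" for k
  proof -
    have "((es ! 0) ^ k)\<^sup>2 = (\<Sum>i<n. (app k v i)\<^sup>2)"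
      using v by (simp add: appv power_mult_distrib flip: sum_distrib_left)
    then have "((es ! 0) ^ k)\<^sup>2 + (\<Sum>i<n. (app k y i)\<^sup>2) = (\<Sum>i<n. (app k v i)\<^sup>2 + (app k y i)\<^sup>2)"
      by (simp add: sum.distrib)
    also have "\<dots> \<le> (\<Sum>i<n. \<Sum>j<n. (M k i j)\<^sup>2)"
      unfolding app_def by (intro sum_mono bessel_two v y vy)
    also have "\<dots> = (\<Sum>i<n. M (k + k) i i)"
      by (intro sum.cong refl) (simp add: Madd Msym power2_eq_square)
    also have "\<dots> = (\<Sum>i<n. (es ! i) ^ (2 * k))"
      using trace_pow_eigenvalues[OF A es, of "2 * k"] by (simp add: M_def mult_2)
    finally show ?thesis .
  qed
  \<comment> \<open>The power of \<open>es ! 0\<close> contributed by \<open>v\<close> cancels the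
    first summand of the trace, and only entries bounded by \<open>lam\<close> remain.\<close>
  have bound: "(\<Sum>i<n. (app k y i)\<^sup>2) \<le> real n * (lam\<^sup>2) ^ k" for k
  proof -
    have "(\<Sum>i<n. (es ! i) ^ (2 * k)) = (es ! 0) ^ (2 * k) + (\<Sum>i\<in>{1..<n}. (es ! i) ^ (2 * k))"
      using n by (simp add: lessThan_atLeast0 sum.atLeast_Suc_lessThan)
    moreover have "(es ! 0) ^ (2 * k) = ((es ! 0) ^ k)\<^sup>2" by (simp add: power_even_eq)
    ultimately have "(\<Sum>i<n. (app k y i)\<^sup>2) \<le> (\<Sum>i\<in>{1..<n}. (es ! i) ^ (2 * k))"
      using tr[of k] by linarith
    also have "\<dots> \<le> (\<Sum>i\<in>{1..<n}. (lam\<^sup>2) ^ k)"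
    proof (intro sum_mono)
      fix i assume "i \<in> {1..<n}"
      then have "\<bar>es ! i\<bar> ^ (2 * k) \<le> lam ^ (2 * k)" by (intro power_mono) (auto simp: lam)
      then show "(es ! i) ^ (2 * k) \<le> (lam\<^sup>2) ^ k" by (simp add: power_mult)
    qed
    also have "\<dots> \<le> real n * (lam\<^sup>2) ^ k" by (simp add: mult_right_mono)
    finally show ?thesis .
  qed
  \<comment> \<open>By symmetry the squared norm of \<open>app k y\<close> is the inner product of
    \<open>y\<close> with \<open>app (k + k) y\<close>; then Cauchy-Schwarz with the unit vector
    \<open>y\<close>.\<close>
  have dbl: "(\<Sum>i<n. (app k y i)\<^sup>2)\<^sup>2 \<le> (\<Sum>i<n. (app (k + k) y i)\<^sup>2)" for k
  proof -
    have "(\<Sum>i<n. (app k y i)\<^sup>2) = (\<Sum>i<n. \<Sum>j<n. \<Sum>l<n. (M k i j * y j) * (M k i l * y l))"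
      by (simp add: app_def power2_eq_square sum_product)
    also have "\<dots> = (\<Sum>j<n. \<Sum>i<n. \<Sum>l<n. (M k i j * y j) * (M k i l * y l))"
      by (rule sum.swap)
    also have "\<dots> = (\<Sum>j<n. \<Sum>l<n. \<Sum>i<n. (M k i j * y j) * (M k i l * y l))"
      by (intro sum.cong refl sum.swap)
    also have "\<dots> = (\<Sum>j<n. \<Sum>l<n. \<Sum>i<n. y j * (M k j i * M k i l * y l))"
      by (intro sum.cong refl) (simp add: Msym mult_ac)
    also have "\<dots> = (\<Sum>j<n. y j * app (k + k) y j)"
      unfolding app_def sum_distrib_left by (intro sum.cong refl)
        (simp add: Madd sum_distrib_right sum_distrib_left)
    finally have "(\<Sum>i<n. (app k y i)\<^sup>2)\<^sup>2 = (\<Sum>j<n. y j * app (k + k) y j)\<^sup>2" by simp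
    also have "\<dots> \<le> (\<Sum>i<n. (y i)\<^sup>2) * (\<Sum>i<n. (app (k + k) y i)\<^sup>2)"
      by (rule Cauchy_Schwarz_ineq_sum)
    finally show ?thesis using y by simp
  qed
  have "(\<Sum>i<n. (app 1 y i)\<^sup>2) ^ (2 ^ j) \<le> (\<Sum>i<n. (app (2 ^ j) y i)\<^sup>2)" for j
  proof (induction j)
    case (Suc j)
    have "(\<Sum>i<n. (app 1 y i)\<^sup>2) ^ (2 ^ Suc j) = ((\<Sum>i<n. (app 1 y i)\<^sup>2) ^ (2 ^ j))\<^sup>2"
      by (simp add: power_mult[symmetric] mult.commute)
    also have "\<dots> \<le> (\<Sum>i<n. (app (2 ^ j) y i)\<^sup>2)\<^sup>2"
      by (intro power_mono Suc) (intro zero_le_power sum_nonneg zero_le_power2)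
    also have "\<dots> \<le> (\<Sum>i<n. (app (2 ^ Suc j) y i)\<^sup>2)"
      using dbl[of "2 ^ j"] by (simp add: mult_2)
    finally show ?case .
  qed simp
  then have "(\<Sum>i<n. (app 1 y i)\<^sup>2) ^ (2 ^ j) \<le> real n * (lam\<^sup>2) ^ (2 ^ j)" for j
    using bound[of "2 ^ j"] by (meson order_trans)
  then have "(\<Sum>i<n. (app 1 y i)\<^sup>2) \<le> lam\<^sup>2"
    by (rule le_if_pow_le[OF sum_nonneg[OF zero_le_power2] zero_le_power2])
  moreover have "app 1 y i = (\<Sum>j<n. A $$ (i, j) * y j)" for i
    using A by (simp add: app_def M_def)
  ultimately show ?thesis by simp
qed

text \<open>Interface to the combinatorial part: after normalising the eigenvector and rescaling
  \<open>y\<close>, matrices and eigenvalue lists no longer occur.\<close>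

lemma adj_spectral_gap:
  assumes E: "simple_graph_on n E" and n: "n \<ge> 1" and lam: "0 \<le> spec_lambda n E"
  obtains v :: "nat \<Rightarrow> real" and \<mu> where
    "(\<Sum>i<n. (v i)\<^sup>2) = 1"
    "\<And>i. i < n \<Longrightarrow> (\<Sum>j<n. (if E i j then 1 else 0) * v j) = \<mu> * v i"
    "\<And>y :: nat \<Rightarrow> real. (\<Sum>i<n. v i * y i) = 0 \<Longrightarrow>
       (\<Sum>i<n. (\<Sum>j<n. (if E i j then 1 else 0) * y j)\<^sup>2) \<le> (spec_lambda n E)\<^sup>2 * (\<Sum>i<n. (y i)\<^sup>2)"
proof -
  let ?A = "adj_mat n E" and ?es = "adj_eigenvalues n E"
  note A = adj_mat_carrier[of n E]
  note es = adj_eigenvalues_char_poly[OF E]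
  have sym: "?A $$ (i, j) = ?A $$ (j, i)" if "i < n" "j < n" for i j
    using that E by (auto simp: adj_mat_index simple_graph_on_def)
  have "?es ! 0 \<in> set ?es" using es(2) n by (intro nth_mem) simp
  then have "poly (char_poly ?A) (?es ! 0) = 0"
    by (auto simp: es(1) poly_prod_list prod_list_zero_iff o_def)
  then have "eigenvalue ?A (?es ! 0)" using eigenvalue_root_char_poly[OF A] by simp
  then obtain v0 i0 where v0: "\<And>i. i < n \<Longrightarrow> (\<Sum>j<n. ?A $$ (i, j) * v0 j) = ?es ! 0 * v0 i"
    "i0 < n" "v0 i0 \<noteq> 0"
    using eigenvalue_sum_form[OF A] by metis
  define N where "N = (\<Sum>i<n. (v0 i)\<^sup>2)"
  have "(v0 i0)\<^sup>2 \<le> N" unfolding N_def by (rule member_le_sum) (use v0 in auto)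
  then have N: "N > 0" using v0(3) by (smt (verit) zero_less_power2)
  define v where "v = (\<lambda>i. v0 i / sqrt N)"
  have v1: "(\<Sum>i<n. (v i)\<^sup>2) = 1"
    using N by (simp add: v_def power_divide N_def[symmetric] flip: sum_divide_distrib)
  have veig: "(\<Sum>j<n. ?A $$ (i, j) * v j) = ?es ! 0 * v i" if "i < n" for i
    using v0(1)[OF that] by (simp add: v_def flip: sum_divide_distrib)
  have gap: "(\<Sum>i<n. (\<Sum>j<n. ?A $$ (i, j) * y j)\<^sup>2) \<le> (spec_lambda n E)\<^sup>2 * (\<Sum>i<n. (y i)\<^sup>2)"
    if vy: "(\<Sum>i<n. v i * y i) = 0" for y :: "nat \<Rightarrow> real"
  proof (cases "(\<Sum>i<n. (y i)\<^sup>2) = 0")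
    case True
    then have "y i = 0" if "i < n" for i using that by (simp add: sum_nonneg_eq_0_iff)
    then show ?thesis by simp
  next
    case False
    define Y where "Y = (\<Sum>i<n. (y i)\<^sup>2)"
    have Y: "Y > 0" using False unfolding Y_def by (simp add: order.strict_iff_order sum_nonneg)
    define y' where "y' = (\<lambda>i. y i / sqrt Y)"
    have "(\<Sum>i<n. (\<Sum>j<n. ?A $$ (i, j) * y' j)\<^sup>2) \<le> (spec_lambda n E)\<^sup>2"
    proof (rule spectral_gap_unit[OF A sym n es(1) _ lam veig v1])
      show "(\<Sum>i<n. (y' i)\<^sup>2) = 1"
        using Y by (simp add: y'_def power_divide Y_def[symmetric] flip: sum_divide_distrib)
      show "(\<Sum>i<n. v i * y' i) = 0"
        using vy by (simp add: y'_def flip: sum_divide_distrib)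
    qed (use adj_eigenvalues_abs_le[OF E] in auto)
    also have "(\<Sum>i<n. (\<Sum>j<n. ?A $$ (i, j) * y' j)\<^sup>2) = (\<Sum>i<n. (\<Sum>j<n. ?A $$ (i, j) * y j)\<^sup>2) / Y"
      using Y by (simp add: y'_def power_divide flip: sum_divide_distrib)
    finally show ?thesis using Y by (simp add: divide_le_eq Y_def)
  qed
  have idx: "(\<Sum>j<n. ?A $$ (i, j) * z j) = (\<Sum>j<n. (if E i j then 1 else 0) * z j)" if "i < n" for i z
    using that by (intro sum.cong refl) (simp add: adj_mat_index)
  have gap': "(\<Sum>i<n. (\<Sum>j<n. (if E i j then 1 else 0) * y j)\<^sup>2) = (\<Sum>i<n. (\<Sum>j<n. ?A $$ (i, j) * y j)\<^sup>2)" for y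
    by (intro sum.cong refl) (simp only: idx lessThan_iff)
  show ?thesis
    by (rule that[OF v1, of "?es ! 0"]) (simp_all only: idx[symmetric] veig gap gap')
qed

section \<open>Almost regular graphs: counting neighbours in a set\<close>

text \<open>Read the eigenvalue equation at a coordinate where \<open>v\<close> has the largest
  absolute value.\<close>

lemma abs_eigenvalue_le_max_degree:
  fixes v :: "nat \<Rightarrow> real" and a :: "nat \<Rightarrow> nat \<Rightarrow> real" and \<mu> D :: real
  assumes a: "\<And>i j. 0 \<le> a i j" and D: "\<And>i. i < n \<Longrightarrow> (\<Sum>j<n. a i j) \<le> D"
    and eig: "\<And>i. i < n \<Longrightarrow> (\<Sum>j<n. a i j * v j) = \<mu> * v i"
    and v: "(\<Sum>i<n. (v i)\<^sup>2) = 1"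
  shows "\<bar>\<mu>\<bar> \<le> D"
proof -
  have ne: "n \<noteq> 0" using v by (cases n) auto
  have "Max ((\<lambda>i. \<bar>v i\<bar>) ` {..<n}) \<in> (\<lambda>i. \<bar>v i\<bar>) ` {..<n}" using ne by (intro Max_in) auto
  then obtain i where i: "i < n" "Max ((\<lambda>i. \<bar>v i\<bar>) ` {..<n}) = \<bar>v i\<bar>" by auto
  have mx: "\<bar>v j\<bar> \<le> \<bar>v i\<bar>" if "j < n" for j using that i(2) by (metis Max_ge finite_imageI finite_lessThan imageI lessThan_iff)
  have vi: "\<bar>v i\<bar> > 0"
  proof (rule ccontr)
    assume "\<not> ?thesis"
    then have "v j = 0" if "j < n" for j using mx[OF that] by simp
    then have "(\<Sum>i<n. (v i)\<^sup>2) = 0" by simp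
    with v show False by simp
  qed
  have "\<bar>\<mu>\<bar> * \<bar>v i\<bar> = \<bar>\<Sum>j<n. a i j * v j\<bar>" using eig[OF i(1)] by (simp add: abs_mult)
  also have "\<dots> \<le> (\<Sum>j<n. \<bar>a i j * v j\<bar>)" by (rule sum_abs)
  also have "\<dots> \<le> (\<Sum>j<n. a i j * \<bar>v i\<bar>)"
    using a mx by (intro sum_mono) (auto simp: abs_mult intro!: mult_left_mono)
  also have "\<dots> \<le> D * \<bar>v i\<bar>" using D[OF i(1)] by (simp add: mult_right_mono flip: sum_distrib_right)
  finally show ?thesis using vi by simp
qed

text \<open>Almost regularity makes the all-ones vector an approximate eigenvector for the maximum degree,
  and the spectral gap then forces it to be close to the top eigenvector.\<close>

lemma almost_regular_top_eigenvector:
  fixes v :: "nat \<Rightarrow> real" and a :: "nat \<Rightarrow> nat \<Rightarrow> real" and \<mu> D d lam :: real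
  assumes sym: "\<And>i j. i < n \<Longrightarrow> j < n \<Longrightarrow> a i j = a j i"
    and D: "\<And>i. i < n \<Longrightarrow> (\<Sum>j<n. a i j) \<le> D" and d: "\<And>i. i < n \<Longrightarrow> d \<le> (\<Sum>j<n. a i j)"
    and eig: "\<And>i. i < n \<Longrightarrow> (\<Sum>j<n. a i j * v j) = \<mu> * v i"
    and v: "(\<Sum>i<n. (v i)\<^sup>2) = 1"
    and gap: "\<And>y. (\<Sum>i<n. v i * y i) = 0 \<Longrightarrow> (\<Sum>i<n. (\<Sum>j<n. a i j * y j)\<^sup>2) \<le> lam\<^sup>2 * (\<Sum>i<n. (y i)\<^sup>2)"
    and lam: "0 \<le> lam" "lam < D"
  defines "c \<equiv> (\<Sum>i<n. v i)" and "w \<equiv> (\<lambda>i. 1 - (\<Sum>i<n. v i) * v i)" and "\<rho> \<equiv> (D - d) / (D - lam)"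
  shows "(\<Sum>i<n. (w i)\<^sup>2) = real n - c\<^sup>2" and "L2_set w {..<n} \<le> \<rho> * sqrt (real n)"
proof -
  have w: "w i = 1 - c * v i" for i by (simp add: w_def c_def)
  have "(\<Sum>i<n. (w i)\<^sup>2) = (\<Sum>i<n. 1 - 2 * c * v i + c\<^sup>2 * (v i)\<^sup>2)"
    by (intro sum.cong refl) (simp add: w power2_eq_square algebra_simps)
  also have "\<dots> = real n - 2 * c * c + c\<^sup>2 * 1"
    by (simp add: sum.distrib sum_subtractf v[symmetric] flip: sum_distrib_left c_def)
  finally show ww: "(\<Sum>i<n. (w i)\<^sup>2) = real n - c\<^sup>2" by (simp add: power2_eq_square)
  have vw: "(\<Sum>i<n. v i * w i) = 0"
  proof -
    have "(\<Sum>i<n. v i * w i) = (\<Sum>i<n. v i - c * (v i)\<^sup>2)"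
      by (intro sum.cong refl) (simp add: w power2_eq_square algebra_simps)
    also have "\<dots> = c - c * 1" by (simp add: sum_subtractf c_def v[symmetric] flip: sum_distrib_left)
    finally show ?thesis by simp
  qed
  \<comment> \<open>The defect of the all-ones vector as an eigenvector for \<open>D\<close>; each
    entry lies between \<open>d - D\<close> and 0. The vector \<open>w\<close> is the part of the
    all-ones vector orthogonal to \<open>v\<close>.\<close>
  define r where "r = (\<lambda>i. (\<Sum>j<n. a i j) - D)"
  define Aw where "Aw = (\<lambda>i. \<Sum>j<n. a i j * w j)"
  have Aw: "Aw i - D * w i = r i - c * (\<mu> - D) * v i" if "i < n" for i
  proof -
    have "Aw i = (\<Sum>j<n. a i j - c * (a i j * v j))"
      unfolding Aw_def by (intro sum.cong refl) (simp add: w algebra_simps)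
    also have "\<dots> = (\<Sum>j<n. a i j) - c * (\<mu> * v i)"
      by (simp add: sum_subtractf eig[OF that] flip: sum_distrib_left)
    finally show ?thesis by (simp add: r_def w algebra_simps)
  qed
  \<comment> \<open>With \<open>Aw\<close> this says that the image of \<open>w\<close> under A - D
    is the projection of \<open>r\<close> away from \<open>v\<close>, so its norm is at most that of
    \<open>r\<close>.\<close>
  have rv: "(\<Sum>i<n. r i * v i) = (\<mu> - D) * c"
  proof -
    have "(\<Sum>i<n. (\<Sum>j<n. a i j) * v i) = (\<Sum>j<n. \<Sum>i<n. a i j * v i)"
      unfolding sum_distrib_right by (rule sum.swap)
    also have "\<dots> = (\<Sum>j<n. \<mu> * v j)"
    proof (intro sum.cong refl)
      fix j assume j: "j \<in> {..<n}"
      have "(\<Sum>i<n. a i j * v i) = (\<Sum>i<n. a j i * v i)"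
        by (intro sum.cong refl) (use sym j in auto)
      then show "(\<Sum>i<n. a i j * v i) = \<mu> * v j" using eig j by simp
    qed
    finally have "(\<Sum>i<n. (\<Sum>j<n. a i j) * v i) = \<mu> * c" by (simp add: c_def sum_distrib_left)
    then show ?thesis
      by (simp add: r_def left_diff_distrib sum_subtractf c_def flip: sum_distrib_left)
  qed
  have "(\<Sum>i<n. (Aw i - D * w i)\<^sup>2) = (\<Sum>i<n. (r i)\<^sup>2 - 2 * c * (\<mu> - D) * (r i * v i) + (c * (\<mu> - D))\<^sup>2 * (v i)\<^sup>2)"
    by (intro sum.cong refl) (simp add: Aw power2_eq_square algebra_simps)
  also have "\<dots> = (\<Sum>i<n. (r i)\<^sup>2) - 2 * c * (\<mu> - D) * ((\<mu> - D) * c) + (c * (\<mu> - D))\<^sup>2 * 1"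
    unfolding sum.distrib sum_subtractf sum_distrib_left[symmetric] rv v ..
  also have "\<dots> = (\<Sum>i<n. (r i)\<^sup>2) - (c * (\<mu> - D))\<^sup>2" by (simp add: power2_eq_square algebra_simps)
  also have "\<dots> \<le> (\<Sum>i<n. (r i)\<^sup>2)" by simp
  also have "\<dots> \<le> (\<Sum>i<n. (D - d)\<^sup>2)"
  proof (intro sum_mono)
    fix i assume "i \<in> {..<n}"
    then have "\<bar>r i\<bar> \<le> \<bar>D - d\<bar>" using D[of i] d[of i] by (auto simp: r_def)
    then show "(r i)\<^sup>2 \<le> (D - d)\<^sup>2" by (simp add: abs_le_square_iff)
  qed
  finally have 1: "L2_set (\<lambda>i. Aw i - D * w i) {..<n} \<le> sqrt (real n * (D - d)\<^sup>2)"
    unfolding L2_set_def by (intro real_sqrt_le_mono) simp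
  have dD: "d \<le> D" if "n \<noteq> 0" using D[of 0] d[of 0] that by linarith
  have 1: "L2_set (\<lambda>i. Aw i - D * w i) {..<n} \<le> (D - d) * sqrt (real n)"
    using 1 dD by (cases "n = 0") (auto simp: real_sqrt_mult mult.commute)
  have "(\<Sum>i<n. (Aw i)\<^sup>2) \<le> lam\<^sup>2 * (\<Sum>i<n. (w i)\<^sup>2)"
    unfolding Aw_def by (rule gap[OF vw])
  then have "L2_set Aw {..<n} \<le> sqrt (lam\<^sup>2 * (\<Sum>i<n. (w i)\<^sup>2))"
    unfolding L2_set_def by (rule real_sqrt_le_mono)
  then have 2: "L2_set Aw {..<n} \<le> lam * L2_set w {..<n}"
    using lam by (simp add: real_sqrt_mult L2_set_def)
  \<comment> \<open>Since \<open>w\<close> is orthogonal to \<open>v\<close>, the gap gives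
    \<open>Aw\<close> norm at most \<open>lam\<close> times that of \<open>w\<close>; the triangle
    inequality then isolates the factor \<open>D - lam\<close>.\<close>
  have "D * L2_set w {..<n} = L2_set (\<lambda>i. D * w i) {..<n}"
    using lam by (intro L2_set_right_distrib) simp
  also have "(\<lambda>i. D * w i) = (\<lambda>i. Aw i + (D * w i - Aw i))" by auto
  also have "L2_set \<dots> {..<n} \<le> L2_set Aw {..<n} + L2_set (\<lambda>i. D * w i - Aw i) {..<n}"
    by (rule L2_set_triangle_ineq)
  also have "L2_set (\<lambda>i. D * w i - Aw i) {..<n} = L2_set (\<lambda>i. Aw i - D * w i) {..<n}"
    unfolding L2_set_def by (simp add: power2_commute)
  finally have "(D - lam) * L2_set w {..<n} \<le> (D - d) * sqrt (real n)"
    using 1 2 by (simp add: left_diff_distrib)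
  then show "L2_set w {..<n} \<le> \<rho> * sqrt (real n)"
    using lam by (simp add: \<rho>_def field_simps)
qed

text \<open>Split the indicator \<open>x\<close> of \<open>S\<close> into its component
  \<open>p\<close> along \<open>v\<close> and the orthogonal rest \<open>y\<close>. The gap handles
  \<open>y\<close> and yields the term \<open>(lam / D)\<^sup>2\<close>. Since \<open>v\<close> is
  nearly constant, \<open>p\<^sup>2\<close> is about \<open>k\<^sup>2 / n\<close>, which yields the
  other terms.\<close>

lemma neighbour_count_square_sum:
  fixes v :: "nat \<Rightarrow> real" and a :: "nat \<Rightarrow> nat \<Rightarrow> real" and \<mu> D d lam :: real
  assumes a: "\<And>i j. 0 \<le> a i j" and sym: "\<And>i j. i < n \<Longrightarrow> j < n \<Longrightarrow> a i j = a j i"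
    and D: "\<And>i. i < n \<Longrightarrow> (\<Sum>j<n. a i j) \<le> D" and d: "\<And>i. i < n \<Longrightarrow> d \<le> (\<Sum>j<n. a i j)"
    and eig: "\<And>i. i < n \<Longrightarrow> (\<Sum>j<n. a i j * v j) = \<mu> * v i"
    and v: "(\<Sum>i<n. (v i)\<^sup>2) = 1"
    and gap: "\<And>y. (\<Sum>i<n. v i * y i) = 0 \<Longrightarrow> (\<Sum>i<n. (\<Sum>j<n. a i j * y j)\<^sup>2) \<le> lam\<^sup>2 * (\<Sum>i<n. (y i)\<^sup>2)"
    and lam: "0 \<le> lam" "lam < D" and S: "S \<subseteq> {..<n}" and n: "n \<ge> 1"
  defines "\<rho> \<equiv> (D - d) / (D - lam)"
  assumes rho: "\<rho> < 1"
  shows "(\<Sum>i<n. (\<Sum>j\<in>S. a i j)\<^sup>2) \<le> D\<^sup>2 * card S * (card S / n + (2 * \<rho> / (1 - \<rho>) + (lam / D)\<^sup>2))"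
proof -
  define k where "k = real (card S)"
  have kn: "k \<le> real n" unfolding k_def using card_mono[OF _ S] by simp
  have k0: "0 \<le> k" by (simp add: k_def)
  have dD: "d \<le> D" using D[of 0] d[of 0] n by linarith
  have rho0: "0 \<le> \<rho>" using dD lam by (simp add: \<rho>_def)
  define x :: "nat \<Rightarrow> real" where "x = (\<lambda>i. if i \<in> S then 1 else 0)"
  have xs: "(\<Sum>i<n. f i * x i) = (\<Sum>i\<in>S. f i)" for f
  proof -
    have "(\<Sum>i<n. f i * x i) = (\<Sum>i\<in>{..<n} \<inter> S. f i)"
      unfolding x_def by (simp add: sum.If_cases if_distrib cong: if_cong)
    then show ?thesis using S by (simp add: Int_absorb1)
  qed
  have xx: "(\<Sum>i<n. (x i)\<^sup>2) = k"
    using xs[of x] by (simp add: power2_eq_square k_def x_def)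
  define c where "c = (\<Sum>i<n. v i)"
  define w where "w = (\<lambda>i. 1 - c * v i)"
  note W = almost_regular_top_eigenvector[OF sym D d eig v gap lam, folded c_def \<rho>_def, folded w_def]
  have W1: "(\<Sum>i<n. (w i)\<^sup>2) = real n - c\<^sup>2" using W(1) by (simp add: w_def)
  have L2: "(L2_set w {..<n})\<^sup>2 \<le> (\<rho> * sqrt (real n))\<^sup>2"
    using W(2) by (intro power_mono) (auto simp: L2_set_nonneg)
  then have "real n - c\<^sup>2 \<le> \<rho>\<^sup>2 * real n"
    unfolding W1[symmetric] by (simp add: L2_set_def sum_nonneg power_mult_distrib)
  then have c2: "real n * (1 - \<rho>\<^sup>2) \<le> c\<^sup>2" by (simp add: algebra_simps)
  define p where "p = (\<Sum>i<n. v i * x i)"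
  \<comment> \<open>\<open>c * v\<close> is the all-ones vector minus \<open>w\<close>, so pairing
    it with \<open>x\<close> counts \<open>S\<close> up to an error controlled by the norm of
    \<open>w\<close>.\<close>
  have cp: "c * p = k - (\<Sum>i<n. w i * x i)"
  proof -
    have "(\<Sum>i<n. w i * x i) = (\<Sum>i<n. 1 * x i - c * (v i * x i))"
      by (intro sum.cong refl) (simp add: w_def algebra_simps)
    also have "\<dots> = (\<Sum>i<n. 1 * x i) - c * p" unfolding sum_subtractf p_def sum_distrib_left[symmetric] ..
    also have "(\<Sum>i<n. 1 * x i) = k" unfolding xs by (simp add: k_def)
    finally show ?thesis by simp
  qed
  have "\<bar>\<Sum>i<n. w i * x i\<bar> \<le> (\<Sum>i<n. \<bar>w i\<bar> * \<bar>x i\<bar>)"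
    by (metis (no_types, lifting) abs_mult sum_abs sum.cong)
  also have "\<dots> \<le> L2_set w {..<n} * L2_set x {..<n}" by (rule L2_set_mult_ineq)
  also have "\<dots> \<le> \<rho> * sqrt (real n) * sqrt k"
    using W(2) by (auto simp: L2_set_def xx intro!: mult_right_mono k0)
  finally have "\<bar>c * p\<bar> \<le> k + \<rho> * sqrt (real n) * sqrt k" using cp k0 by linarith
  then have "(c * p)\<^sup>2 \<le> (k + \<rho> * sqrt (real n) * sqrt k)\<^sup>2"
    by (metis abs_ge_zero power2_abs power_mono)
  also have "\<dots> = k\<^sup>2 + 2 * \<rho> * k * sqrt (real n * k) + \<rho>\<^sup>2 * real n * k"
    using k0 by (simp add: power2_sum power_mult_distrib real_sqrt_mult)
  also have "sqrt (real n * k) \<le> real n"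
    using kn k0 by (metis abs_of_nat mult_left_mono of_nat_0_le_iff power2_eq_square real_sqrt_abs real_sqrt_le_mono)
  then have "k\<^sup>2 + 2 * \<rho> * k * sqrt (real n * k) + \<rho>\<^sup>2 * real n * k \<le> k\<^sup>2 + 2 * \<rho> * k * real n + \<rho>\<^sup>2 * real n * k"
    using rho0 k0 by (intro add_mono mult_left_mono) auto
  also have "k\<^sup>2 + 2 * \<rho> * k * real n + \<rho>\<^sup>2 * real n * k = real n * (k * (k / n + 2 * \<rho> + \<rho>\<^sup>2))"
    using n by (simp add: power2_eq_square field_simps)
  finally have cp2: "c\<^sup>2 * p\<^sup>2 \<le> real n * (k * (k / n + 2 * \<rho> + \<rho>\<^sup>2))"
    by (simp add: power_mult_distrib)
  have r2: "0 < 1 - \<rho>\<^sup>2" using rho rho0 by (simp add: power2_less_1_iff abs_less_iff)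
  have "real n * ((1 - \<rho>\<^sup>2) * p\<^sup>2) \<le> c\<^sup>2 * p\<^sup>2"
    using mult_right_mono[OF c2, of "p\<^sup>2"] by (simp add: mult.assoc)
  with cp2 have "real n * ((1 - \<rho>\<^sup>2) * p\<^sup>2) \<le> real n * (k * (k / n + 2 * \<rho> + \<rho>\<^sup>2))" by linarith
  then have "(1 - \<rho>\<^sup>2) * p\<^sup>2 \<le> k * (k / n + 2 * \<rho> + \<rho>\<^sup>2)"
    using n by (simp add: mult_le_cancel_left)
  \<comment> \<open>Origin of \<open>2 * \<rho> / (1 - \<rho>)\<close>: multiplied by
    \<open>1 - \<rho>\<^sup>2\<close> it becomes \<open>2 * \<rho> + 2 * \<rho>\<^sup>2\<close>, and
    the surplus \<open>\<rho>\<^sup>2\<close> pays for the loss in \<open>k / n\<close>, which is at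
    most 1.\<close>
  also have "\<dots> \<le> k * ((1 - \<rho>\<^sup>2) * (k / n + 2 * \<rho> / (1 - \<rho>)))"
  proof (intro mult_left_mono k0)
    have "k / n * \<rho>\<^sup>2 \<le> 1 * \<rho>\<^sup>2" using kn n by (intro mult_right_mono) auto
    moreover have "(1 - \<rho>\<^sup>2) * (2 * \<rho> / (1 - \<rho>)) = 2 * \<rho> + 2 * \<rho>\<^sup>2"
      using rho by (simp add: field_simps power2_eq_square)
    ultimately show "k / n + 2 * \<rho> + \<rho>\<^sup>2 \<le> (1 - \<rho>\<^sup>2) * (k / n + 2 * \<rho> / (1 - \<rho>))"
      by (simp add: algebra_simps)
  qed
  finally have "(1 - \<rho>\<^sup>2) * p\<^sup>2 \<le> (1 - \<rho>\<^sup>2) * (k * (k / n + 2 * \<rho> / (1 - \<rho>)))" by (simp add: mult_ac)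
  then have p2: "p\<^sup>2 \<le> k * (k / n + 2 * \<rho> / (1 - \<rho>))" using r2 by (simp add: mult_le_cancel_left)
  define y where "y = (\<lambda>i. x i - p * v i)"
  have vy: "(\<Sum>i<n. v i * y i) = 0"
  proof -
    have "(\<Sum>i<n. v i * y i) = (\<Sum>i<n. v i * x i - p * (v i)\<^sup>2)"
      by (intro sum.cong refl) (simp add: y_def power2_eq_square algebra_simps)
    also have "\<dots> = p - p * 1" unfolding sum_subtractf sum_distrib_left[symmetric] v p_def ..
    finally show ?thesis by simp
  qed
  have yy: "(\<Sum>i<n. (y i)\<^sup>2) \<le> k"
  proof -
    have "(\<Sum>i<n. (y i)\<^sup>2) = (\<Sum>i<n. (x i)\<^sup>2 - 2 * p * (v i * x i) + p\<^sup>2 * (v i)\<^sup>2)"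
      by (intro sum.cong refl) (simp add: y_def power2_eq_square algebra_simps)
    also have "\<dots> = k - 2 * p * p + p\<^sup>2 * 1"
      unfolding sum.distrib sum_subtractf sum_distrib_left[symmetric] v xx p_def ..
    finally show ?thesis by (simp add: power2_eq_square)
  qed
  define Ay where "Ay = (\<lambda>i. \<Sum>j<n. a i j * y j)"
  \<comment> \<open>By symmetry the image of \<open>y\<close> stays orthogonal to \<open>v\<close>,
    so the squared norm of the image of \<open>x\<close> has no cross term.\<close>
  have vAy: "(\<Sum>i<n. v i * Ay i) = 0"
  proof -
    have "(\<Sum>i<n. v i * Ay i) = (\<Sum>j<n. \<Sum>i<n. v i * (a i j * y j))"
      unfolding Ay_def sum_distrib_left by (rule sum.swap)
    also have "\<dots> = (\<Sum>j<n. (\<Sum>i<n. a j i * v i) * y j)"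
      unfolding sum_distrib_right by (intro sum.cong refl) (simp add: sym mult_ac)
    also have "\<dots> = (\<Sum>j<n. \<mu> * (v j * y j))" by (intro sum.cong refl) (simp add: eig)
    also have "\<dots> = 0" using vy by (simp flip: sum_distrib_left)
    finally show ?thesis .
  qed
  have AyS: "(\<Sum>i<n. (Ay i)\<^sup>2) \<le> lam\<^sup>2 * k"
    using gap[OF vy] mult_left_mono[OF yy, of "lam\<^sup>2"] unfolding Ay_def by simp
  have Ax: "(\<Sum>j\<in>S. a i j) = \<mu> * p * v i + Ay i" if "i < n" for i
  proof -
    have "(\<Sum>j\<in>S. a i j) = (\<Sum>j<n. p * (a i j * v j) + a i j * y j)"
      unfolding xs[symmetric] by (intro sum.cong refl) (simp add: y_def algebra_simps)
    also have "\<dots> = p * (\<mu> * v i) + Ay i"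
      unfolding sum.distrib sum_distrib_left[symmetric] eig[OF that] Ay_def ..
    finally show ?thesis by simp
  qed
  have "(\<Sum>i<n. (\<Sum>j\<in>S. a i j)\<^sup>2) = (\<Sum>i<n. (\<mu> * p)\<^sup>2 * (v i)\<^sup>2 + 2 * (\<mu> * p) * (v i * Ay i) + (Ay i)\<^sup>2)"
    by (intro sum.cong refl) (simp add: Ax power2_eq_square algebra_simps)
  also have "\<dots> = (\<mu> * p)\<^sup>2 * 1 + 2 * (\<mu> * p) * 0 + (\<Sum>i<n. (Ay i)\<^sup>2)"
    unfolding sum.distrib sum_distrib_left[symmetric] v vAy ..
  also have "\<dots> \<le> D\<^sup>2 * (k * (k / n + 2 * \<rho> / (1 - \<rho>))) + lam\<^sup>2 * k"
  proof -
    have "\<bar>\<mu>\<bar> \<le> D" by (rule abs_eigenvalue_le_max_degree[OF a D eig v])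
    then have "\<bar>\<mu>\<bar> \<le> \<bar>D\<bar>" using lam by simp
    then have "\<mu>\<^sup>2 \<le> D\<^sup>2" by (simp only: abs_le_square_iff)
    then have "(\<mu> * p)\<^sup>2 \<le> D\<^sup>2 * (k * (k / n + 2 * \<rho> / (1 - \<rho>)))"
      unfolding power_mult_distrib by (intro mult_mono p2) simp_all
    with AyS show ?thesis by simp
  qed
  also have "\<dots> = D\<^sup>2 * k * (k / n + (2 * \<rho> / (1 - \<rho>) + (lam / D)\<^sup>2))"
    using lam by (simp add: power_divide field_simps)
  finally show ?thesis by (simp add: k_def)
qed

subsection \<open>A single round\<close>

text \<open>Indicators of the two directions of transmission, so that one formula serves all three
  protocols.\<close>

definition pushes :: "protocol \<Rightarrow> real" where "pushes P = of_bool (P \<noteq> Pull)"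
definition pulls :: "protocol \<Rightarrow> real" where "pulls P = of_bool (P \<noteq> Push)"

lemma pushes_pulls_cases:
  "pushes Push = 1" "pulls Push = 0" "pushes Pull = 0" "pulls Pull = 1"
  "pushes PushPull = 1" "pulls PushPull = 1"
  by (simp_all add: pushes_def pulls_def)

lemma pushes_01: "0 \<le> pushes P" "pushes P \<le> 1" "pulls P \<le> 1" "0 \<le> pulls P" "pushes P + pulls P \<ge> 1"
  by (cases P; simp add: pushes_pulls_cases)+

text \<open>The outcome of a round when all \<open>n\<close> vertices draw, whatever the protocol;
  draws that the protocol does not use are ignored. This puts the three protocols on one product
  space.\<close>

definition spread :: "protocol \<Rightarrow> nat \<Rightarrow> nat set \<Rightarrow> (nat \<Rightarrow> nat \<times> bool) \<Rightarrow> nat set" where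
  "spread P n S f = S \<union> {u. P \<noteq> Pull \<and> (\<exists>v\<in>S. u = fst (f v) \<and> snd (f v))}
                      \<union> {u. P \<noteq> Push \<and> u < n \<and> fst (f u) \<in> S \<and> snd (f u)}"

locale gossip =
  fixes n :: nat and E :: "nat \<Rightarrow> nat \<Rightarrow> bool" and q :: real and P :: protocol
  assumes graph: "simple_graph_on n E" and deg_pos: "\<And>v. v < n \<Longrightarrow> degree E v \<ge> 1"
    and q: "0 < q" "q \<le> 1"
begin

lemma nbrs_subset: "nbrs E v \<subseteq> {..<n}"
  using graph by (auto simp: nbrs_def simple_graph_on_def)

lemma finite_nbrs [simp]: "finite (nbrs E v)"
  using nbrs_subset finite_subset by blast

lemma nbrs_ne: "v < n \<Longrightarrow> nbrs E v \<noteq> {}"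
  using deg_pos[of v] by (auto simp: degree_def)

lemma edge_sym: "E u v \<longleftrightarrow> E v u"
  using graph by (auto simp: simple_graph_on_def)

text \<open>Restricting a product distribution to fewer coordinates overwrites the others with
  \<open>(0, False)\<close>, a failed transmission without effect.\<close>

lemma round_step_eq_spread:
  assumes S: "S \<subseteq> {..<n}"
  shows "round_step P n E q S = map_pmf (spread P n S) (choices E q {..<n})"
proof (cases P)
  case Push
  have "choices E q S = map_pmf (\<lambda>f x. if x \<in> S then f x else (0, False)) (choices E q {..<n})"
    unfolding choices_def by (rule Pi_pmf_subset) (use S in auto)
  then show ?thesis
    by (auto simp: Push pmf.map_comp o_def spread_def intro!: pmf.map_cong)
next
  case Pull
  have "choices E q ({..<n} - S) = map_pmf (\<lambda>f x. if x \<in> {..<n} - S then f x else (0, False)) (choices E q {..<n})"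
    unfolding choices_def by (rule Pi_pmf_subset) auto
  then show ?thesis
    by (auto simp: Pull pmf.map_comp o_def spread_def intro!: pmf.map_cong)
next
  case PushPull
  then show ?thesis by (auto simp: spread_def intro!: pmf.map_cong)
qed

lemma set_round_step:
  assumes S: "S \<subseteq> {..<n}" and S': "S' \<in> set_pmf (round_step P n E q S)"
  shows "S \<subseteq> S'" "S' \<subseteq> {..<n}"
proof -
  obtain f where f: "f \<in> set_pmf (choices E q {..<n})" "S' = spread P n S f"
    using S' unfolding round_step_eq_spread[OF S] by auto
  have "fst (f v) < n" if "v < n" for v
  proof -
    have "f v \<in> set_pmf (pair_pmf (pmf_of_set (nbrs E v)) (bernoulli_pmf q))"
      using f(1) set_Pi_pmf_subset'[of "{..<n}" "(0, False)"] that
      unfolding choices_def PiE_dflt_def by fastforce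
    then show ?thesis using nbrs_ne[OF that] nbrs_subset by (cases "f v") auto
  qed
  then show "S \<subseteq> S'" "S' \<subseteq> {..<n}" using S by (auto simp: f(2) spread_def)
qed

lemma finite_set_round_step: "S \<subseteq> {..<n} \<Longrightarrow> finite (set_pmf (round_step P n E q S))"
  by (rule finite_subset[of _ "Pow {..<n}"]) (auto dest: set_round_step)

section \<open>Probability that vertices stay uninformed in a round\<close>

lemma prob_choice:
  assumes "v < n"
  shows "measure_pmf.prob (pair_pmf (pmf_of_set (nbrs E v)) (bernoulli_pmf q)) {x. \<not> (snd x \<and> fst x \<in> T)}
           = 1 - q * card (nbrs E v \<inter> T) / degree E v"
proof -
  let ?M = "pair_pmf (pmf_of_set (nbrs E v)) (bernoulli_pmf q)"
  have "measure_pmf.prob ?M (T \<times> {True}) = measure_pmf.prob (pmf_of_set (nbrs E v)) T * measure_pmf.prob (bernoulli_pmf q) {True}"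
    by (rule measure_pmf_prob_product) auto
  also have "\<dots> = q * card (nbrs E v \<inter> T) / degree E v"
    using nbrs_ne[OF assms] q by (simp add: measure_pmf_of_set degree_def measure_pmf_single)
  finally have "measure_pmf.prob ?M (T \<times> {True}) = q * card (nbrs E v \<inter> T) / degree E v" .
  moreover have "measure_pmf.prob ?M {x. \<not> (snd x \<and> fst x \<in> T)} = 1 - measure_pmf.prob ?M (T \<times> {True})"
    by (subst measure_pmf.prob_compl[symmetric]) (auto intro!: arg_cong[where f = "measure_pmf.prob ?M"])
  ultimately show ?thesis by simp
qed

text \<open>Staying away from \<open>W\<close> constrains each vertex separately: a vertex of
  \<open>S\<close> must not push into \<open>W\<close>, a vertex of \<open>W\<close> must not pull
  from \<open>S\<close>. As \<open>S\<close> and \<open>W\<close> are disjoint, no vertex carries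
  both constraints, and the probability is a product.\<close>

lemma prob_avoid:
  assumes S: "S \<subseteq> {..<n}" and W: "W \<subseteq> {..<n} - S"
  shows "measure_pmf.prob (round_step P n E q S) {S'. S' \<inter> W = {}} =
    (\<Prod>v\<in>S. 1 - pushes P * q * card (nbrs E v \<inter> W) / degree E v) *
    (\<Prod>v\<in>W. 1 - pulls P * q * card (nbrs E v \<inter> S) / degree E v)"
proof -
  define B where "B = (\<lambda>v. {x :: nat \<times> bool. \<not> (v \<in> S \<and> P \<noteq> Pull \<and> snd x \<and> fst x \<in> W) \<and>
    \<not> (v \<in> W \<and> P \<noteq> Push \<and> snd x \<and> fst x \<in> S)})"
  define pr where "pr = (\<lambda>v. measure_pmf.prob (pair_pmf (pmf_of_set (nbrs E v)) (bernoulli_pmf q)) (B v))"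
  have "spread P n S -` {S'. S' \<inter> W = {}} = Pi {..<n} B"
    using S W unfolding spread_def B_def Pi_def by blast
  then have "measure_pmf.prob (round_step P n E q S) {S'. S' \<inter> W = {}} =
      measure_pmf.prob (choices E q {..<n}) (Pi {..<n} B)"
    by (simp add: round_step_eq_spread[OF S])
  also have "\<dots> = (\<Prod>v<n. pr v)"
    unfolding choices_def pr_def by (rule measure_Pi_pmf_Pi) simp
  also have "\<dots> = (\<Prod>v\<in>S \<union> W. pr v)"
  proof (rule prod.mono_neutral_right)
    show "\<forall>v\<in>{..<n} - (S \<union> W). pr v = 1" by (auto simp: pr_def B_def)
  qed (use S W in auto)
  also have "\<dots> = (\<Prod>v\<in>S. pr v) * (\<Prod>v\<in>W. pr v)"
    using S W by (intro prod.union_disjoint) (auto intro: finite_subset)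
  also have "(\<Prod>v\<in>S. pr v) = (\<Prod>v\<in>S. 1 - pushes P * q * card (nbrs E v \<inter> W) / degree E v)"
  proof (intro prod.cong refl)
    fix v assume v: "v \<in> S"
    then have "v \<notin> W" "v < n" using S W by auto
    with v have "B v = (if P \<noteq> Pull then {x. \<not> (snd x \<and> fst x \<in> W)} else UNIV)" by (auto simp: B_def)
    then show "pr v = 1 - pushes P * q * card (nbrs E v \<inter> W) / degree E v"
      using prob_choice[OF \<open>v < n\<close>, of W] by (simp add: pr_def pushes_def)
  qed
  also have "(\<Prod>v\<in>W. pr v) = (\<Prod>v\<in>W. 1 - pulls P * q * card (nbrs E v \<inter> S) / degree E v)"
  proof (intro prod.cong refl)
    fix v assume v: "v \<in> W"
    then have "v \<notin> S" "v < n" using S W by auto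
    with v have "B v = (if P \<noteq> Push then {x. \<not> (snd x \<and> fst x \<in> S)} else UNIV)" by (auto simp: B_def)
    then show "pr v = 1 - pulls P * q * card (nbrs E v \<inter> S) / degree E v"
      using prob_choice[OF \<open>v < n\<close>, of S] by (simp add: pr_def pulls_def)
  qed
  finally show ?thesis .
qed

text \<open>For \<open>u\<close> outside \<open>S\<close>, the probability of remaining uninformed
  for one more round.\<close>

definition miss :: "nat set \<Rightarrow> nat \<Rightarrow> real" where
  "miss S u = (\<Prod>v\<in>S. 1 - pushes P * q * of_bool (E v u) / degree E v) * (1 - pulls P * q * card (nbrs E u \<inter> S) / degree E u)"

lemma card_nbrs_Int: "card (nbrs E v \<inter> {u}) = of_bool (E v u)"
  by (auto simp: nbrs_def)

lemma prob_avoid_single: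
  assumes "S \<subseteq> {..<n}" "u \<in> {..<n} - S"
  shows "measure_pmf.prob (round_step P n E q S) {S'. u \<notin> S'} = miss S u"
  using prob_avoid[OF assms(1), of "{u}"] assms(2) by (simp add: miss_def card_nbrs_Int)

lemma factor_01:
  assumes "v < n"
  shows "0 \<le> 1 - pulls P * q * card (nbrs E v \<inter> W) / degree E v" "0 \<le> 1 - pushes P * q * card (nbrs E v \<inter> W) / degree E v"
    and "1 - pulls P * q * card (nbrs E v \<inter> W) / degree E v \<le> 1" "1 - pushes P * q * card (nbrs E v \<inter> W) / degree E v \<le> 1"
proof -
  have "card (nbrs E v \<inter> W) / degree E v \<le> 1"
    using card_mono[of "nbrs E v" "nbrs E v \<inter> W"] by (simp add: degree_def divide_le_eq_1 card_gt_0_iff nbrs_ne[OF assms])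
  moreover have "0 \<le> pulls P * q" "pulls P * q \<le> 1" "0 \<le> pushes P * q" "pushes P * q \<le> 1"
    using pushes_01 q by (auto intro!: mult_le_one)
  ultimately have *: "0 \<le> c * (card (nbrs E v \<inter> W) / degree E v) \<and> c * (card (nbrs E v \<inter> W) / degree E v) \<le> 1"
    if "c \<in> {pulls P * q, pushes P * q}" for c
    using that by (intro conjI mult_nonneg_nonneg mult_le_one) auto
  from *[of "pulls P * q"] *[of "pushes P * q"]
  show "0 \<le> 1 - pulls P * q * card (nbrs E v \<inter> W) / degree E v" "0 \<le> 1 - pushes P * q * card (nbrs E v \<inter> W) / degree E v"
    "1 - pulls P * q * card (nbrs E v \<inter> W) / degree E v \<le> 1" "1 - pushes P * q * card (nbrs E v \<inter> W) / degree E v \<le> 1"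
    by simp_all
qed

lemma miss_01:
  assumes "S \<subseteq> {..<n}" "u \<in> {..<n} - S"
  shows "0 \<le> miss S u" "miss S u \<le> 1"
  using prob_avoid_single[OF assms] by (metis measure_nonneg, metis measure_pmf.prob_le_1)

text \<open>A vertex pushes to only one of \<open>u\<close> and \<open>w\<close>, so its factor has
  the form 1 - a - b, at most (1 - a)(1 - b). The pulls of \<open>u\<close> and \<open>w\<close> are
  independent.\<close>

lemma prob_avoid_pair:
  assumes S: "S \<subseteq> {..<n}" and u: "u \<in> {..<n} - S" "w \<in> {..<n} - S" "u \<noteq> w"
  shows "measure_pmf.prob (round_step P n E q S) {S'. u \<notin> S' \<and> w \<notin> S'} \<le> miss S u * miss S w"
proof -
  have [simp]: "card (nbrs E v \<inter> {u, w}) = of_bool (E v u) + of_bool (E v w)" for v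
    using u(3) by (auto simp: nbrs_def)
  have "(\<Prod>v\<in>S. 1 - pushes P * q * card (nbrs E v \<inter> {u, w}) / degree E v) \<le>
     (\<Prod>v\<in>S. (1 - pushes P * q * of_bool (E v u) / degree E v) * (1 - pushes P * q * of_bool (E v w) / degree E v))"
  proof (intro prod_mono conjI)
    fix v assume "v \<in> S"
    then have v: "v < n" using S by auto
    show "0 \<le> 1 - pushes P * q * card (nbrs E v \<inter> {u, w}) / degree E v" by (rule factor_01[OF v])
    have "0 \<le> pushes P * q * of_bool (E v u) / degree E v * (pushes P * q * of_bool (E v w) / degree E v)"
      using pushes_01 q by simp
    then show "1 - pushes P * q * card (nbrs E v \<inter> {u, w}) / degree E v \<le>
      (1 - pushes P * q * of_bool (E v u) / degree E v) * (1 - pushes P * q * of_bool (E v w) / degree E v)"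
      by (simp add: algebra_simps add_divide_distrib)
  qed
  then have "(\<Prod>v\<in>S. 1 - pushes P * q * card (nbrs E v \<inter> {u, w}) / degree E v) *
      ((1 - pulls P * q * card (nbrs E u \<inter> S) / degree E u) * (1 - pulls P * q * card (nbrs E w \<inter> S) / degree E w))
      \<le> (\<Prod>v\<in>S. (1 - pushes P * q * of_bool (E v u) / degree E v) * (1 - pushes P * q * of_bool (E v w) / degree E v)) *
      ((1 - pulls P * q * card (nbrs E u \<inter> S) / degree E u) * (1 - pulls P * q * card (nbrs E w \<inter> S) / degree E w))"
    using u factor_01(1)[of u S] factor_01(1)[of w S] by (intro mult_right_mono mult_nonneg_nonneg) auto
  also have "\<dots> = miss S u * miss S w" unfolding miss_def prod.distrib by (simp only: mult_ac)
  finally show ?thesis using prob_avoid[OF S, of "{u, w}"] u by (simp del: of_nat_add)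

qed

end

text \<open>Tangent line to \<open>1 / (L + y)\<close> at the mean, with a quadratic error term.\<close>

lemma expectation_inverse_le:
  fixes Y :: "'a \<Rightarrow> real"
  assumes fin: "finite (set_pmf M)" and Y: "\<And>x. x \<in> set_pmf M \<Longrightarrow> 0 \<le> Y x"
    and mean: "measure_pmf.expectation M Y = g"
    and var: "measure_pmf.expectation M (\<lambda>x. (Y x - g)\<^sup>2) \<le> g" and L: "0 < L"
  shows "measure_pmf.expectation M (\<lambda>x. 1 / (L + Y x)) \<le> (1 + 1 / L) / (L + g) - 1 / (L + g)\<^sup>2"
proof -
  note int = integrable_measure_pmf_finite[OF fin]
  have g: "0 \<le> g" using mean Y by (metis (mono_tags, lifting) AE_measure_pmf_iff integral_nonneg_AE)
  define G where "G = L + g"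
  have G: "G > 0" using g L by (simp add: G_def)
  have pt: "1 / (L + Y x) \<le> 1 / G - (Y x - g) / G\<^sup>2 + (Y x - g)\<^sup>2 / (L * G\<^sup>2)" if "x \<in> set_pmf M" for x
  proof -
    define y where "y = Y x - g"
    have Gy: "L \<le> G + y" "L + Y x = G + y" using Y[OF that] by (auto simp: G_def y_def)
    \<comment> \<open>An exact identity; only the last denominator is estimated, by
      \<open>L \<le> G + y\<close>. In expectation the linear term vanishes.\<close>
    have "1 / (G + y) = 1 / G - y / G\<^sup>2 + y\<^sup>2 / ((G + y) * G\<^sup>2)"
      using G Gy L by (simp add: divide_simps power2_eq_square) (simp add: algebra_simps)
    also have "y\<^sup>2 / ((G + y) * G\<^sup>2) \<le> y\<^sup>2 / (L * G\<^sup>2)"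
      using G Gy L by (intro divide_left_mono mult_right_mono mult_pos_pos) auto
    finally show ?thesis by (simp add: Gy y_def)
  qed
  have "measure_pmf.expectation M (\<lambda>x. 1 / (L + Y x)) \<le>
      measure_pmf.expectation M (\<lambda>x. 1 / G - (Y x - g) / G\<^sup>2 + (Y x - g)\<^sup>2 / (L * G\<^sup>2))"
    by (intro integral_mono_AE int) (simp add: AE_measure_pmf_iff pt)
  also have "\<dots> = 1 / G - (measure_pmf.expectation M Y - g) / G\<^sup>2 + measure_pmf.expectation M (\<lambda>x. (Y x - g)\<^sup>2) / (L * G\<^sup>2)"
    by (simp add: int)
  also have "\<dots> \<le> 1 / G + g / (L * G\<^sup>2)"
    using var mean L G by (simp add: divide_right_mono)
  \<comment> \<open>Substitute \<open>g = G - L\<close>. The negative second-order term survives and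
    is what makes the drift contract for a single informed vertex.\<close>
  also have "\<dots> = (1 + 1 / L) / G - 1 / G\<^sup>2"
    using L G by (simp add: G_def divide_simps power2_eq_square) (simp add: algebra_simps)
  finally show ?thesis by (simp add: G_def)
qed

section \<open>Moments of the informed set after one round\<close>

context gossip
begin

abbreviation uninf :: "nat set \<Rightarrow> nat set" where "uninf S \<equiv> {..<n} - S"

lemma expectation_uninformed:
  assumes S: "S \<subseteq> {..<n}"
  shows "measure_pmf.expectation (round_step P n E q S) (\<lambda>S'. real (card (uninf S'))) = (\<Sum>u\<in>uninf S. miss S u)"
    and "measure_pmf.expectation (round_step P n E q S) (\<lambda>S'. (real (card (uninf S')) - (\<Sum>u\<in>uninf S. miss S u))\<^sup>2)
           \<le> (\<Sum>u\<in>uninf S. miss S u * (1 - miss S u))"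
proof -
  let ?M = "round_step P n E q S"
  note int = integrable_measure_pmf_finite[OF finite_set_round_step[OF S]]
  let ?i = "\<lambda>u. indicat_real {S'. u \<notin> S'}"
  have X: "real (card (uninf S')) = (\<Sum>u\<in>uninf S. ?i u S')" if "S' \<in> set_pmf ?M" for S'
  proof -
    have "uninf S' = {u \<in> uninf S. u \<notin> S'}" using set_round_step[OF S that] by auto
    then show ?thesis by (simp add: indicator_def sum.If_cases Int_def)
  qed
  have "measure_pmf.expectation ?M (\<lambda>S'. real (card (uninf S'))) = measure_pmf.expectation ?M (\<lambda>S'. \<Sum>u\<in>uninf S. ?i u S')"
    by (intro integral_cong_AE) (simp_all add: AE_measure_pmf_iff X)
  also have "\<dots> = (\<Sum>u\<in>uninf S. miss S u)"
    by (simp add: int prob_avoid_single[OF S])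
  finally show mean: "measure_pmf.expectation ?M (\<lambda>S'. real (card (uninf S'))) = (\<Sum>u\<in>uninf S. miss S u)" .
  let ?m = "\<Sum>u\<in>uninf S. miss S u"
  have X2: "(real (card (uninf S')))\<^sup>2 = (\<Sum>u\<in>uninf S. \<Sum>w\<in>uninf S. indicat_real {S'. u \<notin> S' \<and> w \<notin> S'} S')"
    if "S' \<in> set_pmf ?M" for S'
    unfolding X[OF that] power2_eq_square sum_product by (intro sum.cong refl) (auto simp: indicator_def)
  have "measure_pmf.expectation ?M (\<lambda>S'. (real (card (uninf S')))\<^sup>2) =
     measure_pmf.expectation ?M (\<lambda>S'. \<Sum>u\<in>uninf S. \<Sum>w\<in>uninf S. indicat_real {S'. u \<notin> S' \<and> w \<notin> S'} S')"
    by (intro integral_cong_AE) (simp_all add: AE_measure_pmf_iff X2)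
  also have "\<dots> = (\<Sum>u\<in>uninf S. \<Sum>w\<in>uninf S. measure_pmf.prob ?M {S'. u \<notin> S' \<and> w \<notin> S'})"
    by (simp add: int)
  \<comment> \<open>Off the diagonal by negative correlation; on the diagonal
    \<open>miss S u\<close> is its square plus \<open>miss S u * (1 - miss S u)\<close>, the only
    part left in the variance.\<close>
  also have "\<dots> \<le> (\<Sum>u\<in>uninf S. \<Sum>w\<in>uninf S. miss S u * miss S w + (if w = u then miss S u * (1 - miss S u) else 0))"
  proof (intro sum_mono)
    fix u w assume u: "u \<in> uninf S" and w: "w \<in> uninf S"
    show "measure_pmf.prob ?M {S'. u \<notin> S' \<and> w \<notin> S'} \<le> miss S u * miss S w + (if w = u then miss S u * (1 - miss S u) else 0)"
      using prob_avoid_single[OF S u] prob_avoid_pair[OF S u w] by (auto simp: algebra_simps)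
  qed
  also have "\<dots> = (\<Sum>u\<in>uninf S. (\<Sum>w\<in>uninf S. miss S u * miss S w) + miss S u * (1 - miss S u))"
    by (intro sum.cong refl) (simp add: sum.distrib)
  also have "\<dots> = ?m * ?m + (\<Sum>u\<in>uninf S. miss S u * (1 - miss S u))"
    by (simp add: sum.distrib sum_product)
  finally have sq: "measure_pmf.expectation ?M (\<lambda>S'. (real (card (uninf S')))\<^sup>2) \<le> ?m * ?m + (\<Sum>u\<in>uninf S. miss S u * (1 - miss S u))" .
  have "measure_pmf.expectation ?M (\<lambda>S'. (real (card (uninf S')) - ?m)\<^sup>2) =
     measure_pmf.expectation ?M (\<lambda>S'. (real (card (uninf S')))\<^sup>2 - 2 * ?m * real (card (uninf S')) + ?m\<^sup>2)"
    by (intro Bochner_Integration.integral_cong refl) (simp add: power2_eq_square algebra_simps)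
  also have "\<dots> = measure_pmf.expectation ?M (\<lambda>S'. (real (card (uninf S')))\<^sup>2) - 2 * ?m * ?m + ?m\<^sup>2"
    using mean by (simp add: int)
  finally show "measure_pmf.expectation ?M (\<lambda>S'. (real (card (uninf S')) - ?m)\<^sup>2)
           \<le> (\<Sum>u\<in>uninf S. miss S u * (1 - miss S u))" using sq by (simp add: power2_eq_square)
qed

lemma card_uninf: "S \<subseteq> {..<n} \<Longrightarrow> real (card (uninf S)) = real n - real (card S)"
  by (simp add: card_Diff_subset finite_subset[OF _ finite_lessThan] of_nat_diff subset_eq_atLeast0_lessThan_card card_mono[of "{..<n}", simplified])

lemma expectation_inverse_uninformed:
  assumes S: "S \<subseteq> {..<n}" and L: "0 < L"
  defines "m \<equiv> \<Sum>u\<in>uninf S. miss S u"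
  shows "measure_pmf.expectation (round_step P n E q S) (\<lambda>S'. 1 / (L + real (card (uninf S')))) \<le> (1 + 1 / L) / (L + m)"
proof -
  have "(\<Sum>u\<in>uninf S. miss S u * (1 - miss S u)) \<le> m"
    unfolding m_def using miss_01[OF S] by (intro sum_mono) (simp add: mult_left_le)
  then have "measure_pmf.expectation (round_step P n E q S) (\<lambda>S'. 1 / (L + real (card (uninf S')))) \<le>
      (1 + 1 / L) / (L + m) - 1 / (L + m)\<^sup>2"
    using expectation_uninformed[OF S] L
    by (intro expectation_inverse_le finite_set_round_step[OF S]) (auto simp: m_def)
  then show ?thesis by (smt (verit) divide_nonneg_nonneg zero_le_power2)
qed

text \<open>The tangent estimate with shift \<open>k\<close> and the number of newly informed
  vertices as variable. This number has the same variance as the uninformed count, and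
  \<open>miss * (1 - miss)\<close> is at most \<open>1 - miss\<close>.\<close>

lemma expectation_inverse_informed:
  assumes S: "S \<subseteq> {..<n}" and ne: "S \<noteq> {}"
  defines "g \<equiv> \<Sum>u\<in>uninf S. 1 - miss S u" and "k \<equiv> real (card S)"
  shows "measure_pmf.expectation (round_step P n E q S) (\<lambda>S'. 1 / real (card S')) \<le> (1 + 1 / k) / (k + g) - 1 / (k + g)\<^sup>2"
proof -
  let ?M = "round_step P n E q S"
  note int = integrable_measure_pmf_finite[OF finite_set_round_step[OF S]]
  have k: "k > 0" using ne S finite_subset[OF S] by (simp add: k_def card_gt_0_iff)
  define Y where "Y = (\<lambda>S'. real (card (uninf S)) - real (card (uninf S')))"
  let ?m = "\<Sum>u\<in>uninf S. miss S u"
  have gm: "g = real (card (uninf S)) - ?m" by (simp add: g_def sum_subtractf)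
  have Y: "k + Y S' = real (card S')" if "S' \<in> set_pmf ?M" for S'
    using card_uninf[OF S] card_uninf[of S'] set_round_step[OF S that] by (simp add: Y_def k_def)
  have "measure_pmf.expectation ?M (\<lambda>S'. 1 / (k + Y S')) \<le> (1 + 1 / k) / (k + g) - 1 / (k + g)\<^sup>2"
  proof (rule expectation_inverse_le[OF finite_set_round_step[OF S]])
    fix S' assume S': "S' \<in> set_pmf ?M"
    have "card (uninf S') \<le> card (uninf S)" using set_round_step[OF S S'] by (intro card_mono) auto
    then show "0 \<le> Y S'" by (simp add: Y_def)
  next
    show "measure_pmf.expectation ?M Y = g"
      unfolding Y_def gm using expectation_uninformed(1)[OF S] by (simp add: int)
    have "measure_pmf.expectation ?M (\<lambda>S'. (Y S' - g)\<^sup>2) = measure_pmf.expectation ?M (\<lambda>S'. (real (card (uninf S')) - ?m)\<^sup>2)"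
      by (intro Bochner_Integration.integral_cong refl) (simp add: Y_def gm power2_commute)
    also have "\<dots> \<le> (\<Sum>u\<in>uninf S. miss S u * (1 - miss S u))" by (rule expectation_uninformed(2)[OF S])
    also have "\<dots> \<le> g"
      unfolding g_def using miss_01[OF S] by (intro sum_mono) (simp add: mult_left_le_one_le)
    finally show "measure_pmf.expectation ?M (\<lambda>S'. (Y S' - g)\<^sup>2) \<le> g" .
  qed (rule k)
  also have "measure_pmf.expectation ?M (\<lambda>S'. 1 / (k + Y S')) = measure_pmf.expectation ?M (\<lambda>S'. 1 / real (card S'))"
    by (intro integral_cong_AE) (simp_all add: AE_measure_pmf_iff Y)
  finally show ?thesis .
qed

lemma expectation_informed:
  assumes S: "S \<subseteq> {..<n}"
  shows "measure_pmf.expectation (round_step P n E q S) (\<lambda>S'. real (card S')) = real (card S) + (\<Sum>u\<in>uninf S. 1 - miss S u)"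
proof -
  let ?M = "round_step P n E q S"
  note int = integrable_measure_pmf_finite[OF finite_set_round_step[OF S]]
  have "measure_pmf.expectation ?M (\<lambda>S'. real (card S')) = measure_pmf.expectation ?M (\<lambda>S'. real n - real (card (uninf S')))"
    using card_uninf set_round_step[OF S] by (intro integral_cong_AE) (simp_all add: AE_measure_pmf_iff)
  also have "\<dots> = real n - (\<Sum>u\<in>uninf S. miss S u)"
    using expectation_uninformed(1)[OF S] by (simp add: int)
  finally show ?thesis using card_uninf[OF S] by (simp add: sum_subtractf)
qed

end

section \<open>Elementary inequalities for products and exponentials\<close>

lemma one_minus_sum_le_prod:
  fixes x :: "'a \<Rightarrow> real"
  assumes "finite A" "\<And>i. i \<in> A \<Longrightarrow> 0 \<le> x i" "\<And>i. i \<in> A \<Longrightarrow> x i \<le> 1"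
  shows "1 - sum x A \<le> (\<Prod>i\<in>A. 1 - x i)"
  using assms
proof (induction A rule: finite_induct)
  case (insert a A)
  have "(\<Prod>i\<in>A. 1 - x i) \<le> 1" using insert by (intro prod_le_1) auto
  then have "x a * (\<Prod>i\<in>A. 1 - x i) \<le> x a" using insert by (simp add: mult_left_le)
  then show ?case using insert by (simp add: algebra_simps)
qed simp

lemma prod_one_minus_le_exp:
  fixes x :: "'a \<Rightarrow> real"
  assumes "\<And>i. i \<in> A \<Longrightarrow> x i \<le> 1"
  shows "(\<Prod>i\<in>A. 1 - x i) \<le> exp (- sum x A)"
proof (cases "finite A")
  case True
  have "(\<Prod>i\<in>A. 1 - x i) \<le> (\<Prod>i\<in>A. exp (- x i))"
    using assms exp_ge_add_one_self[of "- x i" for i] by (intro prod_mono) auto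
  then show ?thesis using True by (simp add: exp_sum flip: sum_negf)
qed simp

lemma exp_minus_le_quadratic: "0 \<le> x \<Longrightarrow> exp (- x) \<le> 1 - x + x\<^sup>2" for x :: real
proof -
  assume x: "0 \<le> x"
  have "exp (- x) \<le> 1 / (1 + x)"
    using x exp_ge_add_one_self[of x] by (simp add: exp_minus inverse_eq_divide frac_le)
  also have "\<dots> \<le> 1 - x + x\<^sup>2"
  proof -
    have "1 \<le> (1 - x + x\<^sup>2) * (1 + x)" using x by (simp add: algebra_simps power2_eq_square)
    then show ?thesis using x by (simp add: divide_le_eq)
  qed
  finally show ?thesis .
qed

lemma exp_minus_le_chord:
  fixes z c :: real
  assumes "0 \<le> z" "z \<le> 1"
  shows "exp (- (c * z)) \<le> 1 - (1 - exp (- c)) * z"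
proof -
  have "exp ((1 - z) *\<^sub>R 0 + z *\<^sub>R (- c)) \<le> (1 - z) * exp 0 + z * exp (- c)"
    by (rule convex_onD[OF exp_convex]) (use assms in auto)
  then show ?thesis by (simp add: algebra_simps)
qed

lemma exp_le_one_minus:
  fixes x :: real
  assumes "x < 1"
  shows "exp (- (x / (1 - x))) \<le> 1 - x"
proof -
  have "1 / (1 - x) = 1 + x / (1 - x)" using assms by (simp add: field_simps)
  also have "\<dots> \<le> exp (x / (1 - x))" by (rule exp_ge_add_one_self)
  finally show ?thesis using assms by (simp add: exp_minus field_simps)
qed

section \<open>One round on an expander\<close>

definition growth_rate :: "protocol \<Rightarrow> real \<Rightarrow> real" where
  "growth_rate P q = (pushes P + pulls P) * q"

text \<open>Idealised probability of staying uninformed when all neighbours are informed. The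
  argument \<open>x\<close> absorbs irregular degrees: it is \<open>d / D\<close> in upper bounds,
  \<open>D / (d - 1)\<close> in lower bounds, and both tend to 1.\<close>

definition survival :: "protocol \<Rightarrow> real \<Rightarrow> real \<Rightarrow> real" where
  "survival P q x = exp (- (pushes P * q * x)) * (1 - pulls P * q)"

text \<open>The window \<open>d\<close>, \<open>D\<close> for the degrees and the bound
  \<open>mix\<close> with error \<eta> are all that is kept of the expander.\<close>

locale gossip_expander = gossip +
  fixes d D \<eta> :: real
  assumes d: "1 < d" and deg_ge: "\<And>v. v < n \<Longrightarrow> d \<le> degree E v" and deg_le: "\<And>v. v < n \<Longrightarrow> degree E v \<le> D"
    and n1: "n \<ge> 1" and eta: "0 \<le> \<eta>"
    and mix: "\<And>S. S \<subseteq> {..<n} \<Longrightarrow> (\<Sum>u<n. (real (card (nbrs E u \<inter> S)))\<^sup>2) \<le> D\<^sup>2 * real (card S) * (card S / n + \<eta>)"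
begin

definition hits :: "nat set \<Rightarrow> nat \<Rightarrow> real" where "hits S u = real (card (nbrs E u \<inter> S))"
abbreviation rate :: real where "rate \<equiv> growth_rate P q"
definition fluct :: "nat set \<Rightarrow> real" where "fluct S = sqrt (card S / n + \<eta>)"

lemma rate_bounds: "q \<le> rate" "rate \<le> 2" "0 < rate"
proof -
  have "pushes P + pulls P \<le> 2" using pushes_01[of P] by simp
  then have "rate \<le> 2 * 1" unfolding growth_rate_def using q by (intro mult_mono) auto
  then show "rate \<le> 2" by simp
  have "1 * q \<le> rate" unfolding growth_rate_def using q pushes_01[of P] by (intro mult_right_mono) auto
  then show "q \<le> rate" "0 < rate" using q by auto
qed

lemma d_le_D: "d \<le> D"
  using deg_ge[of 0] deg_le[of 0] n1 by simp

lemma D_pos: "0 < D" and d_pos: "0 < d"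
  using d_le_D d by auto

lemma fluct_nonneg: "0 \<le> fluct S"
  using eta by (simp add: fluct_def)

lemma hits_nonneg: "0 \<le> hits S u"
  by (simp add: hits_def)

lemma hits_le_degree: "hits S u \<le> degree E u"
  by (simp add: hits_def degree_def card_mono)

lemma hits_compl:
  shows "hits (uninf S) u + hits S u = degree E u"
proof -
  have "nbrs E u = (nbrs E u \<inter> uninf S) \<union> (nbrs E u \<inter> S)" using nbrs_subset by auto
  then have "card (nbrs E u) = card (nbrs E u \<inter> uninf S) + card (nbrs E u \<inter> S)"
    by (metis (no_types, lifting) Diff_disjoint Int_assoc Int_commute Int_empty_right card_Un_disjoint finite_Int finite_nbrs)
  then show ?thesis by (simp add: hits_def degree_def)
qed

lemma hits_eq_sum:
  assumes "S \<subseteq> {..<n}"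
  shows "hits S u = (\<Sum>v\<in>S. of_bool (E v u))"
proof -
  have "finite S" using assms finite_subset by blast
  then have "(\<Sum>v\<in>S. of_bool (E v u)) = real (card {v \<in> S. E v u})"
    by (simp add: of_bool_def sum.If_cases Int_def)
  also have "{v \<in> S. E v u} = nbrs E u \<inter> S" by (auto simp: nbrs_def edge_sym[of u])
  finally show ?thesis by (simp add: hits_def)
qed

lemma sum_hits:
  assumes "S \<subseteq> {..<n}"
  shows "(\<Sum>u<n. hits S u) = (\<Sum>v\<in>S. real (degree E v))"
proof -
  have "(\<Sum>u<n. hits S u) = (\<Sum>v\<in>S. \<Sum>u<n. of_bool (E v u))"
    unfolding hits_eq_sum[OF assms] by (rule sum.swap)
  also have "\<dots> = (\<Sum>v\<in>S. real (degree E v))"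
  proof (intro sum.cong refl)
    fix v assume "v \<in> S"
    have "{u \<in> {..<n}. E v u} = nbrs E v" using nbrs_subset[of v] by (auto simp: nbrs_def)
    then show "(\<Sum>u<n. of_bool (E v u)) = real (degree E v)"
      by (simp add: of_bool_def sum.If_cases Int_def degree_def)
  qed
  finally show ?thesis .
qed

lemma sum_hits_bounds:
  assumes S: "S \<subseteq> {..<n}"
  shows "d * real (card S) \<le> (\<Sum>u<n. hits S u)" "(\<Sum>u<n. hits S u) \<le> D * real (card S)"
proof -
  have "(\<Sum>v\<in>S. d) \<le> (\<Sum>v\<in>S. real (degree E v))" using deg_ge S by (intro sum_mono) auto
  moreover have "(\<Sum>v\<in>S. real (degree E v)) \<le> (\<Sum>v\<in>S. D)" using deg_le S by (intro sum_mono) auto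
  ultimately show "d * real (card S) \<le> (\<Sum>u<n. hits S u)" "(\<Sum>u<n. hits S u) \<le> D * real (card S)"
    using sum_hits[OF S] by (simp_all add: mult.commute)
qed

lemma sum_hits_square:
  "S \<subseteq> {..<n} \<Longrightarrow> (\<Sum>u<n. (hits S u)\<^sup>2) \<le> D\<^sup>2 * real (card S) * (fluct S)\<^sup>2"
  using mix[of S] eta by (simp add: hits_def fluct_def)

text \<open>Cauchy-Schwarz turns the second moment into a first moment: a vertex of \<open>S\<close>
  has on average at most \<open>D * fluct S\<close> neighbours in \<open>S\<close>. It is applied to
  small informed sets and, near the end, to small uninformed sets.\<close>

lemma sum_hits_inside:
  assumes S: "S \<subseteq> {..<n}"
  shows "(\<Sum>u\<in>S. hits S u) \<le> D * fluct S * real (card S)"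
proof -
  have "(\<Sum>u\<in>S. 1 * hits S u)\<^sup>2 \<le> (\<Sum>u\<in>S. 1\<^sup>2) * (\<Sum>u\<in>S. (hits S u)\<^sup>2)"
    by (rule Cauchy_Schwarz_ineq_sum)
  also have "\<dots> \<le> real (card S) * (\<Sum>u<n. (hits S u)\<^sup>2)"
    using S by (simp, intro mult_left_mono sum_mono2) auto
  also have "\<dots> \<le> real (card S) * (D\<^sup>2 * real (card S) * (fluct S)\<^sup>2)"
    by (intro mult_left_mono sum_hits_square S) simp
  also have "\<dots> = (D * fluct S * real (card S))\<^sup>2" by (simp add: power2_eq_square)
  finally show ?thesis
    using D_pos fluct_nonneg by (intro power2_le_imp_le[of "sum (hits S) S"]) auto
qed

lemma sum_hits_outside:
  assumes S: "S \<subseteq> {..<n}"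
  shows "(d - D * fluct S) * real (card S) \<le> (\<Sum>u\<in>uninf S. hits S u)"
proof -
  have "(\<Sum>u<n. hits S u) = (\<Sum>u\<in>uninf S. hits S u) + (\<Sum>u\<in>S. hits S u)"
    using S by (intro sum.subset_diff) auto
  then show ?thesis using sum_hits_bounds(1)[OF S] sum_hits_inside[OF S] by (simp add: algebra_simps)
qed

lemma push_factor_bounds:
  assumes "v < n"
  shows "0 \<le> pushes P * q * of_bool (E v u) / degree E v" "pushes P * q * of_bool (E v u) / degree E v \<le> 1"
  using factor_01(2,4)[OF assms, of "{u}"] by (simp_all add: card_nbrs_Int)

lemma sum_push_factor:
  assumes S: "S \<subseteq> {..<n}"
  shows "pushes P * q * hits S u / D \<le> (\<Sum>v\<in>S. pushes P * q * of_bool (E v u) / degree E v)"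
    and "(\<Sum>v\<in>S. pushes P * q * of_bool (E v u) / degree E v) \<le> pushes P * q * hits S u / d"
proof -
  have nn: "0 \<le> pushes P * q * of_bool (E v u)" for v using pushes_01 q by simp
  have "pushes P * q * hits S u / D = (\<Sum>v\<in>S. pushes P * q * of_bool (E v u) / D)"
    unfolding hits_eq_sum[OF S] by (simp only: sum_distrib_left sum_divide_distrib)
  also have "\<dots> \<le> (\<Sum>v\<in>S. pushes P * q * of_bool (E v u) / degree E v)"
    using S deg_le deg_ge d by (intro sum_mono divide_left_mono nn mult_pos_pos D_pos) force+
  finally show "pushes P * q * hits S u / D \<le> (\<Sum>v\<in>S. pushes P * q * of_bool (E v u) / degree E v)" .
  have "(\<Sum>v\<in>S. pushes P * q * of_bool (E v u) / degree E v) \<le> (\<Sum>v\<in>S. pushes P * q * of_bool (E v u) / d)"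
    using S deg_le deg_ge d by (intro sum_mono divide_left_mono nn mult_pos_pos d_pos) force+
  also have "\<dots> = pushes P * q * hits S u / d"
    unfolding hits_eq_sum[OF S] by (simp only: sum_distrib_left sum_divide_distrib)
  finally show "(\<Sum>v\<in>S. pushes P * q * of_bool (E v u) / degree E v) \<le> pushes P * q * hits S u / d" .
qed

text \<open>Union bound: each informed neighbour adds at most \<open>q / d\<close> in each direction
  the protocol uses.\<close>

lemma miss_ge_linear:
  assumes S: "S \<subseteq> {..<n}" and u: "u \<in> uninf S"
  shows "1 - miss S u \<le> rate * hits S u / d"
proof -
  define x where "x = (\<lambda>v. pushes P * q * of_bool (E v u) / degree E v)"
  have x: "0 \<le> x v" "x v \<le> 1" if "v \<in> S" for v
    unfolding x_def by (rule push_factor_bounds; use that S in auto)+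
  define A where "A = (\<Prod>v\<in>S. 1 - x v)"
  define y where "y = pulls P * q * hits S u / degree E u"
  have y: "0 \<le> y" "y \<le> pulls P * q * hits S u / d"
    using pushes_01 q deg_ge[of u] u d by (auto simp: y_def hits_nonneg intro!: divide_left_mono mult_pos_pos)
  have A1: "A \<le> 1" unfolding A_def using x by (intro prod_le_1) auto
  have "1 - sum x S \<le> A"
    unfolding A_def using x finite_subset[OF S] by (intro one_minus_sum_le_prod) auto
  then have A2: "1 - A \<le> pushes P * q * hits S u / d"
    using sum_push_factor(2)[OF S, of u, folded x_def] by linarith
  have "miss S u = A - A * y" unfolding miss_def A_def y_def hits_def x_def by (simp add: right_diff_distrib)
  moreover have "A * y \<le> 1 * y" using A1 y by (intro mult_right_mono) auto
  ultimately have "1 - miss S u \<le> pushes P * q * hits S u / d + pulls P * q * hits S u / d"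
    using A2 y by linarith
  then show ?thesis by (simp add: growth_rate_def add_divide_distrib algebra_simps)
qed

lemma miss_le_product:
  assumes S: "S \<subseteq> {..<n}" and u: "u \<in> uninf S"
  shows "miss S u \<le> exp (- (pushes P * q * hits S u / D)) * (1 - pulls P * q * hits S u / degree E u)"
proof -
  have "(\<Prod>v\<in>S. 1 - pushes P * q * of_bool (E v u) / degree E v) \<le>
      exp (- (\<Sum>v\<in>S. pushes P * q * of_bool (E v u) / degree E v))"
    using S by (intro prod_one_minus_le_exp push_factor_bounds) auto
  also have "\<dots> \<le> exp (- (pushes P * q * hits S u / D))" using sum_push_factor(1)[OF S, of u] by simp
  finally show ?thesis unfolding miss_def hits_def using factor_01(1)[of u S] u by (intro mult_right_mono) auto
qed

lemma miss_le_exp: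
  assumes S: "S \<subseteq> {..<n}" and u: "u \<in> uninf S"
  shows "miss S u \<le> exp (- (rate * (hits S u / D)))"
proof -
  have "pulls P * q * hits S u / D \<le> pulls P * q * hits S u / degree E u"
    using pushes_01 q deg_le[of u] deg_ge[of u] u d by (intro divide_left_mono mult_nonneg_nonneg hits_nonneg mult_pos_pos D_pos) auto
  then have "1 - pulls P * q * hits S u / degree E u \<le> exp (- (pulls P * q * hits S u / D))"
    using exp_ge_add_one_self[of "- (pulls P * q * hits S u / D)"] by linarith
  then have "exp (- (pushes P * q * hits S u / D)) * (1 - pulls P * q * hits S u / degree E u) \<le>
      exp (- (pushes P * q * hits S u / D)) * exp (- (pulls P * q * hits S u / D))"
    by (intro mult_left_mono) auto
  also have "\<dots> = exp (- (rate * (hits S u / D)))"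
    by (simp add: growth_rate_def algebra_simps add_divide_distrib flip: exp_add)
  finally show ?thesis using miss_le_product[OF S u] by linarith
qed

lemma hits_ratio: "u < n \<Longrightarrow> 0 \<le> hits S u / D \<and> hits S u / D \<le> 1"
  using hits_nonneg[of S u] hits_le_degree[of S u] deg_le[of u] D_pos by auto

text \<open>No expansion enters here: summing the union bound counts the edges leaving
  \<open>S\<close>, and the degrees bound these.\<close>

lemma growth_le:
  assumes S: "S \<subseteq> {..<n}"
  shows "(\<Sum>u\<in>uninf S. 1 - miss S u) \<le> rate * (D / d) * real (card S)"
proof -
  have "(\<Sum>u\<in>uninf S. 1 - miss S u) \<le> (\<Sum>u\<in>uninf S. rate * hits S u / d)"
    by (intro sum_mono miss_ge_linear S)
  also have "\<dots> \<le> (\<Sum>u<n. rate * hits S u / d)"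
    using rate_bounds d_pos hits_nonneg by (intro sum_mono2) auto
  also have "\<dots> = rate / d * (\<Sum>u<n. hits S u)" by (simp add: sum_distrib_left sum_divide_distrib)
  also have "\<dots> \<le> rate / d * (D * real (card S))"
    using rate_bounds d_pos by (intro mult_left_mono sum_hits_bounds S) auto
  finally show ?thesis by (simp add: algebra_simps)
qed

text \<open>Expanding the exponential to second order, the linear part counts edges leaving
  \<open>S\<close> and the quadratic part, the waste by overlapping neighbourhoods, is bounded by
  \<open>mix\<close>. The 4 is the square of the bound 2 for \<open>rate\<close>.\<close>

lemma growth_ge:
  assumes S: "S \<subseteq> {..<n}"
  shows "(rate * (d / D - fluct S) - 4 * (fluct S)\<^sup>2) * real (card S) \<le> (\<Sum>u\<in>uninf S. 1 - miss S u)"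
proof -
  have "rate * (d / D - fluct S) * real (card S) = rate / D * ((d - D * fluct S) * real (card S))"
    using D_pos by (simp add: field_simps)
  also have "\<dots> \<le> rate / D * (\<Sum>u\<in>uninf S. hits S u)"
    using rate_bounds D_pos by (intro mult_left_mono sum_hits_outside S) auto
  finally have 1: "rate * (d / D - fluct S) * real (card S) \<le> (\<Sum>u\<in>uninf S. rate * (hits S u / D))"
    by (simp add: sum_distrib_left sum_divide_distrib)
  have "(\<Sum>u\<in>uninf S. 4 * (hits S u / D)\<^sup>2) \<le> (\<Sum>u<n. 4 * (hits S u / D)\<^sup>2)"
    by (intro sum_mono2) auto
  also have "\<dots> = 4 / D\<^sup>2 * (\<Sum>u<n. (hits S u)\<^sup>2)"
    by (simp add: sum_distrib_left sum_divide_distrib power_divide)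
  also have "\<dots> \<le> 4 / D\<^sup>2 * (D\<^sup>2 * real (card S) * (fluct S)\<^sup>2)"
    by (intro mult_left_mono sum_hits_square S) simp
  also have "\<dots> = 4 * (fluct S)\<^sup>2 * real (card S)" using D_pos by simp
  finally have 2: "(\<Sum>u\<in>uninf S. 4 * (hits S u / D)\<^sup>2) \<le> 4 * (fluct S)\<^sup>2 * real (card S)" .
  have "(\<Sum>u\<in>uninf S. rate * (hits S u / D) - 4 * (hits S u / D)\<^sup>2) \<le> (\<Sum>u\<in>uninf S. 1 - miss S u)"
  proof (intro sum_mono)
    fix u assume u: "u \<in> uninf S"
    define x where "x = rate * (hits S u / D)"
    have "x\<^sup>2 \<le> 4 * (hits S u / D)\<^sup>2"
      unfolding x_def power_mult_distrib using rate_bounds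
      by (intro mult_right_mono) (use power_mono[of rate 2 2] in auto)
    moreover have "0 \<le> x" 
      unfolding x_def using rate_bounds hits_ratio[of u S] u by (intro mult_nonneg_nonneg) auto
    then have "exp (- x) \<le> 1 - x + x\<^sup>2" by (rule exp_minus_le_quadratic)
    ultimately show "rate * (hits S u / D) - 4 * (hits S u / D)\<^sup>2 \<le> 1 - miss S u"
      using miss_le_exp[OF S u] unfolding x_def by linarith
  qed
  then show ?thesis using 1 2 by (simp add: sum_subtractf algebra_simps)
qed

text \<open>For sets of linear size the quadratic error of \<open>growth_ge\<close> may exceed its
  main term. The chord of the exponential loses a constant factor but remains positive whenever
  \<open>fluct S < d / D\<close>.\<close>

lemma growth_ge_chord:
  assumes S: "S \<subseteq> {..<n}"
  shows "(1 - exp (- rate)) * (d / D - fluct S) * real (card S) \<le> (\<Sum>u\<in>uninf S. 1 - miss S u)"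
proof -
  have r: "0 \<le> 1 - exp (- rate)" using rate_bounds by simp
  have "(1 - exp (- rate)) * (d / D - fluct S) * real (card S) = (1 - exp (- rate)) / D * ((d - D * fluct S) * real (card S))"
    using D_pos by (simp add: field_simps)
  also have "\<dots> \<le> (1 - exp (- rate)) / D * (\<Sum>u\<in>uninf S. hits S u)"
    using r D_pos by (intro mult_left_mono sum_hits_outside S) auto
  also have "\<dots> = (\<Sum>u\<in>uninf S. (1 - exp (- rate)) * (hits S u / D))"
    by (simp add: sum_distrib_left sum_divide_distrib)
  also have "\<dots> \<le> (\<Sum>u\<in>uninf S. 1 - miss S u)"
  proof (intro sum_mono)
    fix u assume u: "u \<in> uninf S"
    then show "(1 - exp (- rate)) * (hits S u / D) \<le> 1 - miss S u"
      using miss_le_exp[OF S u] exp_minus_le_chord[of "hits S u / D" rate] hits_ratio[of u S] by simp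
  qed
  finally show ?thesis .
qed

abbreviation survive :: "real \<Rightarrow> real" where "survive \<equiv> survival P q"

lemma pulls_q: "0 \<le> pulls P * q" "pulls P * q \<le> 1" "0 \<le> pushes P * q" "pushes P * q \<le> 1"
  using pushes_01 q by (auto intro!: mult_le_one)

text \<open>When few vertices are uninformed, most of them have few uninformed neighbours. Each such
  neighbour raises the survival probability by at most \<open>3 / d\<close>, and
  \<open>sum_hits_inside\<close> for the uninformed set counts them.\<close>

lemma sum_miss_le:
  assumes S: "S \<subseteq> {..<n}"
  shows "(\<Sum>u\<in>uninf S. miss S u) \<le> (survive (d / D) + 3 * (D / d) * fluct (uninf S)) * real (card (uninf S))"
proof -
  have pt: "miss S u \<le> survive (d / D) + 3 / d * hits (uninf S) u" if u: "u \<in> uninf S" for u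
  proof -
    \<comment> \<open>The factor 3 is composed of 2 from the push part, where
      \<open>exp y \<le> 1 + 2 * y\<close> on the unit interval, and 1 from the pull part.\<close>
    define t where "t = hits (uninf S) u"
    have t0: "0 \<le> t" by (simp add: t_def hits_nonneg)
    have ht: "hits S u = degree E u - t" using hits_compl[of S u] by (simp add: t_def)
    have dg: "d \<le> degree E u" "degree E u \<le> D" using deg_ge deg_le u by auto
    have tD: "t \<le> D" using hits_le_degree[of "uninf S" u] dg by (simp add: t_def)
    define A where "A = exp (- (pushes P * q * hits S u / D))"
    have A: "0 \<le> A" "A \<le> 1"
      unfolding A_def using pulls_q hits_nonneg[of S u] D_pos by auto
    define y where "y = pushes P * q * t / D"
    have "y = (pushes P * q) * (t / D)" by (simp add: y_def)
    also have "\<dots> \<le> 1 * (t / D)" using pulls_q t0 D_pos by (intro mult_right_mono) auto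
    finally have yt: "y \<le> t / D" by simp
    have "t / D \<le> 1" using tD D_pos by simp
    then have "y \<le> 1" using yt by linarith
    moreover have "0 \<le> y" using D_pos t0 pulls_q by (simp add: y_def)
    ultimately have y: "0 \<le> y" "y \<le> 1" by simp_all
    have "- (pushes P * q * hits S u / D) \<le> - (pushes P * q * (d / D)) + y"
    proof -
      have "pushes P * q * (d / D) \<le> pushes P * q * (degree E u / D)"
        using pulls_q dg D_pos by (intro mult_left_mono divide_right_mono) auto
      then show ?thesis by (simp add: y_def ht algebra_simps diff_divide_distrib)
    qed
    then have "A \<le> exp (- (pushes P * q * (d / D))) * exp y" unfolding A_def by (simp flip: exp_add)
    also have "\<dots> \<le> exp (- (pushes P * q * (d / D))) * (1 + 2 * y)"
    proof (intro mult_left_mono)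
      have "y\<^sup>2 \<le> y" using y by (simp add: power2_eq_square mult_left_le)
      then show "exp y \<le> 1 + 2 * y" using exp_bound[OF y] by simp
    qed simp
    also have "\<dots> \<le> exp (- (pushes P * q * (d / D))) + 2 * y"
    proof -
      have "exp (- (pushes P * q * (d / D))) * (2 * y) \<le> 1 * (2 * y)"
        using pulls_q d_pos D_pos y by (intro mult_right_mono) auto
      then show ?thesis by (simp add: algebra_simps)
    qed
    finally have A2: "A \<le> exp (- (pushes P * q * (d / D))) + 2 * (t / D)" using yt by linarith
    have "pulls P * q * t / degree E u \<le> 1 * t / d"
      using pulls_q dg d_pos t0 by (intro frac_le mult_right_mono) auto
    then have B: "1 - pulls P * q * hits S u / degree E u \<le> 1 - pulls P * q + t / d"
      using dg d_pos by (simp add: ht diff_divide_distrib right_diff_distrib)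
    have "miss S u \<le> A * (1 - pulls P * q * hits S u / degree E u)"
      unfolding A_def by (rule miss_le_product[OF S u])
    also have "\<dots> \<le> A * (1 - pulls P * q + t / d)" using B A by (intro mult_left_mono)
    also have "\<dots> = A * (1 - pulls P * q) + A * (t / d)" by (simp add: algebra_simps)
    also have "\<dots> \<le> (exp (- (pushes P * q * (d / D))) + 2 * (t / D)) * (1 - pulls P * q) + 1 * (t / d)"
      using A A2 pulls_q t0 d_pos by (intro add_mono mult_right_mono) auto
    also have "\<dots> \<le> survive (d / D) + 2 * (t / D) * 1 + t / d"
      using pulls_q t0 D_pos unfolding survival_def distrib_right by (intro add_mono mult_left_mono) auto
    also have "2 * (t / D) \<le> 2 * (t / d)"
      using t0 d_le_D d_pos D_pos by (simp add: divide_left_mono)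
    finally show ?thesis by (simp add: t_def)
  qed
  have "(\<Sum>u\<in>uninf S. miss S u) \<le> (\<Sum>u\<in>uninf S. survive (d / D) + 3 / d * hits (uninf S) u)"
    by (intro sum_mono pt)
  also have "\<dots> = survive (d / D) * real (card (uninf S)) + 3 / d * (\<Sum>u\<in>uninf S. hits (uninf S) u)"
    by (simp add: sum.distrib sum_distrib_left)
  also have "\<dots> \<le> survive (d / D) * real (card (uninf S)) + 3 / d * (D * fluct (uninf S) * real (card (uninf S)))"
    using d_pos by (intro add_left_mono mult_left_mono sum_hits_inside) auto
  finally show ?thesis by (simp add: algebra_simps)
qed

text \<open>The chance to survive is least when all neighbours are informed, so the bound needs no
  assumption on the size of \<open>S\<close>.\<close>

lemma miss_ge_survive:
  assumes S: "S \<subseteq> {..<n}" and u: "u \<in> uninf S"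
  shows "survive (D / (d - 1)) \<le> miss S u"
proof -
  have "exp (- (pushes P * q * (D / (d - 1)))) \<le> (\<Prod>v\<in>S. 1 - pushes P * q * of_bool (E v u) / degree E v)"
  proof -
    have "pushes P * q * hits S u \<le> pushes P * q * D"
      using pulls_q hits_le_degree[of S u] deg_le[of u] u by (intro mult_left_mono) auto
    then have "pushes P * q * hits S u / (d - 1) \<le> pushes P * q * (D / (d - 1))"
      using d by (simp add: divide_right_mono)
    then have "exp (- (pushes P * q * (D / (d - 1)))) \<le> exp (- (pushes P * q * hits S u / (d - 1)))" by simp
    also have "\<dots> = (\<Prod>v\<in>S. exp (- (pushes P * q * of_bool (E v u) / (d - 1))))"
      using exp_sum[OF finite_subset[OF S finite_lessThan], of "\<lambda>v. - (pushes P * q * of_bool (E v u) / (d - 1))"]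
      by (simp only: hits_eq_sum[OF S] sum_distrib_left sum_divide_distrib sum_negf)
    also have "\<dots> \<le> (\<Prod>v\<in>S. 1 - pushes P * q * of_bool (E v u) / degree E v)"
    proof (intro prod_mono conjI exp_ge_zero)
      fix v assume "v \<in> S"
      then have v: "v < n" "d \<le> degree E v" using S deg_ge by auto
      define x where "x = pushes P * q * of_bool (E v u)"
      have x: "0 \<le> x" "x \<le> 1" using pulls_q by (auto simp: x_def)
      have "x / degree E v \<le> x / d" using x v d_pos by (intro divide_left_mono) auto
      \<comment> \<open>Origin of \<open>d - 1\<close>: the lower bound for \<open>1 - x / d\<close>
        has the exponent \<open>x / (d - x)\<close>, and \<open>x\<close> is at most 1.\<close>
      have "exp (- (x / (d - 1))) \<le> exp (- (x / (d - x)))"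
        using x d by (simp add: divide_left_mono)
      also have "x / (d - x) = (x / d) / (1 - x / d)" using d x by (simp add: field_simps)
      also have "exp (- ((x / d) / (1 - x / d))) \<le> 1 - x / d"
        using x d by (intro exp_le_one_minus) (simp add: divide_less_eq)
      also have "\<dots> \<le> 1 - x / degree E v" using \<open>x / degree E v \<le> x / d\<close> by simp
      finally show "exp (- (pushes P * q * of_bool (E v u) / (d - 1))) \<le> 1 - pushes P * q * of_bool (E v u) / degree E v"
        by (simp add: x_def)
    qed
    finally show ?thesis .
  qed
  moreover have "1 - pulls P * q \<le> 1 - pulls P * q * card (nbrs E u \<inter> S) / degree E u"
  proof -
    have "hits S u / degree E u \<le> 1" using hits_le_degree[of S u] deg_ge[of u] u d by (simp add: divide_le_eq_1)
    then have "pulls P * q * (hits S u / degree E u) \<le> pulls P * q"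
      by (rule mult_left_le[OF _ pulls_q(1)])
    then show ?thesis by (simp add: hits_def)
  qed
  ultimately show ?thesis unfolding survival_def miss_def using pulls_q
    by (intro mult_mono) (auto intro!: prod_nonneg order_trans[OF exp_ge_zero])
qed

end

subsection \<open>Drift in finite Markov chains\<close>

text \<open>Recursion on the first round with arbitrary start, the form needed to condition on that
  round; \<open>informed_after\<close> appends rounds at the end, and \<open>evolve_add\<close>
  reconciles the two.\<close>

primrec evolve :: "('a \<Rightarrow> 'a pmf) \<Rightarrow> nat \<Rightarrow> 'a \<Rightarrow> 'a pmf" where
  "evolve K 0 x = return_pmf x"
| "evolve K (Suc t) x = K x \<bind> evolve K t"

lemma evolve_add: "evolve K (s + t) x = evolve K s x \<bind> evolve K t"
  by (induction s arbitrary: x) (simp_all add: bind_return_pmf bind_assoc_pmf cong: bind_pmf_cong)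

lemma informed_after_evolve: "informed_after P n E q v0 t = evolve (round_step P n E q) t {v0}"
proof (induction t)
  case (Suc t)
  have "evolve (round_step P n E q) (t + 1) {v0} = evolve (round_step P n E q) t {v0} \<bind> evolve (round_step P n E q) 1"
    by (rule evolve_add)
  moreover have ret: "evolve (round_step P n E q) 0 = return_pmf" by (rule ext) simp
  have "evolve (round_step P n E q) 1 = round_step P n E q"
    by (rule ext) (simp only: One_nat_def evolve.simps(2) ret bind_return_pmf')
  ultimately show ?case using Suc by simp
qed simp

lemma prob_eq_expectation: "measure_pmf.prob M A = measure_pmf.expectation M (indicat_real A)"
  by simp

lemma prob_le_expectation:
  fixes \<phi> :: "'a \<Rightarrow> real"
  assumes fin: "finite (set_pmf M)" and "\<And>x. x \<in> set_pmf M \<Longrightarrow> 0 \<le> \<phi> x"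
    and "\<And>x. x \<in> set_pmf M \<Longrightarrow> x \<in> A \<Longrightarrow> c \<le> \<phi> x" and "0 < c"
  shows "measure_pmf.prob M A \<le> measure_pmf.expectation M \<phi> / c"
proof -
  note int = integrable_measure_pmf_finite[OF fin]
  have "measure_pmf.expectation M (indicat_real A) \<le> measure_pmf.expectation M (\<lambda>x. \<phi> x / c)"
    by (intro integral_mono_AE int) (use assms in \<open>auto simp: AE_measure_pmf_iff indicator_def\<close>)
  then show ?thesis by (simp add: int)
qed

text \<open>With finitely many states every expectation is a finite sum, so integrability is
  automatic.\<close>

locale finite_chain =
  fixes K :: "'a \<Rightarrow> 'a pmf" and X :: "'a set"
  assumes fin: "finite X" and closed: "\<And>x. x \<in> X \<Longrightarrow> set_pmf (K x) \<subseteq> X"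
begin

lemma set_evolve: "x \<in> C \<Longrightarrow> (\<And>y. y \<in> C \<Longrightarrow> set_pmf (K y) \<subseteq> C) \<Longrightarrow> set_pmf (evolve K t x) \<subseteq> C"
proof (induction t arbitrary: x)
  case (Suc t)
  then have "set_pmf (evolve K t y) \<subseteq> C" if "y \<in> set_pmf (K x)" for y
    using that by blast
  then show ?case by auto
qed simp

lemma set_evolve_X: "x \<in> X \<Longrightarrow> set_pmf (evolve K t x) \<subseteq> X"
  using set_evolve closed by blast

lemma finite_set_evolve: "x \<in> X \<Longrightarrow> finite (set_pmf (evolve K t x))"
  using set_evolve_X fin finite_subset by blast

text \<open>Induction by conditioning on the first step. The drift is required only on a closed set
  \<open>C\<close>, so that a phase can use any property that the growth of the informed set
  preserves.\<close>

lemma expectation_drift: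
  fixes \<phi> :: "'a \<Rightarrow> real"
  assumes C: "C \<subseteq> X" "\<And>y. y \<in> C \<Longrightarrow> set_pmf (K y) \<subseteq> C" and r: "0 \<le> r"
    and drift: "\<And>y. y \<in> C \<Longrightarrow> measure_pmf.expectation (K y) \<phi> \<le> r * \<phi> y"
    and x: "x \<in> C"
  shows "measure_pmf.expectation (evolve K t x) \<phi> \<le> r ^ t * \<phi> x"
  using x
proof (induction t arbitrary: x)
  case (Suc t)
  have finC: "finite C" using C fin finite_subset by blast
  have "measure_pmf.expectation (evolve K (Suc t) x) \<phi> = (\<Sum>a\<in>C. pmf (K x) a *\<^sub>R measure_pmf.expectation (evolve K t a) \<phi>)"
    unfolding evolve.simps using C Suc finite_set_evolve by (intro pmf_expectation_bind finC) auto
  also have "\<dots> \<le> (\<Sum>a\<in>C. pmf (K x) a *\<^sub>R (r ^ t * \<phi> a))"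
    using Suc by (intro sum_mono scaleR_left_mono) auto
  also have "\<dots> = r ^ t * (\<Sum>a\<in>C. pmf (K x) a *\<^sub>R \<phi> a)" by (simp add: sum_distrib_left mult_ac)
  also have "(\<Sum>a\<in>C. pmf (K x) a *\<^sub>R \<phi> a) = measure_pmf.expectation (K x) \<phi>"
    using C Suc by (intro integral_measure_pmf[symmetric] finC) auto
  also have "r ^ t * \<dots> \<le> r ^ t * (r * \<phi> x)" using drift Suc r by (intro mult_left_mono) auto
  finally show ?case by (simp add: mult_ac)
qed simp

lemma prob_drift:
  fixes \<phi> :: "'a \<Rightarrow> real"
  assumes C: "C \<subseteq> X" "\<And>y. y \<in> C \<Longrightarrow> set_pmf (K y) \<subseteq> C" and r: "0 \<le> r"
    and drift: "\<And>y. y \<in> C \<Longrightarrow> measure_pmf.expectation (K y) \<phi> \<le> r * \<phi> y"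
    and x: "x \<in> C" and nn: "\<And>y. y \<in> C \<Longrightarrow> 0 \<le> \<phi> y"
    and c: "0 < c" "\<And>y. y \<in> C \<Longrightarrow> y \<in> A \<Longrightarrow> c \<le> \<phi> y"
  shows "measure_pmf.prob (evolve K t x) A \<le> r ^ t * \<phi> x / c"
proof -
  have s: "set_pmf (evolve K t x) \<subseteq> C" using set_evolve[OF x C(2)] .
  have "measure_pmf.prob (evolve K t x) A \<le> measure_pmf.expectation (evolve K t x) \<phi> / c"
    using s nn c C x by (intro prob_le_expectation finite_set_evolve) auto
  also have "\<dots> \<le> r ^ t * \<phi> x / c"
    using expectation_drift[OF C r drift x] c by (simp add: divide_right_mono)
  finally show ?thesis .
qed

text \<open>Glues phases by the Markov property: either the first \<open>s\<close> steps fail to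
  reach \<open>B\<close>, or the second phase fails from a state of \<open>B\<close>.\<close>

lemma prob_compose:
  assumes x: "x \<in> C" and C: "C \<subseteq> X" "\<And>y. y \<in> C \<Longrightarrow> set_pmf (K y) \<subseteq> C"
    and p: "measure_pmf.prob (evolve K s x) (- B) \<le> p"
    and p': "\<And>y. y \<in> C \<Longrightarrow> y \<in> B \<Longrightarrow> measure_pmf.prob (evolve K t y) A \<le> p'" and p'0: "0 \<le> p'"
  shows "measure_pmf.prob (evolve K (s + t) x) A \<le> p + p'"
proof -
  have finC: "finite C" using C fin finite_subset by blast
  have s: "set_pmf (evolve K s x) \<subseteq> C" using set_evolve[OF x C(2)] .
  have xX: "x \<in> X" using x C by auto
  note int = integrable_measure_pmf_finite[OF finite_set_evolve[OF xX]]
  have "measure_pmf.prob (evolve K (s + t) x) A = (\<Sum>a\<in>C. pmf (evolve K s x) a *\<^sub>R measure_pmf.expectation (evolve K t a) (indicat_real A))"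
    unfolding evolve_add prob_eq_expectation using C s finite_set_evolve by (intro pmf_expectation_bind finC) auto
  also have "\<dots> = measure_pmf.expectation (evolve K s x) (\<lambda>a. measure_pmf.prob (evolve K t a) A)"
    using s by (subst integral_measure_pmf[OF finC]) auto
  also have "\<dots> \<le> measure_pmf.expectation (evolve K s x) (\<lambda>a. indicat_real (- B) a + p')"
  proof (intro integral_mono_AE int, simp add: AE_measure_pmf_iff, intro ballI)
    fix a assume "a \<in> set_pmf (evolve K s x)"
    then have "a \<in> C" using s by auto
    then show "measure_pmf.prob (evolve K t a) A \<le> indicat_real (- B) a + p'"
      using p'[of a] p'0 by (cases "a \<in> B") (auto intro!: order_trans[OF measure_pmf.prob_le_1])
  qed
  also have "\<dots> = measure_pmf.prob (evolve K s x) (- B) + p'" by (simp add: int)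
  finally show ?thesis using p by linarith
qed

end

subsection \<open>Phases of the spreading process\<close>

text \<open>Not automatic, because of the subtracted square. In terms of reciprocals the function is
  \<open>(1 + 1 / k) * x - x\<^sup>2\<close>, increasing as long as the two arguments sum to at most
  \<open>1 + 1 / k\<close>.\<close>

lemma inverse_drift_antimono:
  fixes k G1 G2 :: real
  assumes "1 \<le> k" "k \<le> G1" "G1 \<le> G2"
  shows "(1 + 1 / k) / G2 - 1 / G2\<^sup>2 \<le> (1 + 1 / k) / G1 - 1 / G1\<^sup>2"
proof -
  define x y where "x = 1 / G1" and "y = 1 / G2"
  have xy: "y \<le> x" "x \<le> 1 / k" "1 / k \<le> 1" using assms by (auto simp: x_def y_def frac_le)
  then have "0 \<le> (x - y) * (1 + 1 / k - (x + y))" by (intro mult_nonneg_nonneg) auto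
  also have "(x - y) * (1 + 1 / k - (x + y)) = ((1 + 1 / k) * x - x\<^sup>2) - ((1 + 1 / k) * y - y\<^sup>2)"
    by (simp add: power2_eq_square) (simp only: algebra_simps)
  finally have "(1 + 1 / k) * y - y\<^sup>2 \<le> (1 + 1 / k) * x - x\<^sup>2" by simp
  then show ?thesis by (simp add: x_def y_def power_divide)
qed

context gossip_expander
begin

abbreviation step :: "nat set \<Rightarrow> nat set pmf" where "step \<equiv> round_step P n E q"

sublocale chain: finite_chain step "Pow {..<n}"
proof
  fix S assume "S \<in> Pow {..<n}"
  then have "S \<subseteq> {..<n}" by simp
  then show "set_pmf (step S) \<subseteq> Pow {..<n}" using set_round_step(2) by (meson PowI subsetI)
qed simp

definition at_least :: "nat \<Rightarrow> nat set set" where "at_least k = {S. S \<subseteq> {..<n} \<and> k \<le> card S}"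

lemma card_step_mono:
  assumes "S \<subseteq> {..<n}" "S' \<in> set_pmf (step S)"
  shows "card S \<le> card S'"
proof (rule card_mono)
  show "finite S'" using set_round_step(2)[OF assms] by (rule finite_subset) simp
qed (rule set_round_step(1)[OF assms])

lemma at_least_closed: "at_least k \<subseteq> Pow {..<n}" "S \<in> at_least k \<Longrightarrow> set_pmf (step S) \<subseteq> at_least k"
proof -
  show "at_least k \<subseteq> Pow {..<n}" by (auto simp: at_least_def)
  assume S: "S \<in> at_least k"
  show "set_pmf (step S) \<subseteq> at_least k"
  proof
    fix S' assume S': "S' \<in> set_pmf (step S)"
    have Sn: "S \<subseteq> {..<n}" using S by (simp add: at_least_def)
    have "S' \<subseteq> {..<n}" "card S \<le> card S'" using set_round_step(2)[OF Sn S'] card_step_mono[OF Sn S'] by auto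
    then show "S' \<in> at_least k" using S by (auto simp: at_least_def)
  qed
qed

text \<open>Being at most \<open>m\<close> means that \<open>1 / |S|\<close> is at least
  \<open>1 / m\<close>, which is where the factor \<open>m\<close> in Markov's bound comes from. A
  larger starting size \<open>k\<close> brings the contraction factor closer to the ideal
  \<open>1 / (1 + b)\<close>.\<close>

lemma growth_phase:
  assumes k: "1 \<le> k" and b: "0 < b" and m: "0 < m"
    and growth: "\<And>S. S \<in> at_least k \<Longrightarrow> real (card S) \<le> m \<Longrightarrow> b * real (card S) \<le> (\<Sum>u\<in>uninf S. 1 - miss S u)"
    and S: "S \<in> at_least k"
  shows "measure_pmf.prob (evolve step t S) {S'. real (card S') \<le> m} \<le> (1 / (1 + b) + b / (k * (1 + b)\<^sup>2)) ^ t * m"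
proof -
  define r where "r = 1 / (1 + b) + b / (real k * (1 + b)\<^sup>2)"
  have r0: "0 \<le> r" using b k by (simp add: r_def)
  \<comment> \<open>Cutting the potential off above \<open>m\<close> confines the drift condition to
    sizes where \<open>growth\<close> is assumed; sizes never decrease, so the potential stays 0
    once it is 0.\<close>
  define \<phi> where "\<phi> = (\<lambda>S' :: nat set. if real (card S') \<le> m then 1 / real (card S') else 0)"
  have drift: "measure_pmf.expectation (step T) \<phi> \<le> r * \<phi> T" if T: "T \<in> at_least k" for T
  proof -
    have Tn: "T \<subseteq> {..<n}" and kT: "k \<le> card T" using T by (auto simp: at_least_def)
    note int = integrable_measure_pmf_finite[OF finite_set_round_step[OF Tn]]
    show ?thesis
    proof (cases "real (card T) \<le> m")
      case False
      have "\<phi> S' = 0" if "S' \<in> set_pmf (step T)" for S'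
        using False card_step_mono[OF Tn that] by (simp add: \<phi>_def)
      then have "measure_pmf.expectation (step T) \<phi> = measure_pmf.expectation (step T) (\<lambda>_. 0)"
        by (intro integral_cong_AE) (simp_all add: AE_measure_pmf_iff)
      then show ?thesis using False by (simp add: \<phi>_def)
    next
      case True
      define \<kappa> where "\<kappa> = real (card T)"
      have \<kappa>: "1 \<le> \<kappa>" "real k \<le> \<kappa>" using kT k by (auto simp: \<kappa>_def)
      define g where "g = (\<Sum>u\<in>uninf T. 1 - miss T u)"
      have g: "b * \<kappa> \<le> g" unfolding g_def \<kappa>_def using growth[OF T True] .
      have "measure_pmf.expectation (step T) \<phi> \<le> measure_pmf.expectation (step T) (\<lambda>S'. 1 / real (card S'))"
        by (intro integral_mono_AE int) (simp add: \<phi>_def)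
      also have "\<dots> \<le> (1 + 1 / \<kappa>) / (\<kappa> + g) - 1 / (\<kappa> + g)\<^sup>2"
        unfolding \<kappa>_def g_def using kT k by (intro expectation_inverse_informed[OF Tn]) auto
      also have "\<dots> \<le> (1 + 1 / \<kappa>) / (\<kappa> + b * \<kappa>) - 1 / (\<kappa> + b * \<kappa>)\<^sup>2"
        using g b \<kappa> by (intro inverse_drift_antimono) auto
      also have "\<dots> = (1 / (1 + b) + b / (\<kappa> * (1 + b)\<^sup>2)) * (1 / \<kappa>)"
      proof -
        define a where "a = 1 + b"
        have "a > 0" "\<kappa> > 0" "b = a - 1" "\<kappa> + b * \<kappa> = a * \<kappa>" using b \<kappa> by (auto simp: a_def algebra_simps)
        then show ?thesis by (simp add: divide_simps power2_eq_square) (simp add: algebra_simps)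
      qed
      also have "\<dots> \<le> r * (1 / \<kappa>)"
        unfolding r_def using \<kappa> b k by (intro mult_right_mono add_left_mono divide_left_mono mult_pos_pos) auto
      finally show ?thesis using True by (simp add: \<phi>_def \<kappa>_def)
    qed
  qed
  have "measure_pmf.prob (evolve step t S) {S'. real (card S') \<le> m} \<le> r ^ t * \<phi> S / (1 / m)"
  proof (rule chain.prob_drift[OF at_least_closed r0 drift S])
    fix S' assume "S' \<in> at_least k" "S' \<in> {S'. real (card S') \<le> m}"
    then show "1 / m \<le> \<phi> S'" using k m by (auto simp: \<phi>_def at_least_def intro!: divide_left_mono)
  qed (use m in \<open>auto simp: \<phi>_def\<close>)
  also have "\<dots> \<le> r ^ t * 1 / (1 / m)"
  proof (intro divide_right_mono mult_left_mono)
    show "\<phi> S \<le> 1" using S k by (auto simp: \<phi>_def at_least_def divide_le_eq_1)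
  qed (use m r0 in auto)
  finally show ?thesis by (simp add: r_def)
qed

text \<open>The mirror image of the growth phase: the uninformed count, cut off below
  \<open>c\<close>, serves as potential, and linearity of expectation alone gives the drift.\<close>

lemma decay_phase:
  assumes C: "C \<subseteq> Pow {..<n}" "\<And>S. S \<in> C \<Longrightarrow> set_pmf (step S) \<subseteq> C" and r: "0 \<le> r" and c: "0 < c"
    and decay: "\<And>S. S \<in> C \<Longrightarrow> c \<le> real (card (uninf S)) \<Longrightarrow> (\<Sum>u\<in>uninf S. miss S u) \<le> r * real (card (uninf S))"
    and S: "S \<in> C"
  shows "measure_pmf.prob (evolve step t S) {S'. c \<le> real (card (uninf S'))} \<le> r ^ t * n / c"
proof -
  define \<phi> where "\<phi> = (\<lambda>S'. if c \<le> real (card (uninf S')) then real (card (uninf S')) else 0)"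
  have drift: "measure_pmf.expectation (step T) \<phi> \<le> r * \<phi> T" if T: "T \<in> C" for T
  proof -
    have Tn: "T \<subseteq> {..<n}" using T C by auto
    note int = integrable_measure_pmf_finite[OF finite_set_round_step[OF Tn]]
    show ?thesis
    proof (cases "c \<le> real (card (uninf T))")
      case False
      have "\<phi> S' = 0" if "S' \<in> set_pmf (step T)" for S'
        using False card_mono[of "uninf T" "uninf S'"] set_round_step[OF Tn that] by (force simp: \<phi>_def)
      then have "measure_pmf.expectation (step T) \<phi> = measure_pmf.expectation (step T) (\<lambda>_. 0)"
        by (intro integral_cong_AE) (simp_all add: AE_measure_pmf_iff)
      then show ?thesis using False by (simp add: \<phi>_def)
    next
      case True
      have "measure_pmf.expectation (step T) \<phi> \<le> measure_pmf.expectation (step T) (\<lambda>S'. real (card (uninf S')))"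
        by (intro integral_mono_AE int) (simp add: \<phi>_def)
      then show ?thesis using decay[OF T True] expectation_uninformed(1)[OF Tn] True by (simp add: \<phi>_def)
    qed
  qed
  have "measure_pmf.prob (evolve step t S) {S'. c \<le> real (card (uninf S'))} \<le> r ^ t * \<phi> S / c"
    by (rule chain.prob_drift[OF C r drift S]) (use c in \<open>auto simp: \<phi>_def\<close>)
  also have "\<dots> \<le> r ^ t * n / c"
  proof (intro divide_right_mono mult_left_mono)
    have "card (uninf S) \<le> n" using card_mono[of "{..<n}" "uninf S"] by simp
    then show "\<phi> S \<le> real n" by (simp add: \<phi>_def)
  qed (use r c in auto)
  finally show ?thesis .
qed

lemma slow_growth:
  assumes v: "v < n" and m: "0 < m"
  shows "measure_pmf.prob (evolve step t {v}) {S. m \<le> real (card S)} \<le> (1 + rate * (D / d)) ^ t / m"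
proof -
  have r: "0 \<le> 1 + rate * (D / d)" using rate_bounds D_pos d_pos by simp
  have "measure_pmf.expectation (step T) (\<lambda>S. real (card S)) \<le> (1 + rate * (D / d)) * real (card T)" if "T \<in> Pow {..<n}" for T
    using that expectation_informed[of T] growth_le[of T] by (simp add: algebra_simps)
  then have "measure_pmf.prob (evolve step t {v}) {S. m \<le> real (card S)} \<le> (1 + rate * (D / d)) ^ t * real (card {v}) / m"
    using v m chain.closed by (intro chain.prob_drift[where C = "Pow {..<n}"] r) auto
  then show ?thesis by simp
qed

text \<open>The potential is \<open>1 / L\<close> exactly when everybody is informed and is small
  while many are uninformed. The shift \<open>L\<close> keeps it finite, and a large
  \<open>L\<close> makes its growth factor close to the inverse survival probability.\<close>

lemma slow_completion:
  assumes S: "S \<subseteq> {..<n}" "S \<noteq> {..<n}" and L: "0 < L" and q: "pulls P * q < 1"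
  shows "measure_pmf.prob (evolve step t S) {{..<n}} \<le> ((1 + 1 / L) / survive (D / (d - 1))) ^ t * L / card (uninf S)"
proof -
  define p where "p = survive (D / (d - 1))"
  have "0 \<le> pushes P * q * (D / (d - 1))"
    by (rule mult_nonneg_nonneg[OF pulls_q(3)]) (use D_pos d in auto)
  then have "exp (- (pushes P * q * (D / (d - 1)))) \<le> 1" by (simp only: exp_le_one_iff neg_le_0_iff_le)
  moreover have "1 - pulls P * q \<le> 1" "0 < 1 - pulls P * q" using pulls_q(1) q by auto
  ultimately have p: "0 < p" "p \<le> 1" unfolding p_def survival_def
    by (intro mult_pos_pos exp_gt_zero mult_le_one; linarith)+
  define r where "r = (1 + 1 / L) / p"
  have r: "0 \<le> r" using L p by (simp add: r_def)
  have drift: "measure_pmf.expectation (step T) (\<lambda>S'. 1 / (L + real (card (uninf S')))) \<le> r * (1 / (L + real (card (uninf T))))"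
    if T: "T \<in> Pow {..<n}" for T
  proof -
    have Tn: "T \<subseteq> {..<n}" using T by auto
    have "(\<Sum>u\<in>uninf T. p) \<le> (\<Sum>u\<in>uninf T. miss T u)"
      unfolding p_def by (intro sum_mono miss_ge_survive Tn)
    \<comment> \<open>Lowering the shift from \<open>L\<close> to \<open>p * L\<close> allows the
      factor \<open>p\<close> to be pulled out of the whole denominator.\<close>
    moreover have "p * L \<le> L" using p L by simp
    ultimately have "p * (L + real (card (uninf T))) \<le> L + (\<Sum>u\<in>uninf T. miss T u)" by (simp add: algebra_simps)
    moreover have "0 < p * (L + real (card (uninf T)))" using p L by (simp add: add_pos_nonneg)
    ultimately have "(1 + 1 / L) / (L + (\<Sum>u\<in>uninf T. miss T u)) \<le> (1 + 1 / L) / (p * (L + real (card (uninf T))))"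
      using L by (intro divide_left_mono mult_pos_pos[of "L + _"]) auto
    then show ?thesis using expectation_inverse_uninformed[OF Tn L] by (simp add: r_def)
  qed
  have "measure_pmf.prob (evolve step t S) {{..<n}} \<le> r ^ t * (1 / (L + real (card (uninf S)))) / (1 / L)"
    by (rule chain.prob_drift[where C = "Pow {..<n}", OF _ _ r drift]) (use L S chain.closed in auto)
  also have "\<dots> \<le> r ^ t * (1 / real (card (uninf S))) / (1 / L)"
  proof (intro divide_right_mono mult_left_mono divide_left_mono mult_pos_pos)
    have "uninf S \<noteq> {}" using S by auto
    then have "0 < card (uninf S)" by (simp add: card_gt_0_iff)
    then show "0 < real (card (uninf S))" "0 < L + real (card (uninf S))" using L by auto
  qed (use r L in auto)
  finally show ?thesis by (simp add: r_def p_def)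
qed

end

section \<open>Completion time on a single graph\<close>

context gossip_expander
begin

lemma full_absorbing: "evolve step t {..<n} = return_pmf {..<n}"
proof (induction t)
  case (Suc t)
  have "set_pmf (step {..<n}) \<subseteq> {{..<n}}" using set_round_step[of "{..<n}"] by blast
  then have "step {..<n} = return_pmf {..<n}" by (simp add: set_pmf_subset_singleton)
  with Suc show ?case by (simp add: bind_return_pmf)
qed simp

lemma prob_full_mono:
  assumes v: "v < n" and "s \<le> t"
  shows "measure_pmf.prob (evolve step s {v}) {{..<n}} \<le> measure_pmf.prob (evolve step t {v}) {{..<n}}"
proof -
  have "measure_pmf.prob (evolve step (s + (t - s)) {v}) (- {{..<n}}) \<le> measure_pmf.prob (evolve step s {v}) (- {{..<n}}) + 0"
    by (rule chain.prob_compose[where C = "Pow {..<n}" and B = "{{..<n}}"])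
       (use v chain.closed in \<open>auto simp: full_absorbing\<close>)
  then show ?thesis using assms by (simp add: measure_pmf.prob_compl[unfolded space_measure_pmf, simplified Compl_eq_Diff_UNIV[symmetric]])
qed

text \<open>Four phases, one error term each: \<open>t0\<close> rounds to exceed size
  \<open>k\<close>, \<open>t1\<close> rounds to exceed \<open>\<theta> * n\<close>,
  \<open>t2\<close> rounds until fewer than \<open>\<theta>' * n\<close> are uninformed,
  \<open>t3\<close> rounds to finish. The first and third error terms carry no factor
  \<open>n\<close>, so any positive multiple of log n suffices for \<open>t0\<close> and
  \<open>t2\<close>.\<close>

lemma completion_upper:
  fixes b \<theta> \<theta>' h r :: real and k :: nat
  assumes v: "v < n" and b: "0 < b" and k: "1 \<le> k" and \<theta>: "0 < \<theta>" "real k \<le> \<theta> * n" and \<theta>': "0 < \<theta>'"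
    and H1: "b \<le> rate * (d / D - sqrt (\<theta> + \<eta>)) - 4 * (\<theta> + \<eta>)"
    and H2: "h \<le> d / D - sqrt (1 - \<theta>' + \<eta>)" "0 < h" "h * \<theta> \<le> 1" "\<theta>' \<le> 1"
    and H3: "survive (d / D) + 3 * (D / d) * sqrt (\<theta>' + \<eta>) \<le> r" "0 \<le> r"
  shows "measure_pmf.prob (evolve step (t0 + (t1 + (t2 + t3))) {v}) (- {{..<n}}) \<le>
     (1 / (1 + b) + b / (1 + b)\<^sup>2) ^ t0 * k +
     ((1 / (1 + b) + b / (k * (1 + b)\<^sup>2)) ^ t1 * (\<theta> * n) +
     ((1 - (1 - exp (- rate)) * h * \<theta>) ^ t2 / \<theta>' + r ^ t3 * n))"
proof -
  have nz: "real n > 0" using n1 by simp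
  have small: "b * real (card S) \<le> (\<Sum>u\<in>uninf S. 1 - miss S u)" if "S \<subseteq> {..<n}" "real (card S) \<le> \<theta> * n" for S
  proof -
    have "(fluct S)\<^sup>2 \<le> \<theta> + \<eta>" using that nz eta by (simp add: fluct_def divide_le_eq)
    moreover have "fluct S \<le> sqrt (\<theta> + \<eta>)" using that nz eta unfolding fluct_def by (simp add: divide_le_eq)
    ultimately have "rate * (d / D - sqrt (\<theta> + \<eta>)) - 4 * (\<theta> + \<eta>) \<le> rate * (d / D - fluct S) - 4 * (fluct S)\<^sup>2"
      using rate_bounds by (intro diff_mono mult_left_mono) auto
    then have "b \<le> rate * (d / D - fluct S) - 4 * (fluct S)\<^sup>2" by (rule order_trans[OF H1])
    then have "b * real (card S) \<le> (rate * (d / D - fluct S) - 4 * (fluct S)\<^sup>2) * real (card S)"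
      by (intro mult_right_mono) auto
    then show ?thesis using growth_ge[OF that(1)] by linarith
  qed
  define c where "c = (1 - exp (- rate)) * h * \<theta>"
  have ex: "0 < 1 - exp (- rate)" "1 - exp (- rate) \<le> 1" using rate_bounds by auto
  have c0: "0 \<le> c" "c \<le> 1" using ex H2 \<theta> by (auto simp: c_def mult.assoc intro!: mult_le_one)
  have phase3: "measure_pmf.prob (evolve step t3 S) (- {{..<n}}) \<le> r ^ t3 * n"
    if S: "S \<subseteq> {..<n}" "real (card (uninf S)) < \<theta>' * n" for S
  proof -
    define C where "C = {S. S \<subseteq> {..<n} \<and> real (card (uninf S)) < \<theta>' * n}"
    have Cc: "set_pmf (step T) \<subseteq> C" if "T \<in> C" for T
    proof
      fix S' assume S': "S' \<in> set_pmf (step T)"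
      have T: "T \<subseteq> {..<n}" "real (card (uninf T)) < \<theta>' * n" using that by (auto simp: C_def)
      have "card (uninf S') \<le> card (uninf T)"
        using set_round_step(1)[OF T(1) S'] by (intro card_mono) auto
      then have "real (card (uninf S')) \<le> real (card (uninf T))" by simp
      then show "S' \<in> C" using set_round_step(2)[OF T(1) S'] T(2) by (simp add: C_def)
    qed
    \<comment> \<open>Threshold 1 for an integer count: Markov's inequality then bounds the
      probability that anybody is left.\<close>
    have "measure_pmf.prob (evolve step t3 S) {S'. 1 \<le> real (card (uninf S'))} \<le> r ^ t3 * n / 1"
    proof (rule decay_phase[where C = C])
      fix T assume "T \<in> C"
      then have T: "T \<subseteq> {..<n}" "real (card (uninf T)) < \<theta>' * n" by (auto simp: C_def)
      have "fluct (uninf T) \<le> sqrt (\<theta>' + \<eta>)" using T(2) nz by (simp add: fluct_def divide_le_eq)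
      then have "3 * (D / d) * fluct (uninf T) \<le> 3 * (D / d) * sqrt (\<theta>' + \<eta>)"
        using D_pos d_pos by (intro mult_left_mono) auto
      then have "(survive (d / D) + 3 * (D / d) * fluct (uninf T)) * real (card (uninf T)) \<le> r * real (card (uninf T))"
        using H3 by (intro mult_right_mono) auto
      then show "(\<Sum>u\<in>uninf T. miss T u) \<le> r * real (card (uninf T))"
        using sum_miss_le[OF T(1)] by linarith
    qed (use Cc S H3 in \<open>auto simp: C_def\<close>)
    moreover have "measure_pmf.prob (evolve step t3 S) (- {{..<n}}) \<le> measure_pmf.prob (evolve step t3 S) {S'. 1 \<le> real (card (uninf S'))}"
    proof (rule measure_pmf.finite_measure_mono_AE)
      show "AE S' in measure_pmf (evolve step t3 S). S' \<in> - {{..<n}} \<longrightarrow> S' \<in> {S'. 1 \<le> real (card (uninf S'))}"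
      proof (simp add: AE_measure_pmf_iff, intro ballI impI)
        fix S' assume S': "S' \<in> set_pmf (evolve step t3 S)" "S' \<noteq> {..<n}"
        then have "S' \<subseteq> {..<n}" using chain.set_evolve_X[of S t3] S by auto
        then have "uninf S' \<noteq> {}" using S' by auto
        then show "Suc 0 \<le> card (uninf S')" by (simp add: Suc_le_eq card_gt_0_iff)
      qed
    qed auto
    ultimately show ?thesis by simp
  qed
  have phase2: "measure_pmf.prob (evolve step (t2 + t3) S) (- {{..<n}}) \<le> (1 - c) ^ t2 / \<theta>' + r ^ t3 * n"
    if S: "S \<subseteq> {..<n}" "\<theta> * n < real (card S)" for S
  proof (rule chain.prob_compose[where C = "at_least (nat \<lceil>\<theta> * n\<rceil>)" and B = "{S. real (card (uninf S)) < \<theta>' * n}", OF _ at_least_closed])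
    show SC: "S \<in> at_least (nat \<lceil>\<theta> * n\<rceil>)" using S by (simp add: at_least_def nat_le_iff ceiling_le_iff)
    have "measure_pmf.prob (evolve step t2 S) {S'. \<theta>' * n \<le> real (card (uninf S'))} \<le> (1 - c) ^ t2 * n / (\<theta>' * n)"
    proof (rule decay_phase[OF at_least_closed _ _ _ SC])
      fix T assume T: "T \<in> at_least (nat \<lceil>\<theta> * n\<rceil>)" "\<theta>' * n \<le> real (card (uninf T))"
      have Tn: "T \<subseteq> {..<n}" and cT: "\<theta> * n \<le> real (card T)"
        using T by (auto simp: at_least_def nat_le_iff ceiling_le_iff)
      have "real (card T) \<le> (1 - \<theta>') * n" using card_uninf[OF Tn] T(2) by (simp add: left_diff_distrib)
      then have "real (card T) / n \<le> 1 - \<theta>'" using nz by (simp add: pos_divide_le_eq)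
      then have "fluct T \<le> sqrt (1 - \<theta>' + \<eta>)" by (simp add: fluct_def)
      then have "h \<le> d / D - fluct T" using H2 by linarith
      then have "(1 - exp (- rate)) * h * (\<theta> * n) \<le> (1 - exp (- rate)) * (d / D - fluct T) * real (card T)"
        using ex cT H2 \<theta> by (intro mult_mono) auto
      also have "\<dots> \<le> (\<Sum>u\<in>uninf T. 1 - miss T u)" by (rule growth_ge_chord[OF Tn])
      also have "\<dots> = real (card (uninf T)) - (\<Sum>u\<in>uninf T. miss T u)" by (simp add: sum_subtractf)
      \<comment> \<open>In the middle range a round informs at least \<open>c * n\<close> vertices
        on average, in particular a share \<open>c\<close> of the uninformed ones.\<close>
      finally have "(\<Sum>u\<in>uninf T. miss T u) \<le> real (card (uninf T)) - c * n" by (simp add: c_def mult_ac)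
      also have "c * real (card (uninf T)) \<le> c * n"
        using c0 card_uninf[OF Tn] by (intro mult_left_mono) auto
      then have "real (card (uninf T)) - c * n \<le> (1 - c) * real (card (uninf T))" by (simp add: algebra_simps)
      finally show "(\<Sum>u\<in>uninf T. miss T u) \<le> (1 - c) * real (card (uninf T))" .
    qed (use c0 \<theta>' nz in auto)
    then show "measure_pmf.prob (evolve step t2 S) (- {S. real (card (uninf S)) < \<theta>' * n}) \<le> (1 - c) ^ t2 / \<theta>'"
      using nz by (simp add: Collect_neg_eq[symmetric] not_less)
  next
    fix T assume "T \<in> at_least (nat \<lceil>\<theta> * n\<rceil>)" "T \<in> {S. real (card (uninf S)) < \<theta>' * n}"
    then show "measure_pmf.prob (evolve step t3 T) (- {{..<n}}) \<le> r ^ t3 * n"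
      by (intro phase3) (auto simp: at_least_def)
  qed (use H3 in auto)
  define p2 where "p2 = (1 - c) ^ t2 / \<theta>' + r ^ t3 * n"
  have p2: "0 \<le> p2" using c0 H3 \<theta>' by (simp add: p2_def)
  define p1 where "p1 = (1 / (1 + b) + b / (k * (1 + b)\<^sup>2)) ^ t1 * (\<theta> * n) + p2"
  have p1: "0 \<le> p1" using p2 b k \<theta> by (simp add: p1_def)
  have phase1: "measure_pmf.prob (evolve step (t1 + (t2 + t3)) S) (- {{..<n}}) \<le> p1"
    if SC: "S \<in> at_least k" for S
    unfolding p1_def
  proof (rule chain.prob_compose[where C = "at_least k" and B = "{S. \<theta> * n < real (card S)}", OF SC at_least_closed _ _ p2])
    have "measure_pmf.prob (evolve step t1 S) {S'. real (card S') \<le> \<theta> * n} \<le> (1 / (1 + b) + b / (k * (1 + b)\<^sup>2)) ^ t1 * (\<theta> * n)"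
      by (rule growth_phase[OF k b _ small SC]) (use \<theta> nz in \<open>auto simp: at_least_def\<close>)
    then show "measure_pmf.prob (evolve step t1 S) (- {S. \<theta> * n < real (card S)}) \<le> (1 / (1 + b) + b / (k * (1 + b)\<^sup>2)) ^ t1 * (\<theta> * n)"
      by (simp add: Collect_neg_eq[symmetric] not_less)
  next
    fix T assume "T \<in> at_least k" "T \<in> {S. \<theta> * n < real (card S)}"
    then show "measure_pmf.prob (evolve step (t2 + t3) T) (- {{..<n}}) \<le> p2"
      unfolding p2_def by (intro phase2) (auto simp: at_least_def)
  qed
  have "measure_pmf.prob (evolve step (t0 + (t1 + (t2 + t3))) {v}) (- {{..<n}}) \<le> (1 / (1 + b) + b / (1 + b)\<^sup>2) ^ t0 * k + p1"
  proof (rule chain.prob_compose[where C = "at_least 1" and B = "{S. real k < real (card S)}", OF _ at_least_closed _ _ p1])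
    show SC: "{v} \<in> at_least 1" using v by (simp add: at_least_def)
    have "measure_pmf.prob (evolve step t0 {v}) {S'. real (card S') \<le> real k} \<le> (1 / (1 + b) + b / (real 1 * (1 + b)\<^sup>2)) ^ t0 * real k"
      by (rule growth_phase[OF _ b _ small SC]) (use k \<theta> in \<open>auto simp: at_least_def\<close>)
    then show "measure_pmf.prob (evolve step t0 {v}) (- {S. real k < real (card S)}) \<le> (1 / (1 + b) + b / (1 + b)\<^sup>2) ^ t0 * k"
      by (simp add: Collect_neg_eq[symmetric] not_less)
  next
    fix T assume "T \<in> at_least 1" "T \<in> {S. real k < real (card S)}"
    then show "measure_pmf.prob (evolve step (t1 + (t2 + t3)) T) (- {{..<n}}) \<le> p1"
      by (intro phase1) (auto simp: at_least_def)
  qed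
  then show ?thesis by (simp add: p1_def p2_def c_def)
qed

text \<open>Either half of the vertices are informed within \<open>t1\<close> rounds, or at least
  half are still missing and all of them must be informed within \<open>t2\<close> rounds.\<close>

lemma completion_lower:
  assumes v: "v < n" and L: "0 < L" and q': "pulls P * q < 1"
  shows "measure_pmf.prob (evolve step (t1 + t2) {v}) {{..<n}} \<le>
    (1 + rate * (D / d)) ^ t1 / (n / 2) + ((1 + 1 / L) / survive (D / (d - 1))) ^ t2 * L / (n / 2)"
proof (rule chain.prob_compose[where C = "Pow {..<n}" and B = "{S. real (card S) < n / 2}"])
  have nz: "real n > 0" using n1 by simp
  have "measure_pmf.prob (evolve step t1 {v}) {S. n / 2 \<le> real (card S)} \<le> (1 + rate * (D / d)) ^ t1 / (n / 2)"
    by (rule slow_growth[OF v]) (use nz in simp)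
  then show "measure_pmf.prob (evolve step t1 {v}) (- {S. real (card S) < n / 2}) \<le> (1 + rate * (D / d)) ^ t1 / (n / 2)"
    by (simp add: Collect_neg_eq[symmetric] not_less)
  have s: "0 < survive (D / (d - 1))" using q' by (simp add: survival_def)
  show "0 \<le> ((1 + 1 / L) / survive (D / (d - 1))) ^ t2 * L / (n / 2)" using s L by simp
  fix S assume S: "S \<in> Pow {..<n}" "S \<in> {S. real (card S) < n / 2}"
  then have Sn: "S \<subseteq> {..<n}" and Sc: "real (card S) < n / 2" by auto
  have "S \<noteq> {..<n}" using Sc by auto
  then have "measure_pmf.prob (evolve step t2 S) {{..<n}} \<le> ((1 + 1 / L) / survive (D / (d - 1))) ^ t2 * L / card (uninf S)"
    by (rule slow_completion[OF Sn _ L q'])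
  also have "\<dots> \<le> ((1 + 1 / L) / survive (D / (d - 1))) ^ t2 * L / (n / 2)"
    using card_uninf[OF Sn] Sc nz s L by (intro divide_left_mono mult_pos_pos) auto
  finally show "measure_pmf.prob (evolve step t2 S) {{..<n}} \<le> ((1 + 1 / L) / survive (D / (d - 1))) ^ t2 * L / (n / 2)" .
qed (use v chain.closed in auto)

text \<open>Covers certain pulling, where the survival bound degenerates to 0 and only the growth of
  the informed set limits the speed.\<close>

lemma completion_lower':
  assumes v: "v < n"
  shows "measure_pmf.prob (evolve step t {v}) {{..<n}} \<le> (1 + rate * (D / d)) ^ t / n"
proof -
  have "measure_pmf.prob (evolve step t {v}) {{..<n}} \<le> measure_pmf.prob (evolve step t {v}) {S. real n \<le> real (card S)}"
    by (intro measure_pmf.finite_measure_mono) auto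
  also have "\<dots> \<le> (1 + rate * (D / d)) ^ t / n" by (rule slow_growth[OF v]) (use n1 in simp)
  finally show ?thesis .
qed

end

subsection \<open>Constants and asymptotics\<close>

definition growth_const :: "protocol \<Rightarrow> real \<Rightarrow> real" where
  "growth_const P q = 1 / ln (1 + growth_rate P q)"

text \<open>The value 0 for certain pulling is the limit of \<open>- 1 / ln s\<close> as
  \<open>s\<close> tends to 0 from above.\<close>

definition finish_const :: "protocol \<Rightarrow> real \<Rightarrow> real" where
  "finish_const P q = (if pulls P * q = 1 then 0 else - 1 / ln (survival P q 1))"

text \<open>At \<open>q = 1\<close> the constant is a left limit. There \<open>ln (1 - q)\<close>
  tends to minus infinity, so the second summand vanishes for pull and push-pull, in agreement with
  \<open>finish_const\<close>.\<close>

lemma c_const_eq: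
  assumes "0 < q" "q \<le> 1"
  shows "c_const P q = growth_const P q + finish_const P q"
proof (cases "q < 1")
  case True
  have ln: "ln (exp (- q) * (1 - q)) = - q + ln (1 - q)" using True by (simp add: ln_mult)
  have "- (1 / (ln (1 - q) - q)) = 1 / (q - ln (1 - q))"
    by (metis minus_diff_eq minus_divide_right)
  then show ?thesis using True ln assms
    by (cases P) (simp_all add: c_const_def growth_const_def finish_const_def growth_rate_def survival_def
        pushes_pulls_cases c_push0_def c_pull0_def c_pp0_def)
next
  case False
  then have q: "q = 1" using assms by simp
  have "((\<lambda>q::real. 1 / ln (1 + q) + 1 / q) \<longlongrightarrow> inverse (ln 2) + 1) (at_left 1)" by real_asymp
  then have 1: "Lim (at_left 1) c_push0 = inverse (ln 2) + 1"
    unfolding c_push0_def[abs_def] by (intro tendsto_Lim) auto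
  have "((\<lambda>q::real. 1 / ln (1 + q) - 1 / ln (1 - q)) \<longlongrightarrow> inverse (ln 2)) (at_left 1)" by real_asymp
  then have 2: "Lim (at_left 1) c_pull0 = inverse (ln 2)"
    unfolding c_pull0_def[abs_def] by (intro tendsto_Lim) auto
  have "((\<lambda>q::real. 1 / ln (1 + 2 * q) + 1 / (q - ln (1 - q))) \<longlongrightarrow> inverse (ln 3)) (at_left 1)" by real_asymp
  then have 3: "Lim (at_left 1) c_pp0 = inverse (ln 3)"
    unfolding c_pp0_def[abs_def] by (intro tendsto_Lim) auto
  show ?thesis unfolding q using 1 2 3
    by (cases P) (simp_all add: c_const_def growth_const_def finish_const_def growth_rate_def survival_def pushes_pulls_cases inverse_eq_divide)
qed

text \<open>With at least \<open>a * ln n\<close> rounds the power is at most n to the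
  \<open>a * ln r\<close>. The exponent \<open>\<kappa>\<close> is 1 for error terms with a factor
  \<open>n\<close> and 0 for the others.\<close>

lemma power_powr_tendsto_0:
  fixes r a \<kappa> :: real and t :: "nat \<Rightarrow> nat"
  assumes r: "0 < r" "r < 1" and neg: "a * ln r + \<kappa> < 0"
    and t: "\<forall>\<^sub>F n in sequentially. a * ln (real n) \<le> real (t n)"
  shows "(\<lambda>n. r ^ t n * real n powr \<kappa>) \<longlonglongrightarrow> 0"
proof (rule tendsto_sandwich[OF _ _ tendsto_const])
  show "(\<lambda>n. real n powr (a * ln r + \<kappa>)) \<longlonglongrightarrow> 0"
    by (rule tendsto_neg_powr[OF neg filterlim_real_sequentially])
  show "\<forall>\<^sub>F n in sequentially. 0 \<le> r ^ t n * real n powr \<kappa>" using r by simp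
  show "\<forall>\<^sub>F n in sequentially. r ^ t n * real n powr \<kappa> \<le> real n powr (a * ln r + \<kappa>)"
    using t eventually_gt_at_top[of 0]
  proof eventually_elim
    case (elim n)
    have "r ^ t n = exp (real (t n) * ln r)" using r by (simp add: exp_of_nat_mult)
    also have "\<dots> \<le> exp (a * ln (real n) * ln r)"
      using elim r by (simp add: mult_right_mono_neg)
    also have "\<dots> = real n powr (a * ln r)" using elim by (simp add: powr_def mult_ac)
    finally have "r ^ t n * real n powr \<kappa> \<le> real n powr (a * ln r) * real n powr \<kappa>"
      by (intro mult_right_mono) auto
    then show ?case by (simp add: powr_add)
  qed
qed

text \<open>The counterpart for lower bounds; \<open>C\<close> absorbs the rounding of the number of
  rounds.\<close>

lemma power_over_tendsto_0:
  fixes y a C :: real and t :: "nat \<Rightarrow> nat"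
  assumes y: "1 \<le> y" and lt: "a * ln y < 1"
    and t: "\<forall>\<^sub>F n in sequentially. real (t n) \<le> a * ln (real n) + C"
  shows "(\<lambda>n. y ^ t n / real n) \<longlonglongrightarrow> 0"
proof (rule tendsto_sandwich[OF _ _ tendsto_const])
  have "(\<lambda>n. real n powr (a * ln y - 1)) \<longlonglongrightarrow> 0"
    using lt by (intro tendsto_neg_powr[OF _ filterlim_real_sequentially]) simp
  then show "(\<lambda>n. exp (C * ln y) * real n powr (a * ln y - 1)) \<longlonglongrightarrow> 0"
    by (rule tendsto_mult_right_zero)
  show "\<forall>\<^sub>F n in sequentially. 0 \<le> y ^ t n / real n" using y by simp
  show "\<forall>\<^sub>F n in sequentially. y ^ t n / real n \<le> exp (C * ln y) * real n powr (a * ln y - 1)"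
    using t eventually_gt_at_top[of 0]
  proof eventually_elim
    case (elim n)
    have "y ^ t n = exp (real (t n) * ln y)" using y by (simp add: exp_of_nat_mult)
    also have "\<dots> \<le> exp ((a * ln (real n) + C) * ln y)"
      using elim y by (simp add: mult_right_mono)
    also have "\<dots> = exp (C * ln y) * real n powr (a * ln y)"
      using elim by (simp add: powr_def algebra_simps exp_add)
    finally have "y ^ t n / real n \<le> exp (C * ln y) * real n powr (a * ln y) / real n"
      using elim by (intro divide_right_mono) auto
    then show ?case using elim by (simp add: powr_diff)
  qed
qed

section \<open>Choice of the parameters of the phases\<close>

text \<open>The order of choice matters: \<open>b\<close> below \<open>\<gamma>\<close> but close
  enough to leave slack, then \<open>k\<close> so large that the correction to
  \<open>1 / (1 + b)\<close> fits into the slack, then \<open>\<theta>\<close> so small that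
  \<open>growth_ge\<close> still provides \<open>b\<close>.\<close>

lemma growth_parameters:
  fixes \<gamma> \<epsilon> :: real
  assumes \<gamma>: "0 < \<gamma>" and \<epsilon>: "0 < \<epsilon>"
  obtains b :: real and k :: nat and \<theta> :: real where "0 < b" "1 \<le> k" "0 < \<theta>" "\<theta> < 1"
    "1 / (1 + b) + b / (k * (1 + b)\<^sup>2) < 1" "(1 / ln (1 + \<gamma>) + \<epsilon>) * ln (1 / (1 + b) + b / (k * (1 + b)\<^sup>2)) + 1 < 0"
    "b < \<gamma> * (1 - sqrt \<theta>) - 4 * \<theta>"
proof -
  define A where "A = 1 / ln (1 + \<gamma>) + \<epsilon>"
  have "((\<lambda>b. A * ln (1 + b)) \<longlongrightarrow> A * ln (1 + \<gamma>)) (at_left \<gamma>)"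
    using \<gamma> by (intro tendsto_intros) auto
  moreover have "1 < A * ln (1 + \<gamma>)" using \<gamma> \<epsilon> by (simp add: A_def distrib_right)
  ultimately have "\<forall>\<^sub>F b in at_left \<gamma>. 1 < A * ln (1 + b)" by (rule order_tendstoD)
  then have "\<forall>\<^sub>F b in at_left \<gamma>. 1 < A * ln (1 + b) \<and> b \<in> {0<..<\<gamma>}"
    using eventually_at_left_real[OF \<gamma>] by eventually_elim auto
  then obtain b where b: "1 < A * ln (1 + b)" "0 < b" "b < \<gamma>"
    using eventually_happens'[of "at_left \<gamma>"] by auto
  have lim: "(\<lambda>k. 1 / (1 + b) + b / (real k * (1 + b)\<^sup>2)) \<longlonglongrightarrow> 1 / (1 + b)"
    using b by real_asymp
  have "\<forall>\<^sub>F k in sequentially. 1 / (1 + b) + b / (real k * (1 + b)\<^sup>2) < 1"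
    by (rule order_tendstoD(2)[OF lim]) (use b in simp)
  moreover have "(\<lambda>k. A * ln (1 / (1 + b) + b / (real k * (1 + b)\<^sup>2)) + 1) \<longlonglongrightarrow> A * ln (1 / (1 + b)) + 1"
    using b by (intro tendsto_intros lim) auto
  then have "\<forall>\<^sub>F k in sequentially. A * ln (1 / (1 + b) + b / (real k * (1 + b)\<^sup>2)) + 1 < 0"
    by (rule order_tendstoD(2)) (use b in \<open>simp add: ln_div\<close>)
  ultimately have "\<forall>\<^sub>F k in sequentially. 1 / (1 + b) + b / (real k * (1 + b)\<^sup>2) < 1 \<and>
      A * ln (1 / (1 + b) + b / (real k * (1 + b)\<^sup>2)) + 1 < 0 \<and> 1 \<le> k"
    using eventually_ge_at_top[of 1] by eventually_elim auto
  then obtain k :: nat where k: "1 / (1 + b) + b / (real k * (1 + b)\<^sup>2) < 1"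
      "A * ln (1 / (1 + b) + b / (real k * (1 + b)\<^sup>2)) + 1 < 0" "1 \<le> k"
    using eventually_happens'[of sequentially] by auto
  have "((\<lambda>x. \<gamma> * (1 - sqrt x) - 4 * x) \<longlongrightarrow> \<gamma> * (1 - sqrt 0) - 4 * 0) (at_right 0)"
    by (intro tendsto_intros)
  then have "\<forall>\<^sub>F x in at_right 0. b < \<gamma> * (1 - sqrt x) - 4 * x"
    by (rule order_tendstoD) (use b in simp)
  then have "\<forall>\<^sub>F x in at_right 0. b < \<gamma> * (1 - sqrt x) - 4 * x \<and> x \<in> {0<..<1}"
    using eventually_at_right_real[of 0 1, simplified] by eventually_elim auto
  then obtain \<theta> where "b < \<gamma> * (1 - sqrt \<theta>) - 4 * \<theta>" "0 < \<theta>" "\<theta> < 1"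
    using eventually_happens'[of "at_right (0::real)"] by auto
  with b k show ?thesis by (intro that[of b k \<theta>]) (auto simp: A_def)
qed

lemma finish_parameters:
  fixes s c \<epsilon> :: real
  assumes s: "0 \<le> s" "s < 1" and c: "0 \<le> c" "0 < s \<Longrightarrow> c = - 1 / ln s" and \<epsilon>: "0 < \<epsilon>"
  obtains r \<theta> where "s < r" "0 < r" "r < 1" "(c + \<epsilon>) * ln r + 1 < 0" "0 < \<theta>" "\<theta> < 1" "s + 3 * sqrt \<theta> < r"
proof -
  \<comment> \<open>The slack \<epsilon> makes this strict for positive \<open>s\<close>. For
    \<open>s = 0\<close> it is trivial, which is how certain pulling is included.\<close>
  have sl: "s < exp (- 1 / (c + \<epsilon>))"
  proof (cases "s = 0")
    case False
    then have s0: "0 < s" using s by simp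
    then have "ln s < 0" using s by simp
    then have "ln s < - 1 / (c + \<epsilon>)" using c(2)[OF s0] c(1) \<epsilon> by (simp add: field_simps mult_pos_neg)
    then show ?thesis using s0 by (metis exp_less_cancel_iff exp_ln)
  qed simp
  then obtain r where r: "s < r" "r < exp (- 1 / (c + \<epsilon>))" using dense by blast
  have r0: "0 < r" using r s by simp
  have lr: "ln r < - 1 / (c + \<epsilon>)" using r r0 by (metis exp_less_cancel_iff exp_ln)
  also have "\<dots> < 0" using c \<epsilon> by (simp add: divide_neg_pos)
  finally have r1: "r < 1" using r0 by simp
  have "((\<lambda>x. s + 3 * sqrt x) \<longlongrightarrow> s + 3 * sqrt 0) (at_right 0)" by (intro tendsto_intros)
  then have "\<forall>\<^sub>F x in at_right 0. s + 3 * sqrt x < r"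
    by (rule order_tendstoD) (use r in simp)
  then have "\<forall>\<^sub>F x in at_right 0. s + 3 * sqrt x < r \<and> x \<in> {0<..<1}"
    using eventually_at_right_real[of 0 1, simplified] by eventually_elim auto
  then obtain \<theta> where "s + 3 * sqrt \<theta> < r" "0 < \<theta>" "\<theta> < 1"
    using eventually_happens'[of "at_right (0::real)"] by auto
  moreover have "(c + \<epsilon>) * ln r + 1 < 0" using lr c \<epsilon> by (simp add: field_simps)
  ultimately show ?thesis using r r0 r1 by (intro that[of r \<theta>]) auto
qed

text \<open>Room above the ideal base \<open>x0\<close>, to be spent on degree irregularity and on
  the factor \<open>1 + 1 / L\<close>.\<close>

lemma slow_parameter:
  fixes x0 \<epsilon> :: real
  assumes "1 < x0" "0 < \<epsilon>"
  obtains x where "x0 < x" "(1 / ln x0 - \<epsilon>) * ln x < 1"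
proof -
  have "((\<lambda>x. (1 / ln x0 - \<epsilon>) * ln x) \<longlongrightarrow> (1 / ln x0 - \<epsilon>) * ln x0) (at_right x0)"
    using assms by (intro tendsto_intros) auto
  then have "\<forall>\<^sub>F x in at_right x0. (1 / ln x0 - \<epsilon>) * ln x < 1"
    by (rule order_tendstoD) (use assms in \<open>simp add: left_diff_distrib\<close>)
  then have "\<forall>\<^sub>F x in at_right x0. (1 / ln x0 - \<epsilon>) * ln x < 1 \<and> x \<in> {x0<..<x0 + 1}"
    using eventually_at_right_real[OF less_add_one[of x0]] by eventually_elim auto
  then obtain x where "(1 / ln x0 - \<epsilon>) * ln x < 1" "x0 < x"
    using eventually_happens'[of "at_right x0"] by auto
  then show ?thesis using that by blast
qed

lemma survival_bounds:
  assumes "0 < q" "q \<le> 1"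
  shows "0 \<le> survival P q 1" "survival P q 1 < 1" "pulls P * q < 1 \<Longrightarrow> 0 < survival P q 1"
    "pulls P * q = 1 \<Longrightarrow> survival P q 1 = 0"
proof -
  have "exp (- q) * (1 - q) \<le> 1 * (1 - q)" using assms by (intro mult_right_mono) auto
  then show "survival P q 1 < 1"
    using assms by (cases P) (simp_all add: survival_def pushes_pulls_cases)
  show "0 \<le> survival P q 1" "pulls P * q < 1 \<Longrightarrow> 0 < survival P q 1" "pulls P * q = 1 \<Longrightarrow> survival P q 1 = 0"
    using assms by (cases P; simp add: survival_def pushes_pulls_cases)+
qed

lemma pulls_q_cases: "0 < q \<Longrightarrow> q \<le> 1 \<Longrightarrow> pulls P * q < 1 \<or> pulls P * q = 1"
  by (cases P) (auto simp: pushes_pulls_cases)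

lemma nat_ceiling_le: "0 \<le> z \<Longrightarrow> real (nat \<lceil>z\<rceil>) \<le> z + 1" for z :: real
  using of_int_ceiling_le_add_one[of z] by simp

lemma growth_rate_pos: "0 < q \<Longrightarrow> 0 < growth_rate P q"
  by (cases P) (simp_all add: growth_rate_def pushes_pulls_cases)

lemma finish_const_nonneg:
  assumes "0 < q" "q \<le> 1"
  shows "0 \<le> finish_const P q"
proof (cases "pulls P * q = 1")
  case False
  then have "0 < survival P q 1" using survival_bounds(3)[OF assms] pulls_q_cases[OF assms] by blast
  then have "ln (survival P q 1) < 0" using survival_bounds(2)[OF assms] by simp
  then show ?thesis using False by (simp add: finish_const_def divide_nonpos_neg)
qed (simp add: finish_const_def)

section \<open>Limits along a sequence of graphs\<close>

locale gossip_seq =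
  fixes G :: "nat \<Rightarrow> nat \<Rightarrow> nat \<Rightarrow> bool" and q :: real and P :: protocol
    and d D \<eta> :: "nat \<Rightarrow> real" and v :: "nat \<Rightarrow> nat"
  assumes ev: "\<forall>\<^sub>F n in sequentially. gossip_expander n (G n) q (d n) (D n) (\<eta> n)"
    and v: "\<forall>\<^sub>F n in sequentially. v n < n"
    and eta0: "\<eta> \<longlonglongrightarrow> 0" and reg: "(\<lambda>n. d n / D n) \<longlonglongrightarrow> 1"
    and reg': "(\<lambda>n. D n / (d n - 1)) \<longlonglongrightarrow> 1" and q: "0 < q" "q \<le> 1"
begin

abbreviation law :: "nat \<Rightarrow> nat \<Rightarrow> nat set pmf" where
  "law n t \<equiv> evolve (round_step P n (G n) q) t {v n}"

lemma reg_inv: "(\<lambda>n. D n / d n) \<longlonglongrightarrow> 1"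
  using tendsto_inverse[OF reg] by (simp add: inverse_eq_divide)

lemma ln_at_top: "filterlim (\<lambda>n. ln (real n)) at_top sequentially"
  by real_asymp

lemma incomplete_tendsto_0:
  fixes t :: "nat \<Rightarrow> nat"
  assumes \<epsilon>: "0 < \<epsilon>"
    and t: "\<forall>\<^sub>F n in sequentially. (growth_const P q + finish_const P q + \<epsilon>) * ln (real n) - 1 \<le> real (t n)"
  shows "(\<lambda>n. measure_pmf.prob (law n (t n)) (- {{..<n}})) \<longlonglongrightarrow> 0"
proof -
  define \<gamma> where "\<gamma> = growth_rate P q"
  define s where "s = survival P q 1"
  define c1 where "c1 = growth_const P q"
  define c2 where "c2 = finish_const P q"
  \<comment> \<open>Four fifths go to the four phases; the last one pays for rounding.\<close>
  define e where "e = \<epsilon> / 5"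
  have e: "0 < e" using \<epsilon> by (simp add: e_def)
  have \<gamma>: "0 < \<gamma>" using growth_rate_pos q by (simp add: \<gamma>_def)
  have c1: "0 \<le> c1" using \<gamma> by (simp add: c1_def growth_const_def \<gamma>_def)
  have c2: "0 \<le> c2" using finish_const_nonneg q by (simp add: c2_def)
  obtain b k \<theta> where b: "0 < b" and k: "1 \<le> k" and \<theta>: "0 < \<theta>" "\<theta> < 1"
    and r1: "1 / (1 + b) + b / (real k * (1 + b)\<^sup>2) < 1" "(c1 + e) * ln (1 / (1 + b) + b / (real k * (1 + b)\<^sup>2)) + 1 < 0"
    and bg: "b < \<gamma> * (1 - sqrt \<theta>) - 4 * \<theta>"
    using growth_parameters[OF \<gamma> e] unfolding c1_def growth_const_def \<gamma>_def by metis
  have "0 < s \<Longrightarrow> c2 = - 1 / ln s"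
    using survival_bounds(4)[OF q, of P] by (auto simp: s_def c2_def finish_const_def)
  then obtain r \<theta>' where r: "s < r" "0 < r" "r < 1" "(c2 + e) * ln r + 1 < 0" and \<theta>': "0 < \<theta>'" "\<theta>' < 1" "s + 3 * sqrt \<theta>' < r"
    using finish_parameters[of s c2 e] survival_bounds(1,2)[OF q, of P] c2 e by (auto simp: s_def)
  \<comment> \<open>Half of the limiting gap, so that \<open>h\<close> stays below
    \<open>d n / D n - sqrt (1 - \<theta>' + \<eta> n)\<close> for large \<open>n\<close>.\<close>
  define h where "h = (1 - sqrt (1 - \<theta>')) / 2"
  obtain w where w: "w = sqrt (1 - \<theta>')" "w < 1" "0 \<le> w" using \<theta>' by auto
  then have h: "0 < h" "h < 1" "h < 1 - sqrt (1 - \<theta>')" unfolding h_def w(1)[symmetric] by simp_all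
  have hth: "h * \<theta> < 1" using h \<theta> mult_strict_mono[of h 1 \<theta> 1] by simp
  \<comment> \<open>The contraction factor for starting size 1. It equals
    \<open>(1 + 2 * b) / (1 + b)\<^sup>2\<close>, which is below 1 for every positive
    \<open>b\<close>.\<close>
  define r0 where "r0 = 1 / (1 + b) + b / (1 + b)\<^sup>2"
  have r0: "0 < r0" "r0 < 1"
  proof -
    show "0 < r0" using b by (simp add: r0_def add_pos_pos)
    have "r0 = (1 + 2 * b) / (1 + b)\<^sup>2" using b by (simp add: r0_def divide_simps power2_eq_square)
    moreover have "1 + 2 * b < (1 + b)\<^sup>2" "0 < (1 + b)\<^sup>2" using b by (simp add: power2_sum, simp)
    ultimately show "r0 < 1" by (simp only: divide_less_eq_1_pos)
  qed
  define r1' where "r1' = 1 / (1 + b) + b / (real k * (1 + b)\<^sup>2)"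
  have r10: "0 < r1'" using b k by (simp add: r1'_def add_pos_pos)
  define r2 where "r2 = 1 - (1 - exp (- \<gamma>)) * h * \<theta>"
  have "0 < (1 - exp (- \<gamma>)) * (h * \<theta>)" using \<gamma> h \<theta> by (intro mult_pos_pos) auto
  moreover have "(1 - exp (- \<gamma>)) * (h * \<theta>) \<le> 1 * (h * \<theta>)" using h \<theta> by (intro mult_right_mono) auto
  ultimately have r2: "0 < r2" "r2 < 1" using hth by (auto simp: r2_def mult.assoc)
  define t0 where "t0 = (\<lambda>n. nat \<lceil>e * ln (real n)\<rceil>)"
  define t1 where "t1 = (\<lambda>n. nat \<lceil>(c1 + e) * ln (real n)\<rceil>)"
  define t3 where "t3 = (\<lambda>n. t n - (t0 n + t1 n + t0 n))"
  \<comment> \<open>Three ceilings cost at most 3 rounds and the hypothesis on \<open>t\<close>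
    allows one more to be lost, hence 4.\<close>
  have big: "\<forall>\<^sub>F n in sequentially. 4 / e \<le> ln (real n)"
    using ln_at_top by (simp add: filterlim_at_top)
  have tt: "\<forall>\<^sub>F n in sequentially. t n = t0 n + (t1 n + (t0 n + t3 n)) \<and> (c2 + e) * ln (real n) \<le> real (t3 n)"
    using t big eventually_gt_at_top[of 0]
  proof eventually_elim
    case (elim n)
    define l where "l = ln (real n)"
    have l: "4 \<le> e * l" "0 \<le> l" using elim e by (auto simp: l_def field_simps)
    have 0: "real (t0 n) \<le> e * l + 1"
      unfolding t0_def l_def[symmetric] by (rule nat_ceiling_le) (use l in simp)
    have "0 \<le> (c1 + e) * l" using c1 e l by simp
    then have 1: "real (t1 n) \<le> (c1 + e) * l + 1"
      unfolding t1_def l_def[symmetric] by (rule nat_ceiling_le)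
    have T: "(c1 + c2 + 5 * e) * l - 1 \<le> real (t n)"
      using elim(1) by (simp add: c1_def c2_def e_def l_def)
    have sum: "real (t0 n + t1 n + t0 n) + (c2 + e) * l \<le> real (t n)"
      using 0 1 T l by (simp add: algebra_simps)
    moreover have "0 \<le> (c2 + e) * l" using c2 e l by simp
    ultimately have le: "t0 n + t1 n + t0 n \<le> t n" by linarith
    then have "real (t3 n) = real (t n) - real (t0 n + t1 n + t0 n)" by (simp add: t3_def of_nat_diff)
    then show ?case using le sum by (simp add: t3_def l_def)
  qed
  have ceil: "\<forall>\<^sub>F n in sequentially. x * ln (real n) \<le> real (nat \<lceil>x * ln (real n)\<rceil>)" for x
    by (simp add: real_nat_ceiling_ge)
  have p0: "(\<lambda>n. r0 ^ t0 n * real n powr 0) \<longlonglongrightarrow> 0"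
    unfolding t0_def by (rule power_powr_tendsto_0[OF r0 _ ceil]) (use e r0 in \<open>simp add: mult_pos_neg\<close>)
  have p1: "(\<lambda>n. r1' ^ t1 n * real n powr 1) \<longlonglongrightarrow> 0"
    unfolding t1_def by (rule power_powr_tendsto_0[OF r10 _ _ ceil]) (use r1 in \<open>simp_all add: r1'_def\<close>)
  have p2: "(\<lambda>n. r2 ^ t0 n * real n powr 0) \<longlonglongrightarrow> 0"
    unfolding t0_def by (rule power_powr_tendsto_0[OF r2 _ ceil]) (use e r2 in \<open>simp add: mult_pos_neg\<close>)
  have p3: "(\<lambda>n. r ^ t3 n * real n powr 1) \<longlonglongrightarrow> 0"
    by (rule power_powr_tendsto_0[OF r(2,3,4)]) (use tt in eventually_elim, simp)
  have lim: "(\<lambda>n. r0 ^ t0 n * real n powr 0 * real k + (r1' ^ t1 n * real n powr 1 * \<theta> +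
      (r2 ^ t0 n * real n powr 0 / \<theta>' + r ^ t3 n * real n powr 1))) \<longlonglongrightarrow> 0 * real k + (0 * \<theta> + (0 / \<theta>' + 0))"
    using \<theta>' by (intro tendsto_intros p0 p1 p2 p3) auto
  have H1: "\<forall>\<^sub>F n in sequentially. b < \<gamma> * (d n / D n - sqrt (\<theta> + \<eta> n)) - 4 * (\<theta> + \<eta> n)"
  proof (rule order_tendstoD(1))
    show "(\<lambda>n. \<gamma> * (d n / D n - sqrt (\<theta> + \<eta> n)) - 4 * (\<theta> + \<eta> n)) \<longlonglongrightarrow> \<gamma> * (1 - sqrt (\<theta> + 0)) - 4 * (\<theta> + 0)"
      by (intro tendsto_intros reg eta0)
  qed (use bg in simp)
  have H2: "\<forall>\<^sub>F n in sequentially. h < d n / D n - sqrt (1 - \<theta>' + \<eta> n)"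
  proof (rule order_tendstoD(1))
    show "(\<lambda>n. d n / D n - sqrt (1 - \<theta>' + \<eta> n)) \<longlonglongrightarrow> 1 - sqrt (1 - \<theta>' + 0)"
      by (intro tendsto_intros reg eta0)
  qed (use h in simp)
  have H3: "\<forall>\<^sub>F n in sequentially. survival P q (d n / D n) + 3 * (D n / d n) * sqrt (\<theta>' + \<eta> n) < r"
  proof (rule order_tendstoD(2))
    show "(\<lambda>n. survival P q (d n / D n) + 3 * (D n / d n) * sqrt (\<theta>' + \<eta> n)) \<longlonglongrightarrow> survival P q 1 + 3 * 1 * sqrt (\<theta>' + 0)"
      unfolding survival_def by (intro tendsto_intros reg reg_inv eta0)
  qed (use \<theta>' in \<open>simp add: s_def\<close>)
  have kn: "\<forall>\<^sub>F n in sequentially. real k / \<theta> \<le> real n"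
    using filterlim_real_sequentially by (simp add: filterlim_at_top)
  show ?thesis
  proof (rule tendsto_sandwich[OF _ _ tendsto_const])
    show "(\<lambda>n. r0 ^ t0 n * real n powr 0 * real k + (r1' ^ t1 n * real n powr 1 * \<theta> +
      (r2 ^ t0 n * real n powr 0 / \<theta>' + r ^ t3 n * real n powr 1))) \<longlonglongrightarrow> 0" using lim by simp
    show "\<forall>\<^sub>F n in sequentially. measure_pmf.prob (law n (t n)) (- {{..<n}}) \<le>
      r0 ^ t0 n * real n powr 0 * real k + (r1' ^ t1 n * real n powr 1 * \<theta> +
      (r2 ^ t0 n * real n powr 0 / \<theta>' + r ^ t3 n * real n powr 1))"
      using ev v tt H1 H2 H3 kn eventually_gt_at_top[of 0]
    proof eventually_elim
      case (elim n)
      interpret gossip_expander n "G n" q P "d n" "D n" "\<eta> n" by fact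
      have "measure_pmf.prob (evolve step (t0 n + (t1 n + (t0 n + t3 n))) {v n}) (- {{..<n}}) \<le>
         (1 / (1 + b) + b / (1 + b)\<^sup>2) ^ t0 n * real k +
         ((1 / (1 + b) + b / (real k * (1 + b)\<^sup>2)) ^ t1 n * (\<theta> * real n) +
         ((1 - (1 - exp (- growth_rate P q)) * h * \<theta>) ^ t0 n / \<theta>' + r ^ t3 n * real n))"
      proof (rule completion_upper)
        show "real k \<le> \<theta> * real n" using elim \<theta> by (simp add: field_simps)
      qed (use elim b k \<theta> \<theta>' h hth r in \<open>auto simp: \<gamma>_def\<close>)
      then show ?case using elim by (simp add: r0_def r1'_def r2_def \<gamma>_def mult_ac)
    qed
  qed simp
qed

lemma complete_tendsto_0:
  fixes t :: "nat \<Rightarrow> nat"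
  assumes \<epsilon>: "0 < \<epsilon>" "\<epsilon> < growth_const P q" "pulls P * q < 1 \<Longrightarrow> \<epsilon> < finish_const P q"
    and t: "\<forall>\<^sub>F n in sequentially. real (t n) \<le> (growth_const P q + finish_const P q - \<epsilon>) * ln (real n)"
  shows "(\<lambda>n. measure_pmf.prob (law n (t n)) {{..<n}}) \<longlonglongrightarrow> 0"
proof -
  define \<gamma> where "\<gamma> = growth_rate P q"
  define s where "s = survival P q 1"
  define c1 where "c1 = growth_const P q"
  define c2 where "c2 = finish_const P q"
  have \<gamma>: "0 < \<gamma>" using growth_rate_pos q by (simp add: \<gamma>_def)
  have c1: "c1 = 1 / ln (1 + \<gamma>)" by (simp add: c1_def growth_const_def \<gamma>_def)
  define e where "e = \<epsilon> / 2"
  have e: "0 < e" using \<epsilon> by (simp add: e_def)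
  obtain x where x: "1 + \<gamma> < x" "(c1 - e) * ln x < 1"
    using slow_parameter[of "1 + \<gamma>" e] \<gamma> e unfolding c1 by auto
  have x1: "1 \<le> x" using x \<gamma> by simp
  have xev: "\<forall>\<^sub>F n in sequentially. 1 + \<gamma> * (D n / d n) < x"
  proof (rule order_tendstoD(2))
    show "(\<lambda>n. 1 + \<gamma> * (D n / d n)) \<longlonglongrightarrow> 1 + \<gamma> * 1" by (intro tendsto_intros reg_inv)
  qed (use x in simp)
  consider "pulls P * q < 1" | "pulls P * q = 1"
    using pulls_q_cases[OF q] by blast
  then show ?thesis
  proof cases
    case 1
    have s: "0 < s" "s < 1" using survival_bounds[OF q, of P] 1 by (auto simp: s_def)
    have c2: "c2 = 1 / ln (1 / s)" using 1 s by (simp add: c2_def finish_const_def s_def ln_div)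
    obtain y where y: "1 / s < y" "(c2 - e) * ln y < 1"
      using slow_parameter[of "1 / s" e] s e unfolding c2 by auto
    have y1: "1 \<le> y" using y s by (smt (verit) less_divide_eq_1_pos)
    have "((\<lambda>L. (1 + 1 / L) / s) \<longlongrightarrow> (1 + 0) / s) at_top"
      using s by (intro tendsto_intros tendsto_divide_0[OF tendsto_const] filterlim_at_top_imp_at_infinity filterlim_ident) auto
    then have "\<forall>\<^sub>F L in at_top. (1 + 1 / L) / s < y"
      by (rule order_tendstoD(2)) (use y in simp)
    then have "\<forall>\<^sub>F L in at_top. (1 + 1 / L) / s < y \<and> 0 < L"
      using eventually_gt_at_top[of "0::real"] by eventually_elim auto
    then obtain L where L: "(1 + 1 / L) / s < y" "0 < (L::real)"
      using eventually_happens'[of "at_top :: real filter"] by auto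
    have yev: "\<forall>\<^sub>F n in sequentially. (1 + 1 / L) / survival P q (D n / (d n - 1)) < y"
    proof (rule order_tendstoD(2))
      have "(\<lambda>n. survival P q (D n / (d n - 1))) \<longlonglongrightarrow> survival P q 1"
        unfolding survival_def by (intro tendsto_intros reg')
      then show "(\<lambda>n. (1 + 1 / L) / survival P q (D n / (d n - 1))) \<longlonglongrightarrow> (1 + 1 / L) / survival P q 1"
        using s by (intro tendsto_intros) (auto simp: s_def)
    qed (use L in \<open>simp add: s_def\<close>)
    define t1 where "t1 = (\<lambda>n. nat \<lfloor>(c1 - e) * ln (real n)\<rfloor>)"
    \<comment> \<open>The additional round makes up for the floor in \<open>t1\<close>, so that
      together they cover \<open>t n\<close>.\<close>
    define t2 where "t2 = (\<lambda>n. nat \<lceil>(c2 - e) * ln (real n)\<rceil> + 1)"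
    have ce: "0 < c1 - e" "0 < c2 - e" using \<epsilon> 1 by (auto simp: c1_def c2_def e_def)
    have t1: "\<forall>\<^sub>F n in sequentially. real (t1 n) \<le> (c1 - e) * ln (real n) + 0"
      using eventually_gt_at_top[of 0]
    proof eventually_elim
      case (elim n)
      then have "0 \<le> (c1 - e) * ln (real n)" using ce by simp
      then show ?case by (simp add: t1_def)
    qed
    have t2: "\<forall>\<^sub>F n in sequentially. real (t2 n) \<le> (c2 - e) * ln (real n) + 2"
      using eventually_gt_at_top[of 0]
    proof eventually_elim
      case (elim n)
      then have "0 \<le> (c2 - e) * ln (real n)" using ce by simp
      from nat_ceiling_le[OF this] show ?case unfolding t2_def by linarith
    qed
    have tt: "\<forall>\<^sub>F n in sequentially. t n \<le> t1 n + t2 n"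
      using t
    proof eventually_elim
      case (elim n)
      have "(c1 - e) * ln (real n) - 1 \<le> real (t1 n)" unfolding t1_def by linarith
      moreover have "(c2 - e) * ln (real n) + 1 \<le> real (t2 n)" unfolding t2_def by (simp add: real_nat_ceiling_ge)
      moreover have "(c1 + c2 - \<epsilon>) * ln (real n) = (c1 - e) * ln (real n) + (c2 - e) * ln (real n)"
        by (simp add: e_def algebra_simps)
      ultimately have "real (t n) \<le> real (t1 n + t2 n)" using elim by (simp add: c1_def c2_def)
      then show ?case by linarith
    qed
    have "(\<lambda>n. 2 * (x ^ t1 n / real n) + 2 * L * (y ^ t2 n / real n)) \<longlonglongrightarrow> 2 * 0 + 2 * L * 0"
      by (intro tendsto_intros power_over_tendsto_0[OF x1 x(2) t1] power_over_tendsto_0[OF y1 y(2) t2])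
    then have lim: "(\<lambda>n. 2 * (x ^ t1 n / real n) + 2 * L * (y ^ t2 n / real n)) \<longlonglongrightarrow> 0" by simp
    show ?thesis
    proof (rule tendsto_sandwich[OF _ _ tendsto_const lim])
      show "\<forall>\<^sub>F n in sequentially. measure_pmf.prob (law n (t n)) {{..<n}} \<le> 2 * (x ^ t1 n / real n) + 2 * L * (y ^ t2 n / real n)"
        using ev v tt xev yev
      proof eventually_elim
        case (elim n)
        interpret gossip_expander n "G n" q P "d n" "D n" "\<eta> n" by fact
        have "measure_pmf.prob (law n (t n)) {{..<n}} \<le> measure_pmf.prob (law n (t1 n + t2 n)) {{..<n}}"
          by (rule prob_full_mono) (use elim in auto)
        also have "\<dots> \<le> (1 + rate * (D n / d n)) ^ t1 n / (real n / 2) + ((1 + 1 / L) / survive (D n / (d n - 1))) ^ t2 n * L / (real n / 2)"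
          by (rule completion_lower) (use elim L 1 in auto)
        also have "\<dots> \<le> x ^ t1 n / (real n / 2) + y ^ t2 n * L / (real n / 2)"
        proof -
          have "0 \<le> 1 + rate * (D n / d n)" using rate_bounds D_pos d_pos by simp
          moreover have "0 \<le> (1 + 1 / L) / survive (D n / (d n - 1))" using L 1 by (simp add: survival_def)
          ultimately show ?thesis using elim L
            by (intro add_mono divide_right_mono mult_right_mono power_mono) (auto simp: \<gamma>_def)
        qed
        finally show ?case by (simp add: mult_ac)
      qed
    qed simp
  next
    case 2
    have "finish_const P q = 0" using 2 by (simp add: finish_const_def)
    then have t': "\<forall>\<^sub>F n in sequentially. real (t n) \<le> (c1 - \<epsilon>) * ln (real n) + 0" using t by (simp add: c1_def)
    have "(c1 - \<epsilon>) * ln x \<le> (c1 - e) * ln x" using x1 \<epsilon> by (intro mult_right_mono) (auto simp: e_def)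
    then have "(c1 - \<epsilon>) * ln x < 1" using x(2) by linarith
    note lim = power_over_tendsto_0[OF x1 this t']
    show ?thesis
    proof (rule tendsto_sandwich[OF _ _ tendsto_const lim])
      show "\<forall>\<^sub>F n in sequentially. measure_pmf.prob (law n (t n)) {{..<n}} \<le> x ^ t n / real n"
        using ev v xev
      proof eventually_elim
        case (elim n)
        interpret gossip_expander n "G n" q P "d n" "D n" "\<eta> n" by fact
        have "measure_pmf.prob (law n (t n)) {{..<n}} \<le> (1 + rate * (D n / d n)) ^ t n / real n"
          by (rule completion_lower') (use elim in auto)
        also have "\<dots> \<le> x ^ t n / real n"
          using elim rate_bounds D_pos d_pos by (intro divide_right_mono power_mono) (auto simp: \<gamma>_def)
        finally show ?case .
      qed
    qed simp
  qed
qed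

end

section \<open>Expander sequences supply the parameters\<close>

lemma degree_bounds:
  assumes "v < n"
  shows "min_degree n E \<le> degree E v" "degree E v \<le> max_degree n E"
  using assms by (auto simp: min_degree_def max_degree_def)

lemma adj_row_sum:
  assumes "simple_graph_on n E"
  shows "(\<Sum>j<n. if E i j then 1 else 0) = real (degree E i)"
proof -
  have "{j \<in> {..<n}. E i j} = nbrs E i" using assms by (auto simp: nbrs_def simple_graph_on_def)
  then show ?thesis by (simp add: sum.If_cases Int_def degree_def)
qed

lemma adj_row_sum_set:
  assumes "finite S"
  shows "(\<Sum>j\<in>S. if E i j then 1 else 0) = real (card (nbrs E i \<inter> S))"
  using assms by (simp add: sum.If_cases nbrs_def Int_def conj_commute)

lemma spec_lambda_nonneg: "0 \<le> spec_lambda n E"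
  by (simp add: spec_lambda_def)

lemma expander_mixing:
  assumes E: "simple_graph_on n E" and n: "n \<ge> 1" and S: "S \<subseteq> {..<n}"
  defines "D \<equiv> real (max_degree n E)" and "d \<equiv> real (min_degree n E)" and "lam \<equiv> spec_lambda n E"
  assumes lam: "lam < D" and rho: "(D - d) / (D - lam) < 1"
  shows "(\<Sum>u<n. (real (card (nbrs E u \<inter> S)))\<^sup>2) \<le>
    D\<^sup>2 * real (card S) * (card S / n + (2 * ((D - d) / (D - lam)) / (1 - (D - d) / (D - lam)) + (lam / D)\<^sup>2))"
proof -
  obtain v \<mu> where v: "(\<Sum>i<n. (v i)\<^sup>2) = 1"
    "\<And>i. i < n \<Longrightarrow> (\<Sum>j<n. (if E i j then 1 else 0) * v j) = \<mu> * v i"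
    "\<And>y :: nat \<Rightarrow> real. (\<Sum>i<n. v i * y i) = 0 \<Longrightarrow>
       (\<Sum>i<n. (\<Sum>j<n. (if E i j then 1 else 0) * y j)\<^sup>2) \<le> (spec_lambda n E)\<^sup>2 * (\<Sum>i<n. (y i)\<^sup>2)"
    using adj_spectral_gap[OF E n spec_lambda_nonneg] by blast
  have "(\<Sum>i<n. (\<Sum>j\<in>S. if E i j then 1 else 0)\<^sup>2) \<le>
    D\<^sup>2 * real (card S) * (card S / n + (2 * ((D - d) / (D - lam)) / (1 - (D - d) / (D - lam)) + (lam / D)\<^sup>2))"
  proof (rule neighbour_count_square_sum[where v = v and \<mu> = \<mu>])
    show "(\<Sum>j<n. if E i j then 1 else 0) \<le> D" "d \<le> (\<Sum>j<n. if E i j then 1 else 0)" if "i < n" for i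
      using degree_bounds[OF that, of E] by (simp_all add: adj_row_sum[OF E] D_def d_def)
    show "(if E i j then 1 else 0) = (if E j i then 1 else (0::real))" for i j
      using E by (auto simp: simple_graph_on_def)
  qed (use v lam rho S n spec_lambda_nonneg in \<open>auto simp: lam_def\<close>)
  moreover have "finite S" using S finite_subset by blast
  ultimately show ?thesis by (simp add: adj_row_sum_set)
qed

text \<open>The error \<eta> is the bracket from \<open>expander_mixing\<close>; it vanishes because
  the relative degree defect and \<open>lam / D\<close> do. The limit with \<open>d n - 1\<close>
  additionally needs unbounded degrees.\<close>

lemma expander_seq_parameters:
  assumes G: "expander_seq G" and q: "0 < q" "q \<le> 1"
  obtains d D \<eta> :: "nat \<Rightarrow> real" where
    "\<forall>\<^sub>F n in sequentially. gossip_expander n (G n) q (d n) (D n) (\<eta> n)"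
    "\<eta> \<longlonglongrightarrow> 0" "(\<lambda>n. d n / D n) \<longlonglongrightarrow> 1" "(\<lambda>n. D n / (d n - 1)) \<longlonglongrightarrow> 1"
proof -
  define D where "D = (\<lambda>n. real (max_degree n (G n)))"
  define d where "d = (\<lambda>n. real (min_degree n (G n)))"
  define lam where "lam = (\<lambda>n. spec_lambda n (G n))"
  define \<rho> where "\<rho> = (\<lambda>n. (D n - d n) / (D n - lam n))"
  define \<eta> where "\<eta> = (\<lambda>n. 2 * \<rho> n / (1 - \<rho> n) + (lam n / D n)\<^sup>2)"
  have Dd: "(\<lambda>n. D n / d n) \<longlonglongrightarrow> 1" and lD: "(\<lambda>n. lam n / D n) \<longlonglongrightarrow> 0"
    using G by (auto simp: expander_seq_def D_def d_def lam_def)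
  have dD: "(\<lambda>n. d n / D n) \<longlonglongrightarrow> 1"
    using tendsto_inverse[OF Dd] by (simp add: inverse_eq_divide)
  \<comment> \<open>Division by zero gives 0, so a ratio close to 1 excludes minimum degree
    0.\<close>
  have "\<forall>\<^sub>F n in sequentially. 0 < D n / d n" by (rule order_tendstoD(1)[OF Dd]) simp
  then have pos: "\<forall>\<^sub>F n in sequentially. 0 < D n \<and> 1 \<le> d n"
    by eventually_elim (auto simp: D_def d_def zero_less_divide_iff)
  have "(\<lambda>n. (1 - d n / D n) / (1 - lam n / D n)) \<longlonglongrightarrow> (1 - 1) / (1 - 0)"
    by (intro tendsto_intros dD lD) simp
  moreover have "\<forall>\<^sub>F n in sequentially. (1 - d n / D n) / (1 - lam n / D n) = \<rho> n"
    using pos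
  proof eventually_elim
    case (elim n)
    then have "1 - d n / D n = (D n - d n) / D n" "1 - lam n / D n = (D n - lam n) / D n"
      by (simp_all add: diff_divide_distrib)
    then show ?case using elim by (simp add: \<rho>_def)
  qed
  ultimately have rho0: "\<rho> \<longlonglongrightarrow> 0" using Lim_transform_eventually by fastforce
  have "\<eta> \<longlonglongrightarrow> 2 * 0 / (1 - 0) + 0\<^sup>2"
    unfolding \<eta>_def by (intro tendsto_intros rho0 lD) simp
  then have eta0: "\<eta> \<longlonglongrightarrow> 0" by simp
  have lamD: "\<forall>\<^sub>F n in sequentially. lam n / D n < 1" by (rule order_tendstoD(2)[OF lD]) simp
  have rho1: "\<forall>\<^sub>F n in sequentially. \<rho> n < 1" by (rule order_tendstoD(2)[OF rho0]) simp
  have base: "\<forall>\<^sub>F n in sequentially. simple_graph_on n (G n) \<and> n \<ge> 1 \<and> 0 < D n \<and> 1 \<le> d n \<and> d n \<le> D n \<and> 0 \<le> \<eta> n \<and>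
    (\<forall>S\<subseteq>{..<n}. (\<Sum>u<n. (real (card (nbrs (G n) u \<inter> S)))\<^sup>2) \<le> (D n)\<^sup>2 * real (card S) * (card S / n + \<eta> n))"
    using pos lamD rho1 eventually_ge_at_top[of 1]
  proof eventually_elim
    case (elim n)
    have g: "simple_graph_on n (G n)"
      using G elim by (auto simp: expander_seq_def connected_graph_on_def)
    have l: "lam n < D n" using elim by (simp add: divide_less_eq)
    have dlD: "d n \<le> D n" using degree_bounds[of 0 n "G n"] elim by (simp add: d_def D_def)
    have "0 \<le> \<rho> n" using dlD l by (simp add: \<rho>_def)
    then have "0 \<le> \<eta> n" using elim by (simp add: \<eta>_def)
    moreover have "(\<Sum>u<n. (real (card (nbrs (G n) u \<inter> S)))\<^sup>2) \<le> (D n)\<^sup>2 * real (card S) * (card S / n + \<eta> n)"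
      if "S \<subseteq> {..<n}" for S
      using expander_mixing[OF g _ that] elim l unfolding \<eta>_def \<rho>_def D_def d_def lam_def by simp
    ultimately show ?case using g elim dlD by auto
  qed
  \<comment> \<open>For one vertex the left side of the mixing bound is its degree, at least 1.
    Hence \<open>1 \<le> (D n)\<^sup>2 * (1 / n + \<eta> n)\<close>, and since
    \<open>D n / d n\<close> is bounded, \<open>d n\<close> tends to infinity.\<close>
  have ub: "\<forall>\<^sub>F n in sequentially. (1 / d n)\<^sup>2 \<le> (D n / d n)\<^sup>2 * (1 / n + \<eta> n)"
    using base
  proof eventually_elim
    case (elim n)
    have "{0} \<subseteq> {..<n}" using elim by auto
    then have "(\<Sum>u<n. (real (card (nbrs (G n) u \<inter> {0})))\<^sup>2) \<le> (D n)\<^sup>2 * real (card {0::nat}) * (card {0::nat} / n + \<eta> n)"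
      using elim by blast
    moreover have "(\<Sum>u<n. (real (card (nbrs (G n) u \<inter> {0})))\<^sup>2) = (\<Sum>u<n. if G n 0 u then 1 else 0)"
      using elim by (intro sum.cong refl) (auto simp: nbrs_def simple_graph_on_def)
    moreover have "\<dots> = real (degree (G n) 0)" using adj_row_sum[of n "G n" 0] elim by simp
    moreover have "1 \<le> real (degree (G n) 0)" using degree_bounds(1)[of 0 n "G n"] elim by (simp add: d_def)
    ultimately have "1 \<le> (D n)\<^sup>2 * (1 / n + \<eta> n)" by simp
    then have "1 / (d n)\<^sup>2 \<le> (D n)\<^sup>2 * (1 / n + \<eta> n) / (d n)\<^sup>2" using elim by (intro divide_right_mono) auto
    then show ?case by (simp add: power_divide)
  qed
  have "(\<lambda>n. (D n / d n)\<^sup>2 * (1 / real n + \<eta> n)) \<longlonglongrightarrow> 1\<^sup>2 * (0 + 0)"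
    by (intro tendsto_intros Dd eta0 lim_1_over_n)
  then have "(\<lambda>n. (1 / d n)\<^sup>2) \<longlonglongrightarrow> 0"
    by (intro tendsto_sandwich[OF _ ub tendsto_const]) auto
  then have "(\<lambda>n. sqrt ((1 / d n)\<^sup>2)) \<longlonglongrightarrow> sqrt 0" by (intro tendsto_intros)
  then have d0: "(\<lambda>n. 1 / d n) \<longlonglongrightarrow> 0" by (simp add: d_def)
  have d1: "\<forall>\<^sub>F n in sequentially. 1 / d n < 1" by (rule order_tendstoD(2)[OF d0]) simp
  have "(\<lambda>n. (D n / d n) / (1 - 1 / d n)) \<longlonglongrightarrow> 1 / (1 - 0)" by (intro tendsto_intros Dd d0) simp
  moreover have "\<forall>\<^sub>F n in sequentially. (D n / d n) / (1 - 1 / d n) = D n / (d n - 1)"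
    using pos d1 by eventually_elim (auto simp: field_simps)
  ultimately have Dd1: "(\<lambda>n. D n / (d n - 1)) \<longlonglongrightarrow> 1" using Lim_transform_eventually by fastforce
  have "\<forall>\<^sub>F n in sequentially. gossip_expander n (G n) q (d n) (D n) (\<eta> n)"
    using base d1
  proof eventually_elim
    case (elim n)
    show ?case
    proof
      show "1 \<le> degree (G n) v" if "v < n" for v
        using degree_bounds(1)[OF that, of "G n"] elim by (simp add: d_def)
      show "d n \<le> degree (G n) v" "degree (G n) v \<le> D n" if "v < n" for v
        using degree_bounds[OF that, of "G n"] by (simp_all add: d_def D_def)
      show "1 < d n" using elim by (simp add: divide_less_eq)
    qed (use elim q in auto)
  qed
  then show ?thesis using eta0 dD Dd1 that by blast
qed

section \<open>From fixed precision to an o(log n) window\<close>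

lemma diagonal_sequence:
  fixes Q :: "real \<Rightarrow> nat \<Rightarrow> bool"
  assumes e0: "0 < e0" and Q: "\<And>e. 0 < e \<Longrightarrow> e < e0 \<Longrightarrow> \<forall>\<^sub>F n in sequentially. Q e n"
  obtains f :: "nat \<Rightarrow> real" where "\<And>n. 0 < f n" "f \<longlonglongrightarrow> 0" "\<forall>\<^sub>F n in sequentially. Q (f n) n"
proof -
  \<comment> \<open>The 2 keeps even the first value strictly below \<open>e0\<close>.\<close>
  define e where "e = (\<lambda>m::nat. e0 / (real m + 2))"
  have e: "0 < e m" "e m < e0" for m using e0 by (auto simp: e_def divide_less_eq)
  have "\<exists>N. \<forall>n\<ge>N. Q (e m) n" for m using Q[OF e] by (simp add: eventually_sequentially)
  then obtain N where N: "\<And>m n. N m \<le> n \<Longrightarrow> Q (e m) n" by metis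
  define ok where "ok = (\<lambda>n. {m. m \<le> n \<and> N m \<le> n})"
  have fin: "finite (ok n)" for n by (auto simp: ok_def)
  \<comment> \<open>The finest precision whose threshold has been passed, capped by \<open>n\<close>
    to keep the set finite; inserting 0 makes the maximum exist for small \<open>n\<close>
    too.\<close>
  define M where "M = (\<lambda>n. Max (insert 0 (ok n)))"
  have Mge: "m \<le> M n" if "m \<le> n" "N m \<le> n" for m n
    unfolding M_def using fin that by (intro Max_ge) (auto simp: ok_def)
  have MQ: "Q (e (M n)) n" if "N 0 \<le> n" for n
  proof -
    have "M n \<in> insert 0 (ok n)" unfolding M_def using fin by (intro Max_in) auto
    then have "N (M n) \<le> n" using that by (auto simp: ok_def)
    then show ?thesis by (rule N)
  qed
  have "filterlim M at_top sequentially"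
    unfolding filterlim_at_top
  proof
    fix Z :: nat
    show "\<forall>\<^sub>F n in sequentially. Z \<le> M n"
      using eventually_ge_at_top[of "max Z (N Z)"] by eventually_elim (auto intro: Mge)
  qed
  moreover have "e \<longlonglongrightarrow> 0" unfolding e_def by real_asymp
  ultimately have "(\<lambda>n. e (M n)) \<longlonglongrightarrow> 0" by (rule filterlim_compose[rotated])
  moreover have "\<forall>\<^sub>F n in sequentially. Q (e (M n)) n"
    using eventually_ge_at_top[of "N 0"] by eventually_elim (rule MQ)
  ultimately show ?thesis using that[of "\<lambda>n. e (M n)"] e by blast
qed

lemma finish_const_pos:
  assumes "0 < q" "q \<le> 1" "pulls P * q < 1"
  shows "0 < finish_const P q"
proof -
  have "ln (survival P q 1) < 0" using survival_bounds(2,3)[OF assms(1,2)] assms(3) by simp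
  then show ?thesis using assms(3) by (simp add: finish_const_def divide_neg_neg)
qed

lemma prob_T_le_nat_evolve:
  "prob_T_le_nat P n E q v t = measure_pmf.prob (evolve (round_step P n E q) t {v}) {{..<n}}"
  by (simp add: prob_T_le_nat_def informed_after_evolve measure_pmf_single)

lemma prob_T_in_le_1: "prob_T_in P n E q v a b \<le> 1"
proof -
  have "prob_T_le P n E q v b \<le> 1" by (simp add: prob_T_le_def prob_T_le_nat_def pmf_le_1)
  moreover have "0 \<le> prob_T_lt P n E q v a" by (simp add: prob_T_lt_def prob_T_le_nat_def)
  ultimately show ?thesis by (simp add: prob_T_in_def)
qed

text \<open>\<open>prob_T_in\<close> is a difference of two distribution functions; finishing too
  late and finishing too early lose at most \<open>e / 2\<close> each.\<close>

lemma (in gossip_seq) prob_T_in_eventually: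
  assumes e: "0 < e" "e < growth_const P q" "pulls P * q < 1 \<Longrightarrow> e < finish_const P q"
  shows "\<forall>\<^sub>F n in sequentially. 1 - e \<le> prob_T_in P n (G n) q (v n)
    (c_const P q * ln (real n) - e * ln (real n)) (c_const P q * ln (real n) + e * ln (real n))"
proof -
  define c where "c = c_const P q"
  have c: "c = growth_const P q + finish_const P q" by (simp add: c_def c_const_eq[OF q])
  have ce: "0 < c - e" using e(2) finish_const_nonneg[OF q, of P] by (simp add: c)
  define t where "t = (\<lambda>n. nat \<lfloor>(c + e) * ln (real n)\<rfloor>)"
  \<comment> \<open>The last round strictly before the lower end of the window, matching
    \<open>prob_T_lt\<close>.\<close>
  define t' where "t' = (\<lambda>n. nat (\<lceil>(c - e) * ln (real n)\<rceil> - 1))"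
  have lnpos: "\<forall>\<^sub>F n in sequentially. 0 < ln (real n)"
    using eventually_gt_at_top[of 1] by eventually_elim simp
  have "(\<lambda>n. measure_pmf.prob (law n (t n)) (- {{..<n}})) \<longlonglongrightarrow> 0"
  proof (rule incomplete_tendsto_0[OF e(1)])
    show "\<forall>\<^sub>F n in sequentially. (growth_const P q + finish_const P q + e) * ln (real n) - 1 \<le> real (t n)"
      unfolding t_def c by (intro always_eventually allI) linarith
  qed
  then have up: "\<forall>\<^sub>F n in sequentially. measure_pmf.prob (law n (t n)) (- {{..<n}}) < e / 2"
    by (rule order_tendstoD) (use e in simp)
  have "(\<lambda>n. measure_pmf.prob (law n (t' n)) {{..<n}}) \<longlonglongrightarrow> 0"
  proof (rule complete_tendsto_0[OF e])
    show "\<forall>\<^sub>F n in sequentially. real (t' n) \<le> (growth_const P q + finish_const P q - e) * ln (real n)"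
      using lnpos
    proof eventually_elim
      case (elim n)
      then have "0 < (c - e) * ln (real n)" using ce by simp
      then show ?case unfolding t'_def c[symmetric] by linarith
    qed
  qed
  then have low: "\<forall>\<^sub>F n in sequentially. measure_pmf.prob (law n (t' n)) {{..<n}} < e / 2"
    by (rule order_tendstoD) (use e in simp)
  show ?thesis
    using up low lnpos unfolding c_def[symmetric]
  proof eventually_elim
    case (elim n)
    have "0 \<le> (c + e) * ln (real n)" using elim ce e by simp
    then have "prob_T_le P n (G n) q (v n) (c * ln (real n) + e * ln (real n)) = measure_pmf.prob (law n (t n)) {{..<n}}"
      by (simp add: prob_T_le_def prob_T_le_nat_evolve t_def distrib_right)
    also have "\<dots> = 1 - measure_pmf.prob (law n (t n)) (- {{..<n}})"
      using measure_pmf.prob_compl[of "{{..<n}}" "law n (t n)"] by (simp add: Compl_eq_Diff_UNIV)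
    finally have "1 - e / 2 \<le> prob_T_le P n (G n) q (v n) (c * ln (real n) + e * ln (real n))"
      using elim by simp
    moreover have "prob_T_lt P n (G n) q (v n) (c * ln (real n) - e * ln (real n)) \<le> e / 2"
      using elim(2) e by (simp add: prob_T_lt_def prob_T_le_nat_evolve t'_def left_diff_distrib)
    ultimately show ?case by (simp add: prob_T_in_def)
  qed
qed

theorem theorem1p4:
  fixes G :: "nat \<Rightarrow> nat \<Rightarrow> nat \<Rightarrow> bool" and q :: real
  assumes "expander_seq G" and "0 < q" and "q \<le> 1"
  shows "\<forall>v0 :: nat \<Rightarrow> nat. (\<forall>n\<ge>1. v0 n < n) \<longrightarrow>
           (\<forall>P \<in> {Push, Pull, PushPull}.
              \<exists>g :: nat \<Rightarrow> real. (\<forall>n. g n > 0) \<and> g \<in> o(\<lambda>n. ln (real n)) \<and>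
                ((\<lambda>n. prob_T_in P n (G n) q (v0 n)
                        (c_const P q * ln (real n) - g n) (c_const P q * ln (real n) + g n))
                   \<longlonglongrightarrow> 1))"
proof (intro allI impI ballI)
  fix v0 :: "nat \<Rightarrow> nat" and P
  assume v0: "\<forall>n\<ge>1. v0 n < n"
  note q = assms(2,3)
  obtain d D \<eta> where par:
    "\<forall>\<^sub>F n in sequentially. gossip_expander n (G n) q (d n) (D n) (\<eta> n)"
    "\<eta> \<longlonglongrightarrow> 0" "(\<lambda>n. d n / D n) \<longlonglongrightarrow> 1" "(\<lambda>n. D n / (d n - 1)) \<longlonglongrightarrow> 1"
    using expander_seq_parameters[OF assms] by blast
  have "\<forall>\<^sub>F n in sequentially. v0 n < n"
    using eventually_ge_at_top[of 1] by eventually_elim (use v0 in simp)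
  then interpret gossip_seq G q P d D \<eta> v0
    by unfold_locales (use par q in auto)
  \<comment> \<open>The lower bound needs \<open>e\<close> below each constant that occurs; for
    certain pulling there is no second one, and 1 is a placeholder.\<close>
  define e0 where "e0 = min (growth_const P q) (if pulls P * q < 1 then finish_const P q else 1)"
  have "0 < growth_const P q" using growth_rate_pos[OF q(1), of P] by (simp add: growth_const_def)
  then have e0: "0 < e0" using finish_const_pos[OF q] by (simp add: e0_def)
  let ?I = "\<lambda>g n. prob_T_in P n (G n) q (v0 n) (c_const P q * ln (real n) - g) (c_const P q * ln (real n) + g)"
  have ev: "\<forall>\<^sub>F n in sequentially. 1 - e \<le> ?I (e * ln (real n)) n" if "0 < e" "e < e0" for e
    by (rule prob_T_in_eventually) (use that in \<open>auto simp: e0_def split: if_splits\<close>)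
  obtain f where f: "\<And>n. 0 < f n" "f \<longlonglongrightarrow> 0" "\<forall>\<^sub>F n in sequentially. 1 - f n \<le> ?I (f n * ln (real n)) n"
    using diagonal_sequence[of e0 "\<lambda>e n. 1 - e \<le> ?I (e * ln (real n)) n", OF e0 ev] by blast
  \<comment> \<open>The window must be positive everywhere, but \<open>ln n\<close> is not for
    \<open>n \<le> 1\<close>.\<close>
  define g where "g = (\<lambda>n. if n \<le> 1 then 1 else f n * ln (real n))"
  have g_eq: "\<forall>\<^sub>F n in sequentially. g n = f n * ln (real n) \<and> 0 < ln (real n)"
    using eventually_gt_at_top[of 1] by eventually_elim (simp add: g_def)
  have "\<forall>n. g n > 0" using f(1) by (simp add: g_def)
  moreover have "g \<in> o(\<lambda>n. ln (real n))"
  proof (rule smalloI_tendsto)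
    have "\<forall>\<^sub>F n in sequentially. f n = g n / ln (real n)"
      using g_eq by eventually_elim simp
    then show "(\<lambda>n. g n / ln (real n)) \<longlonglongrightarrow> 0" by (rule Lim_transform_eventually[OF f(2)])
    show "\<forall>\<^sub>F n in sequentially. ln (real n) \<noteq> 0" using g_eq by eventually_elim simp
  qed
  moreover have "(\<lambda>n. ?I (g n) n) \<longlonglongrightarrow> 1"
  proof (rule tendsto_sandwich)
    have "(\<lambda>n. 1 - f n) \<longlonglongrightarrow> 1 - 0" by (intro tendsto_intros f(2))
    then show "(\<lambda>n. 1 - f n) \<longlonglongrightarrow> 1" by simp
    show "\<forall>\<^sub>F n in sequentially. 1 - f n \<le> ?I (g n) n" using f(3) g_eq by eventually_elim simp
    show "\<forall>\<^sub>F n in sequentially. ?I (g n) n \<le> 1" by (simp add: prob_T_in_le_1)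
  qed simp
  ultimately show "\<exists>g :: nat \<Rightarrow> real. (\<forall>n. g n > 0) \<and> g \<in> o(\<lambda>n. ln (real n)) \<and> (\<lambda>n. ?I (g n) n) \<longlonglongrightarrow> 1"
    by blast
qed

end
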